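(* With $\gamma_n=p/n$, define for $\star\in\{F,O,N\}$ the shrinkage rules $$\eta_n^*(\lambda|\star)=1+\gamma_n\,\bar\eta^*(\lambda/\gamma_n-1\,|\,\star),$$ where for $\rho>0$ $$\bar\eta^*(\rho|F)=\frac{\rho^2}{1+\rho},\qquad\bar\eta^*(\rho|O)=\rho,\qquad\bar\eta^*(\rho|N)=\rho\Big(\frac{\rho-1}{\rho+1}\Big)_+,$$ and $\bar\eta^*(\rho|\star)=0$ for $\rho\le0$. Then, in the disproportional framework $\gamma_n\to\infty$ (defined in the context), $\eta^*(\cdot|\star)$ is uniquely asymptotically admissible under the loss $L_{\star,1}(\Sigma,\widehat\Sigma)=\|\Sigma-\widehat\Sigma\|_\star$, for $\star\in\{F,N\}$ and every $r$, and for $\star=O$ when $r=1$.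
   Context: Spiked covariance model: $x_1,\dots,x_n$ are i.i.d. $\mathcal N(0,\Sigma)$ in $\mathbb R^p$, where $\Sigma=\Sigma_p$ has eigenvalues $\ell_1\ge\dots\ge\ell_r\ge1$ and $\ell_{r+1}=\dots=\ell_p=1$, with $r$ fixed. $S=\frac1n\sum_{i=1}^n x_ix_i'$ has eigenvalues $\lambda_1\ge\dots\ge\lambda_p$ and corresponding orthonormal eigenvectors $v_1,\dots,v_p$. $\mathrm{DGF}(\gamma_n\to\infty,(\rho_i)_{i=1}^r)$ denotes a sequence of spiked covariance models such that $n,p\to\infty$, $\gamma_n=p/n\to\infty$, and the spiked eigenvalues are $\ell_i=\ell_{i,n}=1+(\rho_i+o(1))\gamma_n$ with constants $\rho_1>\dots>\rho_r\ge0$. Almost sure statements concern the sequence indexed by $n=1,2,3,\dots$ with $p=p_n$. For a sequence of rules $\eta=\eta_n:[0,\infty)\to[0,\infty)$, $\widehat\Sigma_\eta=I+\sum_{i=1}^r(\eta(\lambda_i)-1)v_iv_i'$. Its asymptotic shrinkage descriptors, when they exist, are the constants $\bar\eta_i$ with $(\eta_n(\lambda_i)-1)/\gamma_n\xrightarrow{a.s.}\bar\eta_i$, $1\le i\le r$. $\|\cdot\|_F,\|\cdot\|_O,\|\cdot\|_N$ are the Frobenius, operator and nuclear norms. For $\rho\ge0$, $\vartheta\in\mathbb R$ let $\mathcal L_\star(\rho,\vartheta)=\left\|\begin{bmatrix}\rho-\vartheta c^2&-\vartheta cs\\-\vartheta cs&-\vartheta s^2\end{bmatrix}\right\|_\star$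 with $c=\sqrt{\rho/(1+\rho)}$, $s=\sqrt{1/(1+\rho)}$, and $\mathcal L^1_\star(\rho)=\min_\vartheta\mathcal L_\star(\rho,\vartheta)$. Put $\mathcal L_F((\rho_i),(\vartheta_i))=(\sum_i\mathcal L_F(\rho_i,\vartheta_i)^2)^{1/2}$, $\mathcal L_O((\rho_i),(\vartheta_i))=\max_i\mathcal L_O(\rho_i,\vartheta_i)$, $\mathcal L_N((\rho_i),(\vartheta_i))=\sum_i\mathcal L_N(\rho_i,\vartheta_i)$. (For a rule with descriptors $(\bar\eta_i)$, $\gamma_n^{-1}L_{\star,1}(\Sigma,\widehat\Sigma_\eta)\to\mathcal L_\star((\rho_i),(\bar\eta_i))$ almost surely.) A rule $\eta^*$ is everywhere asymptotically optimal under $L_{\star,1}$ if, for all spiked eigenvalues satisfying the conditions of $\mathrm{DGF}(\gamma_n\to\infty,\cdot)$, $\gamma_n^{-1}L_{\star,1}(\Sigma,\widehat\Sigma_{\eta^*})$ converges a.s. to $(\sum_i\mathcal L_F^1(\rho_i)^2)^{1/2}$, $\max_i\mathcal L_O^1(\rho_i)$, or $\sum_i\mathcal L_N^1(\rho_i)$ for $\star=F,O,N$ respectively. Two rules are somewhere asymptotically distinct if there exist spiked eigenvalues satisfying the conditions of $\mathrm{DGF}(\gamma_n\to\infty,\cdot)$ for which their asymptotic shrinkage descriptors differ. An everywhere asymptotically optimal rule $\eta^*$ is uniquely asymptotically admissible if, for any rule $\eta^\circ$ somewhere asymptotically distinct from it, there are spiked eigenvalues inducing differing descriptors $(\bar\eta_i^*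 )\ne(\bar\eta_i^\circ)$ at which $\mathcal L_\star((\rho_i),(\bar\eta_i^* ))<\mathcal L_\star((\rho_i),(\bar\eta_i^\circ))$. *)

theory Defs
  imports "HOL-Probability.Probability" "Jordan_Normal_Form.Char_Poly"
begin

unbundle no vec_syntax
no_notation Inner_Product.real_inner_class.inner (infix "\<bullet>" 70)
hide_const (open) Finite_Cartesian_Product.mat Finite_Cartesian_Product.vec
hide_type (open) Finite_Cartesian_Product.vec

text \<open>
  The dimension \<open>p n\<close> varies with \<open>n\<close>, so matrices and eigenvectors use the carrier-based types
  of Jordan Normal Form.  All indices are 0-based: the spikes are \<open>i < r\<close>.
\<close>

section \<open>Matrix norms\<close>

datatype norm_kind = Frobenius | Operator | Nuclear

definition frobenius_norm :: "real mat \<Rightarrow> real" where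
  "frobenius_norm A = sqrt (\<Sum>i<dim_row A. \<Sum>j<dim_col A. (A $$ (i, j))\<^sup>2)"

definition operator_norm :: "real mat \<Rightarrow> real" where
  "operator_norm A =
     (SUP x\<in>{x \<in> carrier_vec (dim_col A). x \<bullet> x \<le> 1}. sqrt ((A *\<^sub>v x) \<bullet> (A *\<^sub>v x)))"

text \<open>The multiset of roots of the characteristic polynomial of \<open>A\<^sup>T A\<close> consists of the squared
  singular values of \<open>A\<close>.\<close>

definition nuclear_norm :: "real mat \<Rightarrow> real" where
  "nuclear_norm A = (\<Sum>s\<in>#proots (char_poly (transpose_mat A * A)). sqrt s)"

fun mat_norm :: "norm_kind \<Rightarrow> real mat \<Rightarrow> real" where
  "mat_norm Frobenius = frobenius_norm"
| "mat_norm Operator = operator_norm"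
| "mat_norm Nuclear = nuclear_norm"

section \<open>The spiked covariance model\<close>

text \<open>\<open>A\<close> has the ordered eigenvalues \<open>lam 0 \<ge> \<dots> \<ge> lam (d - 1)\<close>, with multiplicity, and
  \<open>v 0, \<dots>, v (d - 1)\<close> are corresponding orthonormal eigenvectors.\<close>

definition eigensystem :: "nat \<Rightarrow> real mat \<Rightarrow> (nat \<Rightarrow> real) \<Rightarrow> (nat \<Rightarrow> real vec) \<Rightarrow> bool" where
  "eigensystem d A lam v \<longleftrightarrow>
     A \<in> carrier_mat d d \<and>
     (\<forall>i<d. eigenvector A (v i) (lam i)) \<and>
     (\<forall>i<d. \<forall>j<d. v i \<bullet> v j = (if i = j then 1 else 0)) \<and>
     (\<forall>i j. i \<le> j \<and> j < d \<longrightarrow> lam j \<le> lam i)"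

text \<open>Mean-zero multivariate normality for a positive definite \<open>S\<close>: every nontrivial linear
  combination \<open>a' x\<close> of the coordinates is \<open>N(0, a' S a)\<close>.  (\<open>normal_density\<close> takes the standard
  deviation, not the variance.)  A vector in \<open>d\<close>-space is a point of the product space
  \<open>PiM {..<d} (\<lambda>_. borel)\<close>, hence equal to \<open>undefined\<close> outside \<open>{..<d}\<close>.\<close>

definition normal_vector :: "'a measure \<Rightarrow> nat \<Rightarrow> real mat \<Rightarrow> ('a \<Rightarrow> nat \<Rightarrow> real) \<Rightarrow> bool" where
  "normal_vector M d S x \<longleftrightarrow>
     x \<in> measurable M (PiM {..<d} (\<lambda>_. borel)) \<and>
     (\<forall>a :: nat \<Rightarrow> real. (\<exists>j<d. a j \<noteq> 0) \<longrightarrow>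
        distributed M lborel (\<lambda>\<omega>. \<Sum>j<d. a j * x \<omega> j)
          (normal_density 0 (sqrt (\<Sum>j<d. \<Sum>k<d. a j * S $$ (j, k) * a k))))"

definition spiked_model ::
  "'a measure \<Rightarrow> nat \<Rightarrow> nat \<Rightarrow> nat \<Rightarrow> (nat \<Rightarrow> real) \<Rightarrow> real mat \<Rightarrow> (nat \<Rightarrow> 'a \<Rightarrow> nat \<Rightarrow> real) \<Rightarrow> bool" where
  "spiked_model M n d r ell S x \<longleftrightarrow>
     r \<le> d \<and>
     (\<forall>i<r. 1 \<le> ell i) \<and>
     (\<exists>u. eigensystem d S (\<lambda>i. if i < r then ell i else 1) u) \<and>
     prob_space.indep_vars M (\<lambda>_. PiM {..<d} (\<lambda>_. borel)) x {..<n} \<and>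
     (\<forall>i<n. normal_vector M d S (x i))"

definition sample_cov :: "nat \<Rightarrow> nat \<Rightarrow> (nat \<Rightarrow> nat \<Rightarrow> real) \<Rightarrow> real mat" where
  "sample_cov n d x = mat d d (\<lambda>(j, k). (1 / real n) * (\<Sum>i<n. x i j * x i k))"

text \<open>A sequence of models on one probability space, indexed by the sample size \<open>n\<close>.  The joint
  law of the data belonging to different \<open>n\<close> is left arbitrary, and so is the choice of
  sample eigenvectors (signs, and bases of multiple eigenspaces).\<close>

record 'a model_seq =
  spike :: "nat \<Rightarrow> nat \<Rightarrow> real"
  pop_cov :: "nat \<Rightarrow> real mat"
  obs :: "nat \<Rightarrow> nat \<Rightarrow> 'a \<Rightarrow> nat \<Rightarrow> real"
  sample_eval :: "nat \<Rightarrow> 'a \<Rightarrow> nat \<Rightarrow> real"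
  sample_evec :: "nat \<Rightarrow> 'a \<Rightarrow> nat \<Rightarrow> real vec"

definition aspect :: "(nat \<Rightarrow> nat) \<Rightarrow> nat \<Rightarrow> real" where
  "aspect p n = real (p n) / real n"

definition DGF_infinity ::
  "'a measure \<Rightarrow> (nat \<Rightarrow> nat) \<Rightarrow> nat \<Rightarrow> (nat \<Rightarrow> real) \<Rightarrow> 'a model_seq \<Rightarrow> bool" where
  "DGF_infinity M p r rho D \<longleftrightarrow>
     filterlim p at_top sequentially \<and>
     filterlim (aspect p) at_top sequentially \<and>
     (\<forall>i j. i < j \<and> j < r \<longrightarrow> rho j < rho i) \<and>
     (\<forall>i<r. 0 \<le> rho i) \<and>
     (\<forall>i<r. (\<lambda>n. (spike D n i - 1) / aspect p n) \<longlonglongrightarrow> rho i) \<and>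
     (\<forall>n\<ge>1. spiked_model M n (p n) r (spike D n) (pop_cov D n) (obs D n)) \<and>
     (\<forall>n\<ge>1. \<forall>\<omega>\<in>space M.
        eigensystem (p n) (sample_cov n (p n) (\<lambda>i. obs D n i \<omega>))
          (sample_eval D n \<omega>) (sample_evec D n \<omega>))"

section \<open>Shrinkage rules and losses\<close>

text \<open>A rule is a sequence of functions on \<open>[0,\<infinity>)\<close>; values at negative arguments are irrelevant.\<close>

definition shrinkage_rule :: "(nat \<Rightarrow> real \<Rightarrow> real) \<Rightarrow> bool" where
  "shrinkage_rule \<eta> \<longleftrightarrow> (\<forall>n\<ge>1. \<forall>x\<ge>0. 0 \<le> \<eta> n x)"

definition shrinkage_estimator ::
  "nat \<Rightarrow> nat \<Rightarrow> (real \<Rightarrow> real) \<Rightarrow> (nat \<Rightarrow> real) \<Rightarrow> (nat \<Rightarrow> real vec) \<Rightarrow> real mat" where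
  "shrinkage_estimator d r h lam v =
     mat d d (\<lambda>(j, k). (if j = k then 1 else 0) + (\<Sum>i<r. (h (lam i) - 1) * v i $ j * v i $ k))"

definition loss1 :: "norm_kind \<Rightarrow> real mat \<Rightarrow> real mat \<Rightarrow> real" where
  "loss1 \<kappa> S S' = mat_norm \<kappa> (S - S')"

definition descriptors ::
  "'a measure \<Rightarrow> (nat \<Rightarrow> nat) \<Rightarrow> nat \<Rightarrow> (nat \<Rightarrow> real \<Rightarrow> real) \<Rightarrow> 'a model_seq \<Rightarrow> (nat \<Rightarrow> real) \<Rightarrow> bool" where
  "descriptors M p r \<eta> D \<theta> \<longleftrightarrow>
     (\<forall>i<r. AE \<omega> in M. (\<lambda>n. (\<eta> n (sample_eval D n \<omega> i) - 1) / aspect p n) \<longlonglongrightarrow> \<theta> i)"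

definition asym_loss :: "norm_kind \<Rightarrow> real \<Rightarrow> real \<Rightarrow> real" where
  "asym_loss \<kappa> \<rho> \<theta> =
     (let c = sqrt (\<rho> / (1 + \<rho>)); s = sqrt (1 / (1 + \<rho>)) in
      mat_norm \<kappa> (mat_of_rows_list 2
        [[\<rho> - \<theta> * c\<^sup>2, - \<theta> * c * s],
         [- \<theta> * c * s, - \<theta> * s\<^sup>2]]))"

definition min_asym_loss :: "norm_kind \<Rightarrow> real \<Rightarrow> real" where
  "min_asym_loss \<kappa> \<rho> = (INF \<theta>. asym_loss \<kappa> \<rho> \<theta>)"

text \<open>Aggregation of the losses over the \<open>r\<close> spikes; the operator case presupposes \<open>r \<ge> 1\<close>.\<close>

fun aggregate :: "norm_kind \<Rightarrow> nat \<Rightarrow> (nat \<Rightarrow> real) \<Rightarrow> real" where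
  "aggregate Frobenius r f = sqrt (\<Sum>i<r. (f i)\<^sup>2)"
| "aggregate Operator r f = Max (f ` {..<r})"
| "aggregate Nuclear r f = (\<Sum>i<r. f i)"

definition total_asym_loss :: "norm_kind \<Rightarrow> nat \<Rightarrow> (nat \<Rightarrow> real) \<Rightarrow> (nat \<Rightarrow> real) \<Rightarrow> real" where
  "total_asym_loss \<kappa> r rho \<theta> = aggregate \<kappa> r (\<lambda>i. asym_loss \<kappa> (rho i) (\<theta> i))"

section \<open>Optimality and admissibility\<close>

definition everywhere_optimal ::
  "'a measure \<Rightarrow> (nat \<Rightarrow> nat) \<Rightarrow> nat \<Rightarrow> norm_kind \<Rightarrow> (nat \<Rightarrow> real \<Rightarrow> real) \<Rightarrow> bool" where
  "everywhere_optimal M p r \<kappa> \<eta> \<longleftrightarrow>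
     (\<forall>rho D. DGF_infinity M p r rho D \<longrightarrow>
        (AE \<omega> in M.
           (\<lambda>n. loss1 \<kappa> (pop_cov D n)
                  (shrinkage_estimator (p n) r (\<eta> n) (sample_eval D n \<omega>) (sample_evec D n \<omega>))
                / aspect p n)
           \<longlonglongrightarrow> aggregate \<kappa> r (\<lambda>i. min_asym_loss \<kappa> (rho i))))"

definition differing_descriptors_at ::
  "'a measure \<Rightarrow> (nat \<Rightarrow> nat) \<Rightarrow> nat \<Rightarrow> (nat \<Rightarrow> real \<Rightarrow> real) \<Rightarrow> (nat \<Rightarrow> real \<Rightarrow> real) \<Rightarrow>
     (nat \<Rightarrow> real) \<Rightarrow> 'a model_seq \<Rightarrow> (nat \<Rightarrow> real) \<Rightarrow> (nat \<Rightarrow> real) \<Rightarrow> bool" where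
  "differing_descriptors_at M p r \<eta> \<eta>' rho D \<theta> \<theta>' \<longleftrightarrow>
     DGF_infinity M p r rho D \<and>
     descriptors M p r \<eta> D \<theta> \<and> descriptors M p r \<eta>' D \<theta>' \<and>
     (\<exists>i<r. \<theta> i \<noteq> \<theta>' i)"

definition somewhere_distinct ::
  "'a measure \<Rightarrow> (nat \<Rightarrow> nat) \<Rightarrow> nat \<Rightarrow> (nat \<Rightarrow> real \<Rightarrow> real) \<Rightarrow> (nat \<Rightarrow> real \<Rightarrow> real) \<Rightarrow> bool" where
  "somewhere_distinct M p r \<eta> \<eta>' \<longleftrightarrow>
     (\<exists>rho D \<theta> \<theta>'. differing_descriptors_at M p r \<eta> \<eta>' rho D \<theta> \<theta>')"

definition uniquely_admissible ::
  "'a measure \<Rightarrow> (nat \<Rightarrow> nat) \<Rightarrow> nat \<Rightarrow> norm_kind \<Rightarrow> (nat \<Rightarrow> real \<Rightarrow> real) \<Rightarrow> bool" where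
  "uniquely_admissible M p r \<kappa> \<eta> \<longleftrightarrow>
     shrinkage_rule \<eta> \<and>
     everywhere_optimal M p r \<kappa> \<eta> \<and>
     (\<forall>\<eta>'. shrinkage_rule \<eta>' \<and> somewhere_distinct M p r \<eta> \<eta>' \<longrightarrow>
        (\<exists>rho D \<theta> \<theta>'. differing_descriptors_at M p r \<eta> \<eta>' rho D \<theta> \<theta>' \<and>
           total_asym_loss \<kappa> r rho \<theta> < total_asym_loss \<kappa> r rho \<theta>'))"

section \<open>The optimal rules\<close>

fun opt_descriptor_pos :: "norm_kind \<Rightarrow> real \<Rightarrow> real" where
  "opt_descriptor_pos Frobenius \<rho> = \<rho>\<^sup>2 / (1 + \<rho>)"
| "opt_descriptor_pos Operator \<rho> = \<rho>"
| "opt_descriptor_pos Nuclear \<rho> = \<rho> * max 0 ((\<rho> - 1) / (\<rho> + 1))"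

definition opt_descriptor :: "norm_kind \<Rightarrow> real \<Rightarrow> real" where
  "opt_descriptor \<kappa> \<rho> = (if \<rho> > 0 then opt_descriptor_pos \<kappa> \<rho> else 0)"

definition opt_rule :: "(nat \<Rightarrow> nat) \<Rightarrow> norm_kind \<Rightarrow> nat \<Rightarrow> real \<Rightarrow> real" where
  "opt_rule p \<kappa> n lam = 1 + aspect p n * opt_descriptor \<kappa> (lam / aspect p n - 1)"

end

theory Submission
  imports Defs
begin

text \<open>
  In the eigenbasis of \<open>\<Sigma>\<close> the data matrix is \<open>X = \<Sigma>\<^sup>1\<^sup>/\<^sup>2 Z\<close> with white noise \<open>Z\<close>.  Since \<open>p / n \<rightarrow> \<infinity>\<close>,
  a union bound over a net with \<open>C\<^sup>n\<close> points shows that \<open>Z\<^sup>T Z / p\<close> tends to the identity in operator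
  norm almost surely, so the Gram matrix \<open>X\<^sup>T X / p\<close> is close to \<open>I + \<Sum> \<rho>\<^sub>i h\<^sub>i h\<^sub>i\<^sup>T\<close>, where the \<open>h\<^sub>i\<close> are the
  normalised rows of \<open>Z\<close> along the spikes, which are almost orthonormal.  Courant-Fischer gives
  \<open>\<lambda>\<^sub>i / \<gamma> \<rightarrow> 1 + \<rho>\<^sub>i\<close>, and the eigenvalue equation tested against \<open>h\<^sub>j\<close> gives \<open>\<langle>u\<^sub>i, v\<^sub>j\<rangle>\<^sup>2 \<rightarrow> \<delta>\<^sub>i\<^sub>j \<rho>\<^sub>i / (1 + \<rho>\<^sub>i)\<close>.
  The normalised loss depends only on the coefficients and the Gram matrix of the \<open>2 r\<close> vectors
  \<open>u\<^sub>i, v\<^sub>i\<close>, which in the limit splits into \<open>r\<close> orthogonal planes.  In each plane the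
  descriptor of the rule is the unique minimiser of the explicit two-dimensional loss.
\<close>

section \<open>Gaussian concentration\<close>

text \<open>The model supplies only the laws of nontrivial linear functionals, so no multivariate
  density is formed: tail bounds rest on one-dimensional exponential moments averaged over an
  auxiliary Gaussian. The zero functional is excluded because \<open>normal_density\<close> with
  deviation 0 is not the density of a point mass. One net point fails with probability of order
  exp(- c p), which beats the number of points because p / n tends to infinity; the surplus makes
  the failure probabilities summable, so Borel-Cantelli applies although the joint law over
  different n is arbitrary. From there on the argument is pathwise and deterministic, which copes
  with the arbitrary choice of sample eigenvectors. The strict ordering of the \<rho> separates the
  spikes, but the last may be 0; there only the product of spike strength and squared projection is
  shown to converge. For admissibility no new model is constructed: the one at which a competitor's
  descriptors differ already gives the strict inequality, since each coordinate minimiser is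
  unique.\<close>

definition isotropic_gaussian :: "'a measure \<Rightarrow> nat \<Rightarrow> (nat \<Rightarrow> 'a \<Rightarrow> real) \<Rightarrow> bool" where
  "isotropic_gaussian M m G \<longleftrightarrow>
     (\<forall>k<m. G k \<in> borel_measurable M) \<and>
     (\<forall>b. (\<exists>k<m. b k \<noteq> 0) \<longrightarrow>
        distributed M lborel (\<lambda>\<omega>. \<Sum>k<m. b k * G k \<omega>) (normal_density 0 (sqrt (\<Sum>k<m. (b k)\<^sup>2))))"

section \<open>Exponential moments of Gaussian functionals\<close>

lemma nn_integral_normal_density: "0 < \<sigma> \<Longrightarrow> (\<integral>\<^sup>+ x. ennreal (normal_density \<mu> \<sigma> x) \<partial>lborel) = 1"
  by (subst nn_integral_eq_integral) auto

text \<open>Completing the square: the weight exp (t x) turns the standard normal density into exp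
  (t^2 / 2) times the density centred at t.\<close>

lemma std_normal_mgf:
  "(\<integral>\<^sup>+ x. ennreal (exp (t * x)) \<partial>std_normal_distribution) = ennreal (exp (t\<^sup>2 / 2))"
proof -
  have "std_normal_density x * exp (t * x) = exp (t\<^sup>2 / 2) * normal_density t 1 x" for x
    by (simp add: normal_density_def exp_add[symmetric] field_simps power2_eq_square)
  then have "(\<integral>\<^sup>+ x. ennreal (exp (t * x)) \<partial>std_normal_distribution)
      = (\<integral>\<^sup>+ x. ennreal (exp (t\<^sup>2 / 2)) * ennreal (normal_density t 1 x) \<partial>lborel)"
    by (subst nn_integral_density) (simp_all add: ennreal_mult[symmetric])
  also have "\<dots> = ennreal (exp (t\<^sup>2 / 2))"
    by (subst nn_integral_cmult) (simp_all add: nn_integral_normal_density)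
  finally show ?thesis .
qed

text \<open>The weight only changes the variance, from 1 to 1 / (1 - s). Negative s is allowed; the
  lower tail uses it.\<close>

lemma std_normal_exp_square:
  assumes "s < 1"
  shows "(\<integral>\<^sup>+ x. ennreal (exp (s * x\<^sup>2 / 2)) \<partial>std_normal_distribution) = ennreal (1 / sqrt (1 - s))"
proof -
  have "std_normal_density x * exp (s * x\<^sup>2 / 2) = 1 / sqrt (1 - s) * normal_density 0 (1 / sqrt (1 - s)) x" for x
    using assms by (simp add: normal_density_def exp_add[symmetric] field_simps power2_eq_square real_sqrt_divide)
  then have "(\<integral>\<^sup>+ x. ennreal (exp (s * x\<^sup>2 / 2)) \<partial>std_normal_distribution)
      = (\<integral>\<^sup>+ x. ennreal (1 / sqrt (1 - s)) * ennreal (normal_density 0 (1 / sqrt (1 - s)) x) \<partial>lborel)"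
    using assms by (subst nn_integral_density) (simp_all add: ennreal_mult[symmetric])
  also have "\<dots> = ennreal (1 / sqrt (1 - s))"
    using assms by (subst nn_integral_cmult) (simp_all add: nn_integral_normal_density)
  finally show ?thesis .
qed

context prob_space begin

lemma centred_normal_standardise:
  assumes "distributed M lborel Y (normal_density 0 \<sigma>)" "0 < \<sigma>"
  shows "distr M borel (\<lambda>\<omega>. Y \<omega> / \<sigma>) = std_normal_distribution"
proof -
  have "distributed M lborel (\<lambda>\<omega>. Y \<omega> / \<sigma>) std_normal_density"
    using normal_standard_normal_convert[OF assms(2), of Y 0] assms(1) by simp
  then show ?thesis
    by (simp add: distributed_def cong: distr_cong)
qed

lemma normal_mgf:
  assumes "distributed M lborel Y (normal_density 0 \<sigma>)" "0 < \<sigma>"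
  shows "(\<integral>\<^sup>+ \<omega>. ennreal (exp (\<tau> * Y \<omega>)) \<partial>M) = ennreal (exp (\<tau>\<^sup>2 * \<sigma>\<^sup>2 / 2))"
proof -
  have [measurable]: "Y \<in> borel_measurable M"
    using assms(1) by (auto simp: distributed_def)
  have "(\<integral>\<^sup>+ \<omega>. ennreal (exp (\<tau> * Y \<omega>)) \<partial>M) = (\<integral>\<^sup>+ \<omega>. ennreal (exp ((\<tau> * \<sigma>) * (Y \<omega> / \<sigma>))) \<partial>M)"
    using assms(2) by simp
  also have "\<dots> = (\<integral>\<^sup>+ x. ennreal (exp ((\<tau> * \<sigma>) * x)) \<partial>distr M borel (\<lambda>\<omega>. Y \<omega> / \<sigma>))"
    by (subst nn_integral_distr) simp_all
  finally show ?thesis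
    using centred_normal_standardise[OF assms] std_normal_mgf[of "\<tau> * \<sigma>"] by (simp add: power_mult_distrib)
qed

lemma normal_char:
  assumes "distributed M lborel Y (normal_density 0 \<sigma>)" "0 < \<sigma>"
  shows "(CLINT \<omega>|M. iexp (\<tau> * Y \<omega>)) = complex_of_real (exp (- (\<tau>\<^sup>2 * \<sigma>\<^sup>2) / 2))"
proof -
  have [measurable]: "Y \<in> borel_measurable M"
    using assms(1) by (auto simp: distributed_def)
  have "(CLINT \<omega>|M. iexp (\<tau> * Y \<omega>)) = (CLINT \<omega>|M. iexp ((\<tau> * \<sigma>) * (Y \<omega> / \<sigma>)))"
    using assms(2) by simp
  also have "\<dots> = (CLINT x|distr M borel (\<lambda>\<omega>. Y \<omega> / \<sigma>). iexp ((\<tau> * \<sigma>) * x))"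
    by (subst integral_distr) simp_all
  finally show ?thesis
    using centred_normal_standardise[OF assms] fun_cong[OF char_std_normal_distribution, of "\<tau> * \<sigma>"]
    by (simp add: char_def power_mult_distrib)
qed

lemma isotropic_gaussian_mgf:
  assumes "isotropic_gaussian M m G"
  shows "(\<integral>\<^sup>+ \<omega>. ennreal (exp (\<Sum>k<m. b k * G k \<omega>)) \<partial>M) = ennreal (exp ((\<Sum>k<m. (b k)\<^sup>2) / 2))"
proof (cases "\<exists>k<m. b k \<noteq> 0")
  case True
  then have "(\<Sum>k<m. (b k)\<^sup>2) > 0"
    by (metis (no_types, lifting) finite_lessThan lessThan_iff sum_pos2 zero_le_power2 zero_less_power2)
  then show ?thesis
    using normal_mgf[of "\<lambda>\<omega>. \<Sum>k<m. b k * G k \<omega>" "sqrt (\<Sum>k<m. (b k)\<^sup>2)" 1] assms True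
    by (simp add: isotropic_gaussian_def)
next
  case False
  then show ?thesis by (simp add: emeasure_space_1)
qed

lemma isotropic_gaussian_char:
  assumes "isotropic_gaussian M m G"
  shows "(CLINT \<omega>|M. iexp (\<Sum>k<m. b k * G k \<omega>)) = complex_of_real (exp (- (\<Sum>k<m. (b k)\<^sup>2) / 2))"
proof (cases "\<exists>k<m. b k \<noteq> 0")
  case True
  then have "(\<Sum>k<m. (b k)\<^sup>2) > 0"
    by (metis (no_types, lifting) finite_lessThan lessThan_iff sum_pos2 zero_le_power2 zero_less_power2)
  then show ?thesis
    using normal_char[of "\<lambda>\<omega>. \<Sum>k<m. b k * G k \<omega>" "sqrt (\<Sum>k<m. (b k)\<^sup>2)" 1] assms True
    by (simp add: isotropic_gaussian_def)
next
  case False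
  then show ?thesis by (simp add: prob_space)
qed

text \<open>Only the laws of linear functionals of \<open>G\<close> are known, so the exponential of \<open>\<bar>G\<bar>\<^sup>2\<close> is
  written as an average of exponentials of \<open>g \<bullet> G\<close> over an independent standard Gaussian \<open>g\<close>.\<close>

lemma isotropic_gaussian_square_mgf:
  assumes G: "isotropic_gaussian M m G" and s: "0 \<le> s" "s < 1"
  shows "(\<integral>\<^sup>+ \<omega>. ennreal (exp (s * (\<Sum>k<m. (G k \<omega>)\<^sup>2) / 2)) \<partial>M) = ennreal ((1 / sqrt (1 - s)) ^ m)"
proof -
  interpret N: prob_space std_normal_distribution by (rule prob_space_normal_density) simp
  interpret P: product_sigma_finite "\<lambda>_::nat. std_normal_distribution" ..
  interpret Q: finite_product_sigma_finite "\<lambda>_::nat. std_normal_distribution" "{..<m}" by standard simp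
  let ?P = "PiM {..<m} (\<lambda>_. std_normal_distribution)"
  interpret PM: pair_sigma_finite M ?P ..
  have Gm[measurable]: "k < m \<Longrightarrow> G k \<in> borel_measurable M" for k
    using G by (simp add: isotropic_gaussian_def)
  have "(\<integral>\<^sup>+ \<omega>. ennreal (exp (s * (\<Sum>k<m. (G k \<omega>)\<^sup>2) / 2)) \<partial>M)
      = (\<integral>\<^sup>+ \<omega>. (\<integral>\<^sup>+ g. ennreal (exp (\<Sum>k<m. sqrt s * g k * G k \<omega>)) \<partial>?P) \<partial>M)"
  proof (rule nn_integral_cong)
    fix \<omega> assume "\<omega> \<in> space M"
    have "(\<integral>\<^sup>+ g. ennreal (exp (\<Sum>k<m. sqrt s * g k * G k \<omega>)) \<partial>?P)
        = (\<integral>\<^sup>+ g. (\<Prod>k<m. ennreal (exp ((sqrt s * G k \<omega>) * g k))) \<partial>?P)"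
      by (simp add: exp_sum prod_ennreal algebra_simps)
    also have "\<dots> = (\<Prod>k<m. ennreal (exp ((sqrt s * G k \<omega>)\<^sup>2 / 2)))"
      by (subst P.product_nn_integral_prod) (simp_all add: std_normal_mgf del: times_divide_eq_left)
    also have "\<dots> = ennreal (exp (s * (\<Sum>k<m. (G k \<omega>)\<^sup>2) / 2))"
      using s by (simp add: prod_ennreal exp_sum[symmetric] power_mult_distrib sum_distrib_left sum_divide_distrib)
    finally show "ennreal (exp (s * (\<Sum>k<m. (G k \<omega>)\<^sup>2) / 2)) = (\<integral>\<^sup>+ g. ennreal (exp (\<Sum>k<m. sqrt s * g k * G k \<omega>)) \<partial>?P)" ..
  qed
  \<comment> \<open>After the exchange the inner integral is the moment generating function of one
    linear functional of \<open>G\<close>, with coefficients sqrt s * g k, and such functionals are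
    all that is known about \<open>G\<close>.\<close>
  also have "\<dots> = (\<integral>\<^sup>+ g. (\<integral>\<^sup>+ \<omega>. ennreal (exp (\<Sum>k<m. sqrt s * g k * G k \<omega>)) \<partial>M) \<partial>?P)"
    by (rule PM.Fubini'[symmetric]) (measurable; simp)
  also have "\<dots> = (\<integral>\<^sup>+ g. (\<Prod>k<m. ennreal (exp (s * (g k)\<^sup>2 / 2))) \<partial>?P)"
    using s by (subst isotropic_gaussian_mgf[OF G])
      (simp add: prod_ennreal exp_sum[symmetric] power_mult_distrib sum_distrib_left sum_divide_distrib)
  also have "\<dots> = ennreal ((1 / sqrt (1 - s)) ^ m)"
    using s by (subst P.product_nn_integral_prod) (simp_all add: std_normal_exp_square ennreal_power)
  finally show ?thesis .
qed

text \<open>A negative exponent would need the square root of a negative number in a real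
  randomisation, so exp (- s |G|^2 / 2) is written as an average of characteristic functions. The
  integrand is complex of modulus 1, which supplies the integrability for Fubini.\<close>

lemma isotropic_gaussian_neg_square_mgf:
  assumes G: "isotropic_gaussian M m G" and s: "0 \<le> s"
  shows "(\<integral> \<omega>. exp (- (s * (\<Sum>k<m. (G k \<omega>)\<^sup>2) / 2)) \<partial>M) = (1 / sqrt (1 + s)) ^ m"
proof -
  interpret N: prob_space std_normal_distribution by (rule prob_space_normal_density) simp
  interpret P: product_prob_space "\<lambda>_::nat. std_normal_distribution" "{..<m}" ..
  let ?P = "PiM {..<m} (\<lambda>_. std_normal_distribution)"
  interpret PP: prob_space ?P by (rule P.P.prob_space_axioms)
  interpret PM: pair_prob_space M ?P ..
  have Gm[measurable]: "k < m \<Longrightarrow> G k \<in> borel_measurable M" for k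
    using G by (simp add: isotropic_gaussian_def)
  let ?f = "\<lambda>\<omega> g. iexp (\<Sum>k<m. sqrt s * g k * G k \<omega>)"
  have meas: "case_prod ?f \<in> borel_measurable (M \<Otimes>\<^sub>M ?P)"
    by (simp add: case_prod_beta') measurable
  have int: "integrable (M \<Otimes>\<^sub>M ?P) (case_prod ?f)"
    by (rule PM.P.integrable_const_bound[where B = 1]) (use meas in \<open>auto\<close>)
  have "complex_of_real (\<integral> \<omega>. exp (- (s * (\<Sum>k<m. (G k \<omega>)\<^sup>2) / 2)) \<partial>M)
      = (CLINT \<omega>|M. (CLINT g|?P. ?f \<omega> g))"
    unfolding integral_complex_of_real[symmetric]
  proof (rule Bochner_Integration.integral_cong[OF refl])
    fix \<omega>
    have "(CLINT g|?P. ?f \<omega> g) = (CLINT g|?P. (\<Prod>k<m. iexp ((sqrt s * G k \<omega>) * g k)))"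
      by (simp add: exp_sum[symmetric] sum_distrib_left algebra_simps)
    also have "\<dots> = (\<Prod>k<m. char std_normal_distribution (sqrt s * G k \<omega>))"
      unfolding char_def
      by (rule P.product_integral_prod) (auto intro!: N.integrable_const_bound[where B = 1])
    also have "\<dots> = complex_of_real (exp (- (s * (\<Sum>k<m. (G k \<omega>)\<^sup>2) / 2)))"
      unfolding char_std_normal_distribution
      using s by (simp add: of_real_prod[symmetric] exp_sum[symmetric] power_mult_distrib sum_distrib_left
          sum_divide_distrib sum_negf del: of_real_prod)
    finally show "complex_of_real (exp (- (s * (\<Sum>k<m. (G k \<omega>)\<^sup>2) / 2))) = (CLINT g|?P. ?f \<omega> g)" ..
  qed
  also have "\<dots> = (CLINT g|?P. (CLINT \<omega>|M. ?f \<omega> g))"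
    by (rule PM.Fubini_integral[symmetric]) (rule int)
  also have "\<dots> = (CLINT g|?P. (\<Prod>k<m. complex_of_real (exp (- s * (g k)\<^sup>2 / 2))))"
    unfolding isotropic_gaussian_char[OF G, of "\<lambda>k. sqrt s * _ k"]
    using s by (simp add: of_real_prod[symmetric] exp_sum[symmetric] power_mult_distrib sum_distrib_left
        sum_divide_distrib sum_negf del: of_real_prod)
  also have "\<dots> = (\<Prod>k<m. complex_of_real (1 / sqrt (1 + s)))"
  proof -
    have int1: "integrable std_normal_distribution (\<lambda>x. exp (- s * x\<^sup>2 / 2))"
      by (rule N.integrable_const_bound[where B = 1]) (use s in auto)
    have "ennreal (\<integral>x. exp (- s * x\<^sup>2 / 2) \<partial>std_normal_distribution) = ennreal (1 / sqrt (1 + s))"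
      using std_normal_exp_square[of "- s"] s nn_integral_eq_integral[OF int1] by simp
    then have "(\<integral>x. exp (- s * x\<^sup>2 / 2) \<partial>std_normal_distribution) = 1 / sqrt (1 + s)"
      using s by (subst (asm) ennreal_inj) auto
    then show ?thesis
      using int1 by (subst P.product_integral_prod) (simp_all add: integral_complex_of_real)
  qed
  finally show ?thesis
    unfolding prod_constant card_lessThan of_real_power[symmetric] of_real_eq_iff .
qed

section \<open>Chernoff bounds for the squared norm\<close>

lemma exponential_Markov:
  assumes [measurable]: "X \<in> borel_measurable M"
    and C: "(\<integral>\<^sup>+ \<omega>. ennreal (exp (X \<omega>)) \<partial>M) = ennreal C" "0 \<le> C"
  shows "prob {\<omega>\<in>space M. a \<le> X \<omega>} \<le> exp (- a) * C"
proof -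
  have "integrable M (\<lambda>\<omega>. exp (X \<omega>))"
    by (rule integrableI_nonneg) (auto simp: C)
  moreover from this have "expectation (\<lambda>\<omega>. exp (X \<omega>)) = C"
    using C by (subst integral_eq_nn_integral) auto
  ultimately have "prob {\<omega>\<in>space M. exp a \<le> exp (X \<omega>)} \<le> C / exp a"
    using integral_Markov_inequality_measure[of M "\<lambda>\<omega>. exp (X \<omega>)" "space M" "exp a"] by simp
  then show ?thesis by (simp add: exp_minus field_simps)
qed

lemma isotropic_gaussian_upper_tail:
  assumes G: "isotropic_gaussian M m G" and e: "0 < e" "e < 1"
  shows "prob {\<omega>\<in>space M. (1 + e) * m \<le> (\<Sum>k<m. (G k \<omega>)\<^sup>2)} \<le> exp (- (e\<^sup>2 / 16) * m)"
proof -
  have [measurable]: "k < m \<Longrightarrow> G k \<in> borel_measurable M" for k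
    using G by (simp add: isotropic_gaussian_def)
  \<comment> \<open>After ln (1 - s) \<ge> - s - 2 s^2 the exponent per coordinate is at most (2 s^2
    - s e) / 2, minimal at s = e / 4 with value - e^2 / 16.\<close>
  define s where "s = e / 4"
  have s: "0 < s" "s < 1" using e by (auto simp: s_def)
  have "prob {\<omega>\<in>space M. s * (1 + e) * m / 2 \<le> s * (\<Sum>k<m. (G k \<omega>)\<^sup>2) / 2}
      \<le> exp (- (s * (1 + e) * m / 2)) * (1 / sqrt (1 - s)) ^ m"
    by (rule exponential_Markov) (use isotropic_gaussian_square_mgf[OF G, of s] s in auto)
  also have "{\<omega>\<in>space M. s * (1 + e) * m / 2 \<le> s * (\<Sum>k<m. (G k \<omega>)\<^sup>2) / 2}
      = {\<omega>\<in>space M. (1 + e) * m \<le> (\<Sum>k<m. (G k \<omega>)\<^sup>2)}"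
    using s by (intro Collect_cong conj_cong refl) (simp add: mult.assoc)
  also have "1 / sqrt (1 - s) = exp (- ln (1 - s) / 2)"
    using s by (simp add: exp_minus inverse_eq_divide ln_sqrt[symmetric])
  also have "exp (- (s * (1 + e) * m / 2)) * exp (- ln (1 - s) / 2) ^ m
      = exp (((- ln (1 - s) - s * (1 + e)) / 2) * m)"
    by (simp add: exp_of_nat_mult[symmetric] exp_add[symmetric] field_simps)
  also have "\<dots> \<le> exp (- (e\<^sup>2 / 16) * m)"
  proof -
    have "- s - 2 * s\<^sup>2 \<le> ln (1 - s)"
      using ln_one_minus_pos_lower_bound[of s] e by (simp add: s_def)
    moreover have "2 * s\<^sup>2 - s * e = - (e\<^sup>2 / 8)"
      by (simp add: s_def power2_eq_square field_simps)
    ultimately have "(- ln (1 - s) - s * (1 + e)) / 2 \<le> - (e\<^sup>2 / 16)"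
      by (simp add: algebra_simps)
    then show ?thesis by (simp only: exp_le_cancel_iff) (rule mult_right_mono, auto)
  qed
  finally show ?thesis .
qed

lemma isotropic_gaussian_lower_tail:
  assumes G: "isotropic_gaussian M m G" and e: "0 < e" "e < 1"
  shows "prob {\<omega>\<in>space M. (\<Sum>k<m. (G k \<omega>)\<^sup>2) \<le> (1 - e) * m} \<le> exp (- (e\<^sup>2 / 16) * m)"
proof -
  have [measurable]: "k < m \<Longrightarrow> G k \<in> borel_measurable M" for k
    using G by (simp add: isotropic_gaussian_def)
  \<comment> \<open>Here ln (1 + s) \<ge> s - s^2 leaves (s^2 - s e) / 2, minimal at s = e / 2 with
    value - e^2 / 8; it is weakened at the end to the rate of the upper tail.\<close>
  define s where "s = e / 2"
  have s: "0 < s" "s < 1" using e by (auto simp: s_def)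
  have "integrable M (\<lambda>\<omega>. exp (- (s * (\<Sum>k<m. (G k \<omega>)\<^sup>2) / 2)))"
    by (rule integrable_const_bound[where B = 1]) (use s in \<open>auto intro!: mult_nonneg_nonneg sum_nonneg\<close>)
  then have "(\<integral>\<^sup>+ \<omega>. ennreal (exp (- (s * (\<Sum>k<m. (G k \<omega>)\<^sup>2) / 2))) \<partial>M) = ennreal ((1 / sqrt (1 + s)) ^ m)"
    using isotropic_gaussian_neg_square_mgf[OF G, of s] s by (simp add: nn_integral_eq_integral)
  then have "prob {\<omega>\<in>space M. - (s * (1 - e) * m / 2) \<le> - (s * (\<Sum>k<m. (G k \<omega>)\<^sup>2) / 2)}
      \<le> exp (- (- (s * (1 - e) * m / 2))) * (1 / sqrt (1 + s)) ^ m"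
    by (intro exponential_Markov) (use s in auto)
  also have "{\<omega>\<in>space M. - (s * (1 - e) * m / 2) \<le> - (s * (\<Sum>k<m. (G k \<omega>)\<^sup>2) / 2)}
      = {\<omega>\<in>space M. (\<Sum>k<m. (G k \<omega>)\<^sup>2) \<le> (1 - e) * m}"
    using s by (intro Collect_cong conj_cong refl) (simp add: mult.assoc)
  also have "1 / sqrt (1 + s) = exp (- ln (1 + s) / 2)"
    using s by (simp add: exp_minus inverse_eq_divide ln_sqrt[symmetric])
  also have "exp (- (- (s * (1 - e) * m / 2))) * exp (- ln (1 + s) / 2) ^ m
      = exp (((s * (1 - e) - ln (1 + s)) / 2) * m)"
    by (simp add: exp_of_nat_mult[symmetric] exp_add[symmetric] field_simps)
  also have "\<dots> \<le> exp (- (e\<^sup>2 / 16) * m)"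
  proof -
    have "s - s\<^sup>2 \<le> ln (1 + s)"
      using ln_one_plus_pos_lower_bound[of s] s by simp
    then have "s * (1 - e) - ln (1 + s) \<le> s * (1 - e) - (s - s\<^sup>2)" by simp
    also have "\<dots> = - (e\<^sup>2 / 4)" by (simp add: s_def power2_eq_square field_simps)
    finally have "(s * (1 - e) - ln (1 + s)) / 2 \<le> - (e\<^sup>2 / 8)" by (simp add: field_simps)
    then have "(s * (1 - e) - ln (1 + s)) / 2 \<le> - (e\<^sup>2 / 16)"
      using zero_le_power2[of e] by (auto elim!: order_trans)
    then show ?thesis by (simp only: exp_le_cancel_iff) (rule mult_right_mono, auto)
  qed
  finally show ?thesis .
qed

lemma isotropic_gaussian_concentration:
  assumes G: "isotropic_gaussian M m G" and e: "0 < e" "e < 1"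
  shows "prob {\<omega>\<in>space M. e * m \<le> \<bar>(\<Sum>k<m. (G k \<omega>)\<^sup>2) - m\<bar>} \<le> 2 * exp (- (e\<^sup>2 / 16) * m)"
proof -
  have [measurable]: "k < m \<Longrightarrow> G k \<in> borel_measurable M" for k
    using G by (simp add: isotropic_gaussian_def)
  have "prob {\<omega>\<in>space M. e * m \<le> \<bar>(\<Sum>k<m. (G k \<omega>)\<^sup>2) - m\<bar>}
     \<le> prob ({\<omega>\<in>space M. (1 + e) * m \<le> (\<Sum>k<m. (G k \<omega>)\<^sup>2)} \<union> {\<omega>\<in>space M. (\<Sum>k<m. (G k \<omega>)\<^sup>2) \<le> (1 - e) * m})"
    by (rule finite_measure_mono) (auto simp: algebra_simps)
  also have "\<dots> \<le> prob {\<omega>\<in>space M. (1 + e) * m \<le> (\<Sum>k<m. (G k \<omega>)\<^sup>2)} + prob {\<omega>\<in>space M. (\<Sum>k<m. (G k \<omega>)\<^sup>2) \<le> (1 - e) * m}"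
    by (rule measure_Un_le) auto
  finally show ?thesis
    using isotropic_gaussian_upper_tail[OF assms] isotropic_gaussian_lower_tail[OF assms] by simp
qed

end

section \<open>Quadratic forms and nets\<close>

definition dot :: "nat \<Rightarrow> (nat \<Rightarrow> real) \<Rightarrow> (nat \<Rightarrow> real) \<Rightarrow> real" where
  "dot n f g = (\<Sum>i<n. f i * g i)"

text \<open>The arguments are whole functions on the naturals while \<open>dot n\<close> sees only
  the coordinates below n. Since \<open>dot n\<close> is thus merely a semi-inner product, vectors
  of length 0 need separate care whenever something is normalised.\<close>

definition symmetric_bilinear :: "((nat \<Rightarrow> real) \<Rightarrow> (nat \<Rightarrow> real) \<Rightarrow> real) \<Rightarrow> bool" where
  "symmetric_bilinear B \<longleftrightarrow> (\<forall>x y. B x y = B y x) \<and>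
     (\<forall>a b x y z. B (\<lambda>i. a * x i + b * y i) z = a * B x z + b * B y z)"

lemma dot_commute: "dot n f g = dot n g f"
  by (simp add: dot_def mult.commute)

lemma dot_nonneg [simp]: "0 \<le> dot n f f"
  by (simp add: dot_def sum_nonneg)

lemma dot_linear: "dot n (\<lambda>i. a * x i + b * y i) z = a * dot n x z + b * dot n y z"
  by (simp add: dot_def sum.distrib sum_distrib_left algebra_simps)

lemma dot_scale_left: "dot n (\<lambda>i. a * x i) z = a * dot n x z"
  by (simp add: dot_def sum_distrib_left algebra_simps)

lemma dot_scale_right: "dot n z (\<lambda>i. a * x i) = a * dot n z x"
  by (simp add: dot_def sum_distrib_left algebra_simps)

lemma dot_sum_left: "dot n (\<lambda>i. \<Sum>k\<in>A. x k i) z = (\<Sum>k\<in>A. dot n (x k) z)"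
  unfolding dot_def sum_distrib_right by (rule sum.swap)

lemma dot_sum_right: "dot n z (\<lambda>i. \<Sum>k\<in>A. x k i) = (\<Sum>k\<in>A. dot n z (x k))"
  unfolding dot_def sum_distrib_left by (rule sum.swap)

lemma symmetric_bilinear_dot: "symmetric_bilinear (dot n)"
  unfolding symmetric_bilinear_def using dot_linear dot_commute by auto

lemma symmetric_bilinear_gram: "symmetric_bilinear (\<lambda>x y. (\<Sum>k\<in>A. dot n (z k) x * dot n (z k) y) / c - dot n x y)"
proof -
  have "dot n (z k) (\<lambda>i. a * x i + b * y i) = a * dot n (z k) x + b * dot n (z k) y" for k a b x y
    by (metis dot_commute dot_linear)
  then show ?thesis
    unfolding symmetric_bilinear_def
    by (simp add: dot_commute[of n x for x] dot_linear sum.distrib sum_distrib_left algebra_simps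
        add_divide_distrib)
qed

lemma symmetric_bilinear_commute: "symmetric_bilinear B \<Longrightarrow> B x y = B y x"
  unfolding symmetric_bilinear_def by blast

lemma symmetric_bilinear_left:
  "symmetric_bilinear B \<Longrightarrow> B (\<lambda>i. a * x i + b * y i) z = a * B x z + b * B y z"
  unfolding symmetric_bilinear_def by blast

lemma symmetric_bilinear_right:
  assumes "symmetric_bilinear B"
  shows "B z (\<lambda>i. a * x i + b * y i) = a * B z x + b * B z y"
  by (simp only: symmetric_bilinear_commute[OF assms, of z] symmetric_bilinear_left[OF assms])

lemma symmetric_bilinear_scale:
  assumes "symmetric_bilinear B"
  shows "B (\<lambda>i. a * x i) z = a * B x z" "B z (\<lambda>i. a * x i) = a * B z x"
  using symmetric_bilinear_left[OF assms, of a x 0 x z] symmetric_bilinear_right[OF assms, of z a x 0 x]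
  by simp_all

text \<open>Polarisation and the parallelogram law bound 2 |B x y| by M (|x|^2 + |y|^2); applied to
  normalised vectors this becomes the product bound.\<close>

lemma symmetric_bilinear_polarization:
  assumes B: "symmetric_bilinear B" and M: "\<And>x. \<bar>B x x\<bar> \<le> M * dot n x x" "0 \<le> M"
  shows "\<bar>B x y\<bar> \<le> M * (sqrt (dot n x x) * sqrt (dot n y y))"
proof -
  note lin = symmetric_bilinear_right[OF B]
  note lin' = symmetric_bilinear_left[OF B] and sym = symmetric_bilinear_commute[OF B]
  have *: "2 * \<bar>B x y\<bar> \<le> M * (dot n x x + dot n y y)" for x y
  proof -
    have "4 * B x y = B (\<lambda>i. 1 * x i + 1 * y i) (\<lambda>i. 1 * x i + 1 * y i)
        - B (\<lambda>i. 1 * x i + (-1) * y i) (\<lambda>i. 1 * x i + (-1) * y i)"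
      unfolding lin lin' using sym[of x y] by (simp add: algebra_simps)
    then have "4 * \<bar>B x y\<bar> \<le> M * dot n (\<lambda>i. 1 * x i + 1 * y i) (\<lambda>i. 1 * x i + 1 * y i)
        + M * dot n (\<lambda>i. 1 * x i + (-1) * y i) (\<lambda>i. 1 * x i + (-1) * y i)"
      using M(1)[of "\<lambda>i. 1 * x i + 1 * y i"] M(1)[of "\<lambda>i. 1 * x i + (-1) * y i"] by linarith
    also have "\<dots> = 2 * (M * (dot n x x + dot n y y))"
      unfolding symmetric_bilinear_right[OF symmetric_bilinear_dot] dot_linear
      by (simp add: algebra_simps dot_commute)
    finally show ?thesis by simp
  qed
  have zero: "B u v = 0" if "dot n u u = 0" for u v
  proof (rule ccontr)
    assume nz: "B u v \<noteq> 0"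
    \<comment> \<open>Scaling u by t keeps its length 0 but makes B (t u) v equal to M |v|^2 + 1,
      which violates the additive bound.\<close>
    define t where "t = (M * dot n v v + 1) / B u v"
    have "2 * \<bar>B (\<lambda>i. t * u i) v\<bar> \<le> M * (t * (t * dot n u u) + dot n v v)"
      using *[of "\<lambda>i. t * u i" v] by (simp add: dot_scale_left dot_scale_right)
    then have "2 * \<bar>M * dot n v v + 1\<bar> \<le> M * dot n v v"
      unfolding symmetric_bilinear_scale[OF B] that using nz by (simp add: t_def)
    moreover define d where "d = M * dot n v v"
    ultimately have "2 * \<bar>d + 1\<bar> \<le> d" by simp
    moreover have "0 \<le> d" unfolding d_def by (intro mult_nonneg_nonneg M(2)) simp
    ultimately show False by simp
  qed
  show ?thesis
  proof (cases "dot n x x = 0 \<or> dot n y y = 0")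
    case True
    then have "B x y = 0" using zero sym by metis
    then show ?thesis using M(2) by simp
  next
    case False
    define a b where "a = sqrt (dot n x x)" and "b = sqrt (dot n y y)"
    have pos: "0 < a" "0 < b" using False dot_nonneg[of n x] dot_nonneg[of n y] by (auto simp: a_def b_def less_le)
    have sq: "a * a = dot n x x" "b * b = dot n y y" by (auto simp: a_def b_def)
    have "2 * \<bar>B (\<lambda>i. (1 / a) * x i) (\<lambda>i. (1 / b) * y i)\<bar> \<le> M * (1 / a * (1 / a * (a * a)) + 1 / b * (1 / b * (b * b)))"
      using *[of "\<lambda>i. (1 / a) * x i" "\<lambda>i. (1 / b) * y i"]
      unfolding dot_scale_left dot_scale_right sq .
    then have "\<bar>B x y\<bar> / (a * b) \<le> M"
      unfolding symmetric_bilinear_scale[OF B] using pos by (simp add: abs_mult)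
    then show ?thesis using pos by (simp add: a_def[symmetric] b_def[symmetric] field_simps)
  qed
qed

lemma dot_Cauchy_Schwarz: "\<bar>dot n x y\<bar> \<le> sqrt (dot n x x) * sqrt (dot n y y)"
  using symmetric_bilinear_polarization[OF symmetric_bilinear_dot, of n 1 n x y] by simp

lemma dot_Cauchy_Schwarz_square: "(dot n x y)\<^sup>2 \<le> dot n x x * dot n y y"
proof -
  have "\<bar>dot n x y\<bar>\<^sup>2 \<le> (sqrt (dot n x x) * sqrt (dot n y y))\<^sup>2"
    by (rule power_mono[OF dot_Cauchy_Schwarz]) simp
  then show ?thesis by (simp add: power_mult_distrib)
qed

text \<open>The integer points in a ball of radius \<open>sqrt (R n)\<close> are counted by comparison with
  the Gaussian sum over the lattice, which factorises over the coordinates.\<close>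

lemma sum_exp_neg_square_le: "(\<Sum>k\<in>{- int m..int m}. exp (- real_of_int (k\<^sup>2))) \<le> 3"
proof -
  have nat_part: "(\<Sum>k\<in>{1..m}. exp (- real k)) \<le> 1" for m :: nat
  proof -
    have half: "exp (- real k) \<le> (1 / 2) ^ k" for k
    proof -
      have "exp (- 1 :: real) \<le> 1 / 2"
        using exp_ge_add_one_self[of 1] by (simp add: exp_minus field_simps)
      then have "exp (- 1 :: real) ^ k \<le> (1 / 2) ^ k" by (rule power_mono) simp
      then show ?thesis by (simp add: exp_of_nat_mult[symmetric])
    qed
    have "(\<Sum>k\<in>{1..m}. exp (- real k)) \<le> (\<Sum>k\<in>{1..m}. (1 / 2 :: real) ^ k)"
      by (rule sum_mono) (rule half)
    also have "\<dots> = 1 - (1 / 2) ^ m"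
      by (induction m) (auto simp: field_simps)
    finally show ?thesis using zero_le_power[of "1/2 :: real" m] by linarith
  qed
  have split: "{- int m..int m} = insert 0 (int ` {1..m} \<union> (\<lambda>k. - int k) ` {1..m})" (is "?L = ?R")
  proof
    show "?L \<subseteq> ?R"
    proof
      fix k assume k: "k \<in> ?L"
      consider "k = 0" | "k > 0" | "k < 0" by linarith
      then show "k \<in> ?R"
      proof cases
        case 2
        then have "k = int (nat k)" "nat k \<in> {1..m}" using k by auto
        then show ?thesis by blast
      next
        case 3
        then have "k = - int (nat (- k))" "nat (- k) \<in> {1..m}" using k by auto
        then show ?thesis by blast
      qed simp
    qed
  qed auto
  have le: "exp (- real_of_int ((int k)\<^sup>2)) \<le> exp (- real k)" for k
  proof -
    have "k \<le> k\<^sup>2" by (simp add: power2_eq_square)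
    then have "real k \<le> real (k\<^sup>2)" using of_nat_le_iff by blast
    then show ?thesis by simp
  qed
  have "(\<Sum>k\<in>{- int m..int m}. exp (- real_of_int (k\<^sup>2)))
      = 1 + (\<Sum>k\<in>int ` {1..m} \<union> (\<lambda>k. - int k) ` {1..m}. exp (- real_of_int (k\<^sup>2)))"
    unfolding split by (subst sum.insert) auto
  also have "(\<Sum>k\<in>int ` {1..m} \<union> (\<lambda>k. - int k) ` {1..m}. exp (- real_of_int (k\<^sup>2)))
      = (\<Sum>k\<in>int ` {1..m}. exp (- real_of_int (k\<^sup>2))) + (\<Sum>k\<in>(\<lambda>k. - int k) ` {1..m}. exp (- real_of_int (k\<^sup>2)))"
    by (rule sum.union_disjoint) auto
  also have "\<dots> = (\<Sum>k\<in>{1..m}. exp (- real_of_int ((int k)\<^sup>2))) + (\<Sum>k\<in>{1..m}. exp (- real_of_int ((int k)\<^sup>2)))"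
    by (subst (1 2) sum.reindex) (auto simp: inj_on_def)
  also have "\<dots> \<le> (\<Sum>k\<in>{1..m}. exp (- real k)) + (\<Sum>k\<in>{1..m}. exp (- real k))"
    by (intro add_mono sum_mono le)
  finally show ?thesis using nat_part[of m] by linarith
qed

definition lattice_ball :: "nat \<Rightarrow> nat \<Rightarrow> (nat \<Rightarrow> int) set" where
  "lattice_ball n R = {f \<in> PiE {..<n} (\<lambda>_. {- int (R * n)..int (R * n)}). (\<Sum>i<n. (f i)\<^sup>2) \<le> int (R * n)}"

lemma finite_lattice_ball: "finite (lattice_ball n R)"
  unfolding lattice_ball_def by (rule finite_subset[OF _ finite_PiE[of "{..<n}" "\<lambda>_. {- int (R * n)..int (R * n)}"]]) auto

text \<open>On the ball the weight exp (R n - |f|^2) is at least 1, so the count is at most the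
  total weight of the box, which is a product of n one-dimensional sums, each at most 3.\<close>

lemma card_lattice_ball: "real (card (lattice_ball n R)) \<le> (exp (real R) * 3) ^ n"
proof -
  let ?P = "PiE {..<n} (\<lambda>_. {- int (R * n)..int (R * n)})"
  have "real (card (lattice_ball n R)) = (\<Sum>f\<in>lattice_ball n R. 1)" by simp
  also have "\<dots> \<le> (\<Sum>f\<in>lattice_ball n R. exp (real (R * n)) * (\<Prod>i<n. exp (- real_of_int ((f i)\<^sup>2))))"
  proof (rule sum_mono)
    fix f assume "f \<in> lattice_ball n R"
    then have "(\<Sum>i<n. (f i)\<^sup>2) \<le> int (R * n)" by (simp add: lattice_ball_def)
    then have "real_of_int (\<Sum>i<n. (f i)\<^sup>2) \<le> real (R * n)" by linarith
    then show "1 \<le> exp (real (R * n)) * (\<Prod>i<n. exp (- real_of_int ((f i)\<^sup>2)))"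
      by (simp add: exp_sum[symmetric] exp_add[symmetric] sum_negf)
  qed
  also have "\<dots> \<le> (\<Sum>f\<in>?P. exp (real (R * n)) * (\<Prod>i<n. exp (- real_of_int ((f i)\<^sup>2))))"
  proof (rule sum_mono2)
    show "finite ?P" by (intro finite_PiE) auto
    show "lattice_ball n R \<subseteq> ?P" unfolding lattice_ball_def by blast
    show "0 \<le> exp (real (R * n)) * (\<Prod>i<n. exp (- real_of_int ((f i)\<^sup>2)))" for f :: "nat \<Rightarrow> int"
      by (intro mult_nonneg_nonneg prod_nonneg) simp_all
  qed
  also have "\<dots> = exp (real (R * n)) * (\<Prod>i<n. \<Sum>k\<in>{- int (R * n)..int (R * n)}. exp (- real_of_int (k\<^sup>2)))"
    by (subst prod_sum_PiE) (simp_all add: sum_distrib_left)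
  also have "\<dots> \<le> exp (real (R * n)) * (\<Prod>i<n. 3)"
    by (intro mult_left_mono prod_mono conjI sum_nonneg sum_exp_neg_square_le) auto
  also have "\<dots> = (exp (real R) * 3) ^ n"
    by (simp add: power_mult_distrib exp_of_nat_mult[symmetric] mult.commute)
  finally show ?thesis .
qed

text \<open>Rounding to the lattice \<open>(4 sqrt n)\<^sup>-\<^sup>1 \<int>\<^sup>n\<close>.\<close>

definition ball_net :: "nat \<Rightarrow> (nat \<Rightarrow> real) set" where
  "ball_net n = (\<lambda>f i. real_of_int (f i) / (4 * sqrt (real n))) ` lattice_ball n 25"

lemma finite_ball_net: "finite (ball_net n)"
  by (simp add: ball_net_def finite_lattice_ball)

lemma card_ball_net: "real (card (ball_net n)) \<le> (exp 25 * 3) ^ n"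
  using card_lattice_ball[of n 25] card_image_le[OF finite_lattice_ball[of n 25], of "\<lambda>f i. real_of_int (f i) / (4 * sqrt (real n))"]
  unfolding ball_net_def by simp

text \<open>The radius 5 / 4 is that of the unit ball enlarged by the rounding error 1 / 4, which is
  why the lattice ball has parameter 25 when the mesh is 1 / (4 sqrt n).\<close>

lemma ball_net_norm:
  assumes "0 < n" "q \<in> ball_net n"
  shows "dot n q q \<le> 25 / 16"
proof -
  obtain f where f: "f \<in> lattice_ball n 25" "q = (\<lambda>i. real_of_int (f i) / (4 * sqrt (real n)))"
    using assms by (auto simp: ball_net_def)
  then have "(\<Sum>i<n. (f i)\<^sup>2) \<le> int (25 * n)" by (simp add: lattice_ball_def)
  then have "real_of_int (\<Sum>i<n. (f i)\<^sup>2) \<le> real (25 * n)" by linarith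
  moreover have eq: "dot n q q = real_of_int (\<Sum>i<n. (f i)\<^sup>2) / (16 * real n)"
    using assms by (simp add: dot_def f power2_eq_square sum_divide_distrib)
  ultimately show ?thesis unfolding eq using assms by (subst pos_divide_le_eq) auto
qed

lemma ball_net_approx:
  assumes n: "0 < n" and y: "dot n y y \<le> 1"
  obtains q where "q \<in> ball_net n" "dot n (\<lambda>i. y i - q i) (\<lambda>i. y i - q i) \<le> 1 / 16"
proof
  let ?c = "4 * sqrt (real n)"
  have c: "?c > 0" "?c * ?c = 16 * real n" using n by auto
  define f where "f = (\<lambda>i\<in>{..<n}. \<lfloor>?c * y i\<rfloor>)"
  define q where "q = (\<lambda>i. real_of_int (f i) / ?c)"
  have diff: "(y i - q i)\<^sup>2 \<le> 1 / (16 * real n)" if "i < n" for i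
  proof -
    have "\<bar>?c * y i - real_of_int (f i)\<bar> \<le> 1" using that by (simp add: f_def) linarith
    then have "(?c * y i - real_of_int (f i))\<^sup>2 \<le> 1" by (simp add: abs_square_le_1)
    moreover have "(y i - q i)\<^sup>2 = (?c * y i - real_of_int (f i))\<^sup>2 / (?c * ?c)"
      using c(1) by (simp add: q_def power2_eq_square field_simps)
    ultimately show ?thesis unfolding c(2) using n by (simp add: divide_right_mono)
  qed
  show d: "dot n (\<lambda>i. y i - q i) (\<lambda>i. y i - q i) \<le> 1 / 16"
  proof -
    have "dot n (\<lambda>i. y i - q i) (\<lambda>i. y i - q i) \<le> (\<Sum>i<n. 1 / (16 * real n))"
      unfolding dot_def by (rule sum_mono) (use diff in \<open>simp add: power2_eq_square\<close>)
    then show ?thesis using n by simp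
  qed
  let ?d = "\<lambda>i. y i - q i"
  have "dot n q q = dot n (\<lambda>i. 1 * y i + (-1) * ?d i) (\<lambda>i. 1 * y i + (-1) * ?d i)" by simp
  also have "\<dots> = dot n y y - 2 * dot n y ?d + dot n ?d ?d"
    unfolding symmetric_bilinear_right[OF symmetric_bilinear_dot] dot_linear
    by (simp add: algebra_simps dot_commute)
  also have "\<dots> \<le> 1 + 2 * (1 * (1 / 4)) + 1 / 16"
  proof -
    have "sqrt (dot n y y) \<le> 1" using y by simp
    moreover have "sqrt (dot n ?d ?d) \<le> 1 / 4" using d by (intro real_le_lsqrt) (auto simp: power2_eq_square)
    ultimately have "sqrt (dot n y y) * sqrt (dot n ?d ?d) \<le> 1 * (1 / 4)"
      by (intro mult_mono) auto
    then have "\<bar>dot n y ?d\<bar> \<le> 1 * (1 / 4)" using dot_Cauchy_Schwarz[of n y ?d] by linarith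
    then show ?thesis using y d by linarith
  qed
  finally have q: "dot n q q \<le> 25 / 16" by simp
  have "dot n q q = real_of_int (\<Sum>i<n. (f i)\<^sup>2) / (16 * real n)"
    using n by (simp add: dot_def q_def power2_eq_square sum_divide_distrib)
  then have "real_of_int (\<Sum>i<n. (f i)\<^sup>2) = 16 * dot n q q * real n" using n by (simp add: field_simps)
  also have "\<dots> \<le> 25 * real n" using q by (intro mult_right_mono) auto
  finally have "real_of_int (\<Sum>i<n. (f i)\<^sup>2) \<le> real_of_int (int (25 * n))" by simp
  then have sq: "(\<Sum>i<n. (f i)\<^sup>2) \<le> int (25 * n)" by (simp only: of_int_le_iff)
  \<comment> \<open>An integer is bounded by its own square, so the norm bound also puts every
    coordinate into the box.\<close>
  have "\<bar>f i\<bar> \<le> int (25 * n)" if "i < n" for i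
  proof -
    have "\<bar>f i\<bar> \<le> (f i)\<^sup>2"
    proof (cases "f i = 0")
      case False
      then have "\<bar>f i\<bar> * 1 \<le> \<bar>f i\<bar> * \<bar>f i\<bar>" by (intro mult_left_mono) auto
      then show ?thesis by (simp add: power2_eq_square)
    qed simp
    also have "\<dots> \<le> (\<Sum>i<n. (f i)\<^sup>2)" by (rule member_le_sum) (use that in auto)
    finally show ?thesis using sq by linarith
  qed
  moreover have "f \<in> extensional {..<n}" by (simp add: f_def)
  ultimately have "f \<in> lattice_ball n 25"
    unfolding lattice_ball_def using sq by (auto simp: PiE_iff abs_le_iff minus_le_iff)
  then show "q \<in> ball_net n" by (auto simp: ball_net_def q_def)
qed

text \<open>With M the supremum of |B x x| over the unit ball and q a net point near x, B x x - B q
  q = B (x - q) (x + q) is at most M * 1/4 * 9/4. Hence M \<le> \<epsilon> + 9/16 M, the source of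
  16/7. The constant \<open>C\<close> serves to make M finite, without which M could not be
  absorbed.\<close>

lemma symmetric_bilinear_net_bound:
  assumes B: "symmetric_bilinear B" and n: "0 < n"
    and bdd: "\<And>x. \<bar>B x x\<bar> \<le> C * dot n x x"
    and net: "\<And>q. q \<in> ball_net n \<Longrightarrow> \<bar>B q q\<bar> \<le> \<epsilon>"
  shows "\<bar>B y y\<bar> \<le> 16 / 7 * \<epsilon> * dot n y y"
proof -
  note lin = symmetric_bilinear_right[OF B]
  note lin' = symmetric_bilinear_left[OF B] and sym = symmetric_bilinear_commute[OF B]
  define S where "S = (\<lambda>x. \<bar>B x x\<bar>) ` {x. dot n x x \<le> 1}"
  define M where "M = Sup S"
  have C: "\<bar>B x x\<bar> \<le> max C 0" if "dot n x x \<le> 1" for x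
  proof -
    have "\<bar>B x x\<bar> \<le> C * dot n x x" by (rule bdd)
    also have "\<dots> \<le> max C 0 * 1"
      using that by (intro mult_mono) auto
    finally show ?thesis by simp
  qed
  have bS: "bdd_above S" using C by (auto simp: S_def intro!: bdd_aboveI)
  have "(\<lambda>_. 0) \<in> {x. dot n x x \<le> 1}" by (simp add: dot_def)
  then have neS: "S \<noteq> {}" by (auto simp: S_def)
  have upper: "\<bar>B x x\<bar> \<le> M" if "dot n x x \<le> 1" for x
    unfolding M_def by (rule cSup_upper[OF _ bS]) (use that in \<open>auto simp: S_def\<close>)
  have M0: "0 \<le> M" using upper[of "\<lambda>_. 0"] by (simp add: dot_def)
  have scaled: "\<bar>B x x\<bar> \<le> m * dot n x x" if m: "\<And>x. dot n x x \<le> 1 \<Longrightarrow> \<bar>B x x\<bar> \<le> m" for m x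
  proof (cases "dot n x x = 0")
    case True
    then show ?thesis using bdd[of x] by simp
  next
    case False
    define a where "a = sqrt (dot n x x)"
    have a: "0 < a" "a * a = dot n x x" using False dot_nonneg[of n x] by (auto simp: a_def less_le)
    have "dot n (\<lambda>i. (1 / a) * x i) (\<lambda>i. (1 / a) * x i) = 1"
      unfolding dot_scale_left dot_scale_right a(2)[symmetric] using a(1) by simp
    then have "\<bar>B (\<lambda>i. (1 / a) * x i) (\<lambda>i. (1 / a) * x i)\<bar> \<le> m" by (intro m) simp
    then have "\<bar>B x x\<bar> / (a * a) \<le> m"
      unfolding symmetric_bilinear_scale[OF B] using a(1) by (simp add: abs_mult)
    moreover have "0 < a * a" using a(1) by simp
    ultimately have "\<bar>B x x\<bar> \<le> m * (a * a)" by (simp only: pos_divide_le_eq)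
    then show ?thesis unfolding a(2) .
  qed
  have BM: "\<bar>B x y\<bar> \<le> M * (sqrt (dot n x x) * sqrt (dot n y y))" for x y
    using symmetric_bilinear_polarization[OF B scaled[OF upper] M0] .
  have "M \<le> \<epsilon> + 9 / 16 * M"
    unfolding M_def
  proof (rule cSup_least[OF neS])
    fix s assume "s \<in> S"
    then obtain x where x: "dot n x x \<le> 1" "s = \<bar>B x x\<bar>" by (auto simp: S_def)
    obtain q where q: "q \<in> ball_net n" "dot n (\<lambda>i. x i - q i) (\<lambda>i. x i - q i) \<le> 1 / 16"
      using ball_net_approx[OF n x(1)] by blast
    let ?d = "\<lambda>i. 1 * x i + (-1) * q i" and ?e = "\<lambda>i. 1 * x i + 1 * q i"
    have "B x x = B q q + B ?d ?e"
      unfolding lin lin' using sym[of x q] by simp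
    then have "\<bar>B x x\<bar> \<le> \<epsilon> + \<bar>B ?d ?e\<bar>" using net[OF q(1)] by linarith
    also have "\<bar>B ?d ?e\<bar> \<le> M * (1 / 4 * (9 / 4))"
    proof -
      have "sqrt (dot n ?d ?d) \<le> 1 / 4" using q(2) by (intro real_le_lsqrt) (auto simp: power2_eq_square)
      moreover have "dot n ?e ?e \<le> (9 / 4)\<^sup>2"
      proof -
        have "dot n ?e ?e = dot n x x + 2 * dot n x q + dot n q q"
          unfolding symmetric_bilinear_right[OF symmetric_bilinear_dot] dot_linear
          by (simp add: algebra_simps dot_commute)
        moreover have "sqrt (dot n x x) * sqrt (dot n q q) \<le> 1 * (5 / 4)"
          using x(1) ball_net_norm[OF n q(1)]
          by (intro mult_mono real_le_lsqrt) (auto simp: power2_eq_square)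
        ultimately show ?thesis
          using dot_Cauchy_Schwarz[of n x q] x(1) ball_net_norm[OF n q(1)] by (simp add: power2_eq_square)
      qed
      then have "sqrt (dot n ?e ?e) \<le> 9 / 4" by (intro real_le_lsqrt) auto
      ultimately have "sqrt (dot n ?d ?d) * sqrt (dot n ?e ?e) \<le> 1 / 4 * (9 / 4)"
        by (intro mult_mono) auto
      then show ?thesis using BM[of ?d ?e] M0 by (meson mult_left_mono order.trans)
    qed
    finally show "s \<le> \<epsilon> + 9 / 16 * Sup S" using x(2) by (simp add: M_def)
  qed
  then have "M \<le> 16 / 7 * \<epsilon>" by simp
  then show ?thesis
    using scaled[OF upper, of y] mult_right_mono[of M "16 / 7 * \<epsilon>" "dot n y y"] by simp
qed

section \<open>The sample spectrum\<close>

text \<open>With m equations in m + 1 unknowns, a zero row completes the coefficients to a singular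
  square matrix. This is the dimension count behind both halves of Courant-Fischer.\<close>

lemma underdetermined_homogeneous:
  fixes g :: "nat \<Rightarrow> nat \<Rightarrow> real"
  obtains \<alpha> where "\<exists>k\<le>m. \<alpha> k \<noteq> 0" "\<And>b. b < m \<Longrightarrow> (\<Sum>k\<le>m. \<alpha> k * g b k) = 0"
proof -
  define A where "A = mat (Suc m) (Suc m) (\<lambda>(b, k). if b < m then g b k else 0)"
  have A: "A \<in> carrier_mat (Suc m) (Suc m)" by (simp add: A_def)
  have "transpose_mat A *\<^sub>v unit_vec (Suc m) m = 0\<^sub>v (Suc m)"
    by (rule eq_vecI) (auto simp: A_def)
  then have "det (transpose_mat A) = 0"
    using A by (subst det_0_iff_vec_prod_zero[of _ "Suc m"]) (auto intro!: exI[of _ "unit_vec (Suc m) m"])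
  then have "det A = 0" using A by (simp add: det_transpose)
  then obtain v where v: "v \<in> carrier_vec (Suc m)" "v \<noteq> 0\<^sub>v (Suc m)" "A *\<^sub>v v = 0\<^sub>v (Suc m)"
    using A by (auto simp: det_0_iff_vec_prod_zero[of _ "Suc m"])
  show ?thesis
  proof (rule that[of "\<lambda>k. v $ k"])
    show "\<exists>k\<le>m. v $ k \<noteq> 0"
    proof (rule ccontr)
      assume "\<not> ?thesis"
      then have "v = 0\<^sub>v (Suc m)" using v(1) by (intro eq_vecI) auto
      then show False using v(2) by simp
    qed
    fix b assume b: "b < m"
    have "(A *\<^sub>v v) $ b = (\<Sum>k = 0..<Suc m. A $$ (b, k) * v $ k)"
      using A v(1) b by (simp add: scalar_prod_def)
    also have "\<dots> = (\<Sum>k\<le>m. v $ k * g b k)"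
      using b by (intro sum.cong) (auto simp: A_def)
    finally show "(\<Sum>k\<le>m. v $ k * g b k) = 0" using v(3) b by simp
  qed
qed

text \<open>The second clause is the resolution of the identity, sum of u_k u_k^T = I, the form in
  which completeness enters Parseval.\<close>

definition orthobasis :: "nat \<Rightarrow> (nat \<Rightarrow> nat \<Rightarrow> real) \<Rightarrow> bool" where
  "orthobasis d u \<longleftrightarrow>
     (\<forall>k<d. \<forall>l<d. dot d (u k) (u l) = (if k = l then 1 else 0)) \<and>
     (\<forall>i<d. \<forall>j<d. (\<Sum>k<d. u k i * u k j) = (if i = j then 1 else 0))"

lemma orthobasis_Parseval:
  assumes "orthobasis d u"
  shows "dot d f g = (\<Sum>k<d. dot d (u k) f * dot d (u k) g)"
proof -
  have "(\<Sum>k<d. dot d (u k) f * dot d (u k) g) = (\<Sum>k<d. \<Sum>i<d. \<Sum>j<d. f i * g j * (u k i * u k j))"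
    unfolding dot_def sum_product by (intro sum.cong refl) simp
  also have "\<dots> = (\<Sum>i<d. \<Sum>j<d. \<Sum>k<d. f i * g j * (u k i * u k j))"
    by (subst sum.swap, rule sum.cong, rule refl, rule sum.swap)
  also have "\<dots> = (\<Sum>i<d. \<Sum>j<d. f i * g j * (if i = j then 1 else 0))"
    unfolding sum_distrib_left[symmetric] using assms by (intro sum.cong refl) (simp add: orthobasis_def)
  also have "\<dots> = dot d f g"
    by (simp add: dot_def if_distrib[of "\<lambda>c. _ * c"] cong: if_cong)
  finally show ?thesis ..
qed

text \<open>The rows z k lie in R^n. The first clause says that Z^T Z / p is within \<delta> of the
  identity in operator norm, the second that the r spike rows, divided by sqrt n, are orthonormal up
  to \<delta>. This is all that the spectral analysis takes from probability.\<close>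

definition near_isometric :: "nat \<Rightarrow> nat \<Rightarrow> nat \<Rightarrow> (nat \<Rightarrow> nat \<Rightarrow> real) \<Rightarrow> real \<Rightarrow> bool" where
  "near_isometric n p r z \<delta> \<longleftrightarrow>
     (\<forall>y. \<bar>(\<Sum>k<p. (dot n (z k) y)\<^sup>2) / real p - dot n y y\<bar> \<le> \<delta> * dot n y y) \<and>
     (\<forall>k<r. \<forall>l<r. \<bar>dot n (z k) (z l) / real n - (if k = l then 1 else 0)\<bar> \<le> \<delta>)"

text \<open>Expanding the square, each error term is at most \<delta> (c_k^2 + c_l^2) / 2, and every
  c_k^2 collects card A such contributions. For the Bessel bound, the combination q with
  coefficients <h_k, w> satisfies <q, w> = s, and Cauchy-Schwarz with |q|^2 \<le> (1 + r \<delta>) s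
  lets one factor s cancel.\<close>

lemma near_orthonormal_Bessel:
  assumes A: "finite A" "card A \<le> r" and d: "0 \<le> \<delta>"
    and h: "\<And>k l. k \<in> A \<Longrightarrow> l \<in> A \<Longrightarrow> \<bar>dot n (h k) (h l) - (if k = l then 1 else 0)\<bar> \<le> \<delta>"
  shows "\<bar>dot n (\<lambda>i. \<Sum>k\<in>A. c k * h k i) (\<lambda>i. \<Sum>k\<in>A. c k * h k i) - (\<Sum>k\<in>A. (c k)\<^sup>2)\<bar> \<le> r * \<delta> * (\<Sum>k\<in>A. (c k)\<^sup>2)"
    and "(\<Sum>k\<in>A. (dot n (h k) w)\<^sup>2) \<le> (1 + r * \<delta>) * dot n w w"
proof -
  show comb: "\<bar>dot n (\<lambda>i. \<Sum>k\<in>A. c k * h k i) (\<lambda>i. \<Sum>k\<in>A. c k * h k i) - (\<Sum>k\<in>A. (c k)\<^sup>2)\<bar> \<le> r * \<delta> * (\<Sum>k\<in>A. (c k)\<^sup>2)" for c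
  proof -
    have "dot n (\<lambda>i. \<Sum>k\<in>A. c k * h k i) (\<lambda>i. \<Sum>k\<in>A. c k * h k i) - (\<Sum>k\<in>A. (c k)\<^sup>2)
        = (\<Sum>k\<in>A. \<Sum>l\<in>A. c k * c l * (dot n (h k) (h l) - (if k = l then 1 else 0)))"
    proof -
      have "(\<Sum>k\<in>A. \<Sum>l\<in>A. c k * c l * (if k = l then 1 else 0)) = (\<Sum>k\<in>A. (c k)\<^sup>2)"
        using A(1) by (intro sum.cong refl) (simp add: if_distrib[of "\<lambda>x. _ * x"] power2_eq_square cong: if_cong)
      then show ?thesis
        unfolding dot_sum_left dot_sum_right dot_scale_left dot_scale_right
        by (simp add: right_diff_distrib sum_subtractf mult.assoc sum_distrib_left)
    qed
    also have "\<bar>\<dots>\<bar> \<le> (\<Sum>k\<in>A. \<Sum>l\<in>A. ((c k)\<^sup>2 + (c l)\<^sup>2) / 2 * \<delta>)"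
    proof (rule order.trans[OF sum_abs], rule sum_mono, rule order.trans[OF sum_abs], rule sum_mono)
      fix k l assume kl: "k \<in> A" "l \<in> A"
      have "\<bar>c k * c l\<bar> \<le> ((c k)\<^sup>2 + (c l)\<^sup>2) / 2"
        using sum_squares_bound[of "\<bar>c k\<bar>" "\<bar>c l\<bar>"] by (simp add: abs_mult)
      then show "\<bar>c k * c l * (dot n (h k) (h l) - (if k = l then 1 else 0))\<bar> \<le> ((c k)\<^sup>2 + (c l)\<^sup>2) / 2 * \<delta>"
        unfolding abs_mult[of "c k * c l"] using h[OF kl] by (intro mult_mono) auto
    qed
    also have "\<dots> = card A * \<delta> * (\<Sum>k\<in>A. (c k)\<^sup>2)"
      by (simp add: sum_distrib_right[symmetric] sum_divide_distrib[symmetric] sum.distrib algebra_simps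
        sum_distrib_left[symmetric])
    also have "\<dots> \<le> r * \<delta> * (\<Sum>k\<in>A. (c k)\<^sup>2)"
      using A(2) d by (intro mult_right_mono sum_nonneg) auto
    finally show ?thesis .
  qed
  define s where "s = (\<Sum>k\<in>A. (dot n (h k) w)\<^sup>2)"
  have s0: "0 \<le> s" by (simp add: s_def sum_nonneg)
  let ?q = "\<lambda>i. \<Sum>k\<in>A. dot n (h k) w * h k i"
  have "dot n ?q w = s"
    unfolding dot_sum_left dot_scale_left by (simp add: s_def power2_eq_square)
  then have "s\<^sup>2 \<le> dot n ?q ?q * dot n w w" using dot_Cauchy_Schwarz_square[of n ?q w] by simp
  also have "\<dots> \<le> ((1 + r * \<delta>) * s) * dot n w w"
    using comb[of "\<lambda>k. dot n (h k) w"] by (intro mult_right_mono) (auto simp: s_def algebra_simps)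
  finally have "s * s \<le> s * ((1 + r * \<delta>) * dot n w w)" by (simp add: power2_eq_square algebra_simps)
  then show "s \<le> (1 + r * \<delta>) * dot n w w"
    using s0 d by (cases "s = 0") auto
qed

section \<open>The dual Gram form of a single realisation\<close>

text \<open>No probability is present: x i is the i-th observation in R^p, u and e are the
  population eigenvectors and eigenvalues, v and lam those of the sample covariance.\<close>

locale sample_spectrum =
  fixes n p r :: nat and e lam :: "nat \<Rightarrow> real" and u v x :: "nat \<Rightarrow> nat \<Rightarrow> real"
  assumes n: "0 < n" and p: "0 < p" and rp: "r \<le> p"
    and u: "orthobasis p u" and v: "orthobasis p v"
    and e: "\<And>k. 1 \<le> e k" "\<And>k. r \<le> k \<Longrightarrow> e k = 1"
    and sample: "\<And>j k. j < p \<Longrightarrow> k < p \<Longrightarrow>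
      (\<Sum>i<n. x i j * x i k) / real n = (\<Sum>a<p. lam a * v a j * v a k)"
    and lam_mono: "\<And>a b. a \<le> b \<Longrightarrow> b < p \<Longrightarrow> lam b \<le> lam a"
begin

text \<open>The spectral problem is moved from R^p to R^n. \<open>X\<close> maps coefficients y to
  the combination of the observations, and \<open>K\<close> is the form of the dual Gram matrix
  divided by p. \<open>t a\<close> is the unnormalised dual eigenvector belonging to v a;
  \<open>z k\<close> are the whitened rows, \<open>h k\<close> the rows rescaled to length about 1,
  and \<open>w l a\<close> is the projection of h l onto the unit dual eigenvector.\<close>

definition "\<gamma> = real p / real n"
definition "X y j = (\<Sum>i<n. y i * x i j)"
definition "K y w = dot p (X y) (X w) / real p"
definition "t a i = dot p (x i) (v a)"
definition "z k i = dot p (u k) (x i) / sqrt (e k)"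
definition "h k i = z k i / sqrt (real n)"
definition "\<rho> k = (e k - 1) / \<gamma>"
definition "\<mu> a = lam a / \<gamma>"
definition "w l a = dot n (h l) (t a) / sqrt (real n * lam a)"

lemma \<gamma>_pos: "0 < \<gamma>" using n p by (simp add: \<gamma>_def)

lemma \<rho>_nonneg: "0 \<le> \<rho> k" using e(1)[of k] \<gamma>_pos by (simp add: \<rho>_def)

lemma dot_X: "dot p (X y) f = dot n y (\<lambda>i. dot p (x i) f)"
proof -
  have "dot p (X y) f = (\<Sum>i<n. dot p (\<lambda>j. y i * x i j) f)"
    unfolding X_def by (rule dot_sum_left)
  then show ?thesis by (simp add: dot_scale_left dot_def[of n])
qed

lemma dot_X_v: "dot p (v a) (X y) = dot n y (t a)"
  using dot_X[of y "v a"] by (simp add: dot_commute t_def[abs_def])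

lemma e_pos: "0 < e k" using e(1)[of k] by linarith

lemma dot_X_u: "dot p (u k) (X y) = sqrt (e k) * dot n (z k) y"
proof -
  have "dot p (u k) (X y) = dot n (\<lambda>i. sqrt (e k) * z k i) y"
    using dot_X[of y "u k"] e_pos[of k] by (simp add: dot_commute z_def)
  then show ?thesis by (simp add: dot_scale_left)
qed

text \<open>Writing e k = 1 + \<gamma> \<rho>_k splits the form into noise and spikes. The factor (e
  k - 1) / p equals \<rho>_k / n, and the 1 / n is absorbed by passing from z to h.\<close>

lemma K_decomp: "K y y' = (\<Sum>k<p. dot n (z k) y * dot n (z k) y') / real p
    + (\<Sum>k<r. \<rho> k * (dot n (h k) y * dot n (h k) y'))"
proof -
  have h: "dot n (h k) f = dot n (z k) f / sqrt (real n)" for k f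
    using dot_scale_left[of n "1 / sqrt (real n)" "z k" f] by (simp add: h_def[abs_def])
  have "K y y' = (\<Sum>k<p. e k * (dot n (z k) y * dot n (z k) y')) / real p"
    unfolding K_def orthobasis_Parseval[OF u, of "X y"] dot_X_u
  proof (rule arg_cong[where f = "\<lambda>c. c / real p"], rule sum.cong[OF refl])
    fix k
    have "sqrt (e k) * sqrt (e k) = e k" using e_pos[of k] by simp
    moreover have "sqrt (e k) * dot n (z k) y * (sqrt (e k) * dot n (z k) y')
        = (sqrt (e k) * sqrt (e k)) * (dot n (z k) y * dot n (z k) y')" by (simp only: mult_ac)
    ultimately show "sqrt (e k) * dot n (z k) y * (sqrt (e k) * dot n (z k) y') = e k * (dot n (z k) y * dot n (z k) y')"
      by simp
  qed
  also have "(\<Sum>k<p. e k * (dot n (z k) y * dot n (z k) y'))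
      = (\<Sum>k<p. dot n (z k) y * dot n (z k) y') + (\<Sum>k<p. (e k - 1) * (dot n (z k) y * dot n (z k) y'))"
    by (simp add: sum.distrib[symmetric] algebra_simps)
  also have "(\<Sum>k<p. (e k - 1) * (dot n (z k) y * dot n (z k) y')) = (\<Sum>k<r. (e k - 1) * (dot n (z k) y * dot n (z k) y'))"
    by (rule sum.mono_neutral_right) (use rp e(2) in auto)
  also have "((\<Sum>k<p. dot n (z k) y * dot n (z k) y') + (\<Sum>k<r. (e k - 1) * (dot n (z k) y * dot n (z k) y'))) / real p
      = (\<Sum>k<p. dot n (z k) y * dot n (z k) y') / real p + (\<Sum>k<r. \<rho> k * (dot n (h k) y * dot n (h k) y'))"
  proof -
    have "(\<Sum>k<r. (e k - 1) * (dot n (z k) y * dot n (z k) y')) / real p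
        = (\<Sum>k<r. \<rho> k * (dot n (h k) y * dot n (h k) y'))"
      unfolding sum_divide_distrib using n p
      by (intro sum.cong refl) (simp add: h \<rho>_def \<gamma>_def)
    then show ?thesis by (simp add: add_divide_distrib)
  qed
  finally show ?thesis .
qed

lemma sample_form:
  "(\<Sum>i<n. dot p (x i) f * dot p (x i) g) = real n * (\<Sum>a<p. lam a * (dot p (v a) f * dot p (v a) g))"
proof -
  have "(\<Sum>i<n. dot p (x i) f * dot p (x i) g) = (\<Sum>i<n. \<Sum>j<p. \<Sum>k<p. f j * g k * (x i j * x i k))"
    unfolding dot_def sum_product by (intro sum.cong refl) simp
  also have "\<dots> = (\<Sum>j<p. \<Sum>k<p. \<Sum>i<n. f j * g k * (x i j * x i k))"
    by (subst sum.swap, rule sum.cong, rule refl, rule sum.swap)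
  also have "\<dots> = (\<Sum>j<p. \<Sum>k<p. \<Sum>a<p. f j * g k * (real n * (lam a * (v a j * v a k))))"
  proof (rule sum.cong[OF refl], rule sum.cong[OF refl])
    fix j k assume "j \<in> {..<p}" "k \<in> {..<p}"
    then have "(\<Sum>i<n. x i j * x i k) = real n * (\<Sum>a<p. lam a * v a j * v a k)"
      using sample[of j k] n by (simp add: field_simps)
    then show "(\<Sum>i<n. f j * g k * (x i j * x i k)) = (\<Sum>a<p. f j * g k * (real n * (lam a * (v a j * v a k))))"
      by (simp add: sum_distrib_left[symmetric] mult.assoc)
  qed
  also have "\<dots> = (\<Sum>a<p. \<Sum>j<p. \<Sum>k<p. f j * g k * (real n * (lam a * (v a j * v a k))))"
    by (rule trans[OF sum.cong[OF refl sum.swap] sum.swap])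
  also have "\<dots> = real n * (\<Sum>a<p. lam a * (dot p (v a) f * dot p (v a) g))"
  proof -
    have "dot p (v a) f * dot p (v a) g = (\<Sum>j<p. \<Sum>k<p. (v a j * f j) * (v a k * g k))" for a
      unfolding dot_def by (rule sum_product)
    then show ?thesis
      by (simp only: sum_distrib_left) (intro sum.cong refl, simp only: mult_ac)
  qed
  finally show ?thesis .
qed

lemma v_orthonormal: "a < p \<Longrightarrow> b < p \<Longrightarrow> dot p (v a) (v b) = (if a = b then 1 else 0)"
  using v by (simp add: orthobasis_def)

lemma sample_form_v:
  assumes "b < p"
  shows "(\<Sum>i<n. dot p (x i) f * t b i) = real n * lam b * dot p (v b) f"
proof -
  have "(\<Sum>i<n. dot p (x i) f * t b i) = real n * (\<Sum>a<p. lam a * (dot p (v a) f * dot p (v a) (v b)))"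
    unfolding t_def by (rule sample_form)
  also have "(\<Sum>a<p. lam a * (dot p (v a) f * dot p (v a) (v b))) = (\<Sum>a<p. if a = b then lam b * dot p (v b) f else 0)"
    using assms by (intro sum.cong refl) (auto simp: v_orthonormal)
  finally show ?thesis using assms by simp
qed

text \<open>The singular value correspondence: the images in R^n of the orthonormal v a stay
  orthogonal. Their squared lengths n * lam a also show that the sample eigenvalues are
  nonnegative.\<close>

lemma dot_t: "a < p \<Longrightarrow> b < p \<Longrightarrow> dot n (t a) (t b) = (if a = b then real n * lam a else 0)"
  using sample_form_v[of b "v a"] by (auto simp: dot_def[of n] t_def[symmetric] v_orthonormal)

lemma lam_nonneg: "a < p \<Longrightarrow> 0 \<le> lam a"
  using dot_t[of a a] dot_nonneg[of n "t a"] n by (simp add: zero_le_mult_iff)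

lemma K_t: 
  assumes "a < p" 
  shows "K (t a) y = \<mu> a * dot n (t a) y"
proof -
  have "K (t a) y = (\<Sum>b<p. dot n (t a) (t b) * dot n y (t b)) / real p"
    unfolding K_def orthobasis_Parseval[OF v, of "X (t a)"] dot_X_v ..
  also have "(\<Sum>b<p. dot n (t a) (t b) * dot n y (t b)) = (\<Sum>b<p. if b = a then real n * lam a * dot n y (t a) else 0)"
    using assms by (intro sum.cong refl) (auto simp: dot_t)
  finally show ?thesis using assms by (simp add: \<mu>_def \<gamma>_def dot_commute)
qed

text \<open>Expanding y in the t b is avoided, since those with lam b = 0 degenerate. Instead q = |X
  y|^2 = <y, X^T X y> gives q^2 \<le> |y|^2 |X^T X y|^2, and the last factor is a lam-weighted sum
  of <y, t b>^2 over b \<ge> a, hence at most n * lam a * q.\<close>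

lemma K_upper:
  assumes a: "a < p" and y: "\<And>b. b < a \<Longrightarrow> dot n y (t b) = 0"
  shows "K y y \<le> \<mu> a * dot n y y"
proof -
  define q where "q = dot p (X y) (X y)"
  have q: "q = (\<Sum>b<p. (dot n y (t b))\<^sup>2)"
    unfolding q_def orthobasis_Parseval[OF v, of "X y"] dot_X_v by (simp add: power2_eq_square)
  have q0: "0 \<le> q" by (simp add: q_def)
  have "q = dot n y (\<lambda>i. dot p (x i) (X y))" by (simp add: q_def dot_X)
  then have "q\<^sup>2 \<le> dot n y y * dot n (\<lambda>i. dot p (x i) (X y)) (\<lambda>i. dot p (x i) (X y))"
    using dot_Cauchy_Schwarz_square[of n y "\<lambda>i. dot p (x i) (X y)"] by simp
  also have "dot n (\<lambda>i. dot p (x i) (X y)) (\<lambda>i. dot p (x i) (X y)) = real n * (\<Sum>b<p. lam b * (dot n y (t b))\<^sup>2)"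
    unfolding dot_def[of n "\<lambda>i. dot p (x i) (X y)"] sample_form dot_X_v by (simp add: power2_eq_square)
  finally have q2: "q\<^sup>2 \<le> dot n y y * (real n * (\<Sum>b<p. lam b * (dot n y (t b))\<^sup>2))" .
  have "(\<Sum>b<p. lam b * (dot n y (t b))\<^sup>2) \<le> (\<Sum>b<p. lam a * (dot n y (t b))\<^sup>2)"
  proof (rule sum_mono)
    fix b assume "b \<in> {..<p}"
    then show "lam b * (dot n y (t b))\<^sup>2 \<le> lam a * (dot n y (t b))\<^sup>2"
      using y[of b] lam_mono[of a b] by (cases "b < a") (auto intro!: mult_right_mono)
  qed
  also have "(\<Sum>b<p. lam a * (dot n y (t b))\<^sup>2) = lam a * q" by (simp add: q sum_distrib_left)
  finally have "dot n y y * (real n * (\<Sum>b<p. lam b * (dot n y (t b))\<^sup>2)) \<le> dot n y y * (real n * (lam a * q))"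
    by (intro mult_left_mono) auto
  with q2 have "q * q \<le> q * (real n * lam a * dot n y y)"
    by (simp add: power2_eq_square mult_ac)
  then have "q \<le> real n * lam a * dot n y y"
    using q0 lam_nonneg[OF a] by (cases "q = 0") auto
  then have "q / real p \<le> real n * lam a * dot n y y / real p" by (simp add: divide_right_mono)
  then show ?thesis by (simp add: K_def q_def \<mu>_def \<gamma>_def mult_ac)
qed

text \<open>Since X (t a) = n * lam a * v a, the cosine between u k and v a is a rescaled projection
  of z k onto t a. The factor is e k / lam a, rewritten so that it has a limit after division by
  \<gamma>.\<close>

lemma overlap:
  assumes "a < p" "0 < lam a"
  shows "(dot p (u k) (v a))\<^sup>2 = (\<rho> k + 1 / \<gamma>) / \<mu> a * (w k a)\<^sup>2"
proof -
  have "(\<Sum>i<n. dot p (x i) (u k) * t a i) = real n * lam a * dot p (u k) (v a)"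
    using sample_form_v[OF assms(1), of "u k"] by (simp add: dot_commute)
  moreover have "(\<Sum>i<n. dot p (x i) (u k) * t a i) = sqrt (e k) * dot n (z k) (t a)"
    using e_pos[of k]
    by (simp add: dot_def[of n] z_def sum_distrib_left dot_commute[of p "u k"] mult.commute)
  moreover have "dot n (h k) (t a) = dot n (z k) (t a) / sqrt (real n)"
    using dot_scale_left[of n "1 / sqrt (real n)" "z k" "t a"] by (simp add: h_def[abs_def])
  ultimately have "real n * lam a * dot p (u k) (v a) = sqrt (e k) * (sqrt (real n) * (sqrt (real n * lam a) * w k a))"
    using n assms(2) by (simp add: w_def)
  then have "(real n * lam a * dot p (u k) (v a))\<^sup>2 = e k * (real n * (real n * lam a * (w k a)\<^sup>2))"
    using n assms(2) e_pos[of k] by (simp add: power_mult_distrib)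
  moreover have eq: "(\<rho> k + 1 / \<gamma>) / \<mu> a = e k / lam a"
    using \<gamma>_pos by (simp add: \<rho>_def \<mu>_def field_simps)
  ultimately show ?thesis
    unfolding eq using n assms(2) by (simp add: power_mult_distrib power2_eq_square field_simps)
qed

section \<open>Spectral estimates under near-isometry\<close>

context
  fixes \<delta> :: real
  assumes good: "near_isometric n p r z \<delta>" and small: "0 \<le> \<delta>" "\<delta> \<le> 1" "r * \<delta> \<le> 1 / 2"
begin

lemma h_gram: "k < r \<Longrightarrow> l < r \<Longrightarrow> \<bar>dot n (h k) (h l) - (if k = l then 1 else 0)\<bar> \<le> \<delta>"
proof -
  assume kl: "k < r" "l < r"
  have "dot n (h k) (h l) = dot n (z k) (z l) / real n"
    using n dot_scale_left[of n "1 / sqrt (real n)" "z k" "h l"] dot_scale_right[of n "z k" "1 / sqrt (real n)" "z l"]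
    by (simp add: h_def[abs_def])
  then show ?thesis using good kl by (simp add: near_isometric_def)
qed

lemma noise: "\<bar>(\<Sum>k<p. (dot n (z k) y)\<^sup>2) / real p - dot n y y\<bar> \<le> \<delta> * dot n y y"
  using good by (simp add: near_isometric_def)

lemma Bessel: "A \<subseteq> {..<r} \<Longrightarrow> (\<Sum>k\<in>A. (dot n (h k) y)\<^sup>2) \<le> (1 + r * \<delta>) * dot n y y"
  using card_mono[of "{..<r}" A] finite_subset[of A "{..<r}"]
  by (intro near_orthonormal_Bessel(2) h_gram small(1)) auto

lemma K_diag: "K y y = (\<Sum>k<p. (dot n (z k) y)\<^sup>2) / real p + (\<Sum>k<r. \<rho> k * (dot n (h k) y)\<^sup>2)"
  using K_decomp[of y y] by (simp add: power2_eq_square)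

text \<open>The span of h_0, ..., h_a has one dimension more than there are constraints, so it
  contains a nonzero y orthogonal to t_0, ..., t_(a-1), and \<open>K_upper\<close> bounds K y y from
  above. From below, y = sum of \<alpha>_k h_k and Cauchy-Schwarz show that the h_k, k \<le> a,
  capture almost all of |y|^2; the remaining spikes only add.\<close>

lemma \<mu>_lower:
  assumes a: "a < r" and c: "0 \<le> c" "\<And>k. k \<le> a \<Longrightarrow> c \<le> \<rho> k"
  shows "(1 - \<delta>) + c * (1 - r * \<delta>) \<le> \<mu> a"
proof -
  obtain \<alpha> where \<alpha>: "\<exists>k\<le>a. \<alpha> k \<noteq> 0" "\<And>b. b < a \<Longrightarrow> (\<Sum>k\<le>a. \<alpha> k * dot n (h k) (t b)) = 0"
    using underdetermined_homogeneous[of a "\<lambda>b k. dot n (h k) (t b)"] by blast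
  define y where "y = (\<lambda>i. \<Sum>k\<le>a. \<alpha> k * h k i)"
  have y_dot: "dot n y f = (\<Sum>k\<le>a. \<alpha> k * dot n (h k) f)" for f
    by (simp add: y_def dot_sum_left dot_scale_left)
  define A where "A = (\<Sum>k\<le>a. (\<alpha> k)\<^sup>2)"
  have A: "0 < A"
    using \<alpha>(1) by (auto simp: A_def intro!: sum_pos2)
  have "\<bar>dot n y y - A\<bar> \<le> r * \<delta> * A"
    unfolding y_def A_def using a
    by (intro near_orthonormal_Bessel(1) h_gram small(1)) auto
  then have yA: "(1 - r * \<delta>) * A \<le> dot n y y" by (auto simp: algebra_simps)
  have y0: "0 < dot n y y"
  proof -
    have "0 < (1 - r * \<delta>) * A" using A small by (intro mult_pos_pos) auto
    then show ?thesis using yA by linarith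
  qed
  define s where "s = (\<Sum>k\<le>a. (dot n (h k) y)\<^sup>2)"
  have "(dot n y y)\<^sup>2 \<le> A * s"
  proof -
    have "(dot n y y)\<^sup>2 = (\<Sum>k\<le>a. \<alpha> k * dot n (h k) y)\<^sup>2" using y_dot[of y] by simp
    also have "\<dots> \<le> A * s" unfolding A_def s_def by (rule Cauchy_Schwarz_ineq_sum)
    finally show ?thesis .
  qed
  then have "(1 - r * \<delta>) * (dot n y y)\<^sup>2 \<le> (1 - r * \<delta>) * A * s"
    using small by (simp add: mult_left_mono mult.assoc)
  also have "\<dots> \<le> dot n y y * s"
    using yA by (intro mult_right_mono) (auto simp: s_def sum_nonneg)
  finally have s: "(1 - r * \<delta>) * dot n y y \<le> s"
    using y0 by (simp add: power2_eq_square mult.assoc mult.left_commute[of _ "dot n y y"])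
  have "(1 - \<delta>) * dot n y y + c * ((1 - r * \<delta>) * dot n y y) \<le> (\<Sum>k<p. (dot n (z k) y)\<^sup>2) / real p + c * s"
    using noise[of y] c s by (intro add_mono mult_left_mono) (auto simp: algebra_simps abs_le_iff)
  also have "c * s \<le> (\<Sum>k\<le>a. \<rho> k * (dot n (h k) y)\<^sup>2)"
    unfolding s_def sum_distrib_left using c by (intro sum_mono mult_right_mono) auto
  also have "\<dots> \<le> (\<Sum>k<r. \<rho> k * (dot n (h k) y)\<^sup>2)"
    using a \<rho>_nonneg by (intro sum_mono2) auto
  finally have "((1 - \<delta>) + c * (1 - r * \<delta>)) * dot n y y \<le> K y y"
    by (simp add: K_diag algebra_simps)
  also have "\<dots> \<le> \<mu> a * dot n y y"
    using a rp \<alpha>(2) by (intro K_upper) (auto simp: y_dot)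
  finally show ?thesis using y0 by simp
qed

text \<open>The dual choice: a combination of t_0, ..., t_a orthogonal to h_0, ..., h_(a-1). On it K
  is at least \<mu>_a |y|^2, while only spikes from a on contribute. Positivity of lam keeps y from
  vanishing, because t b has length 0 when lam b = 0.\<close>

lemma \<mu>_upper:
  assumes a: "a < r" and pos: "\<And>b. b \<le> a \<Longrightarrow> 0 < lam b" and c: "\<And>k. a \<le> k \<Longrightarrow> k < r \<Longrightarrow> \<rho> k \<le> c"
  shows "\<mu> a \<le> (1 + \<delta>) + c * (1 + r * \<delta>)"
proof -
  obtain \<alpha> where \<alpha>: "\<exists>b\<le>a. \<alpha> b \<noteq> 0" "\<And>k. k < a \<Longrightarrow> (\<Sum>b\<le>a. \<alpha> b * dot n (h k) (t b)) = 0"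
    using underdetermined_homogeneous[of a "\<lambda>k b. dot n (h k) (t b)"] by blast
  define y where "y = (\<lambda>i. \<Sum>b\<le>a. \<alpha> b * t b i)"
  have y_dot: "dot n y f = (\<Sum>b\<le>a. \<alpha> b * dot n (t b) f)" for f
    by (simp add: y_def dot_sum_left dot_scale_left)
  have yt: "dot n (t b) y = \<alpha> b * (real n * lam b)" if "b \<le> a" for b
  proof -
    have "dot n (t b) y = (\<Sum>c\<le>a. if c = b then \<alpha> b * (real n * lam b) else 0)"
      unfolding dot_commute[of n "t b"] y_dot
      using that a rp by (intro sum.cong refl) (auto simp: dot_t)
    then show ?thesis using that by simp
  qed
  have yy: "dot n y y = (\<Sum>b\<le>a. (\<alpha> b)\<^sup>2 * (real n * lam b))"
    unfolding y_dot using yt by (intro sum.cong refl) (simp add: power2_eq_square)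
  have y0: "0 < dot n y y"
    unfolding yy using \<alpha>(1) pos n by (auto intro!: sum_pos2 mult_nonneg_nonneg simp: less_imp_le)
  have Ky: "K (t b) y = \<mu> b * dot n (t b) y" if "b \<le> a" for b
    using that a rp by (intro K_t) auto
  have "K y y = (\<Sum>b\<le>a. \<alpha> b * K (t b) y)"
  proof -
    have "X y = (\<lambda>j. \<Sum>b\<le>a. \<alpha> b * X (t b) j)"
      unfolding X_def y_def by (rule ext) (simp add: sum_distrib_left sum_distrib_right mult.assoc, rule sum.swap)
    then show ?thesis
      unfolding K_def by (simp add: dot_sum_left dot_scale_left sum_divide_distrib)
  qed
  also have "\<dots> = (\<Sum>b\<le>a. \<mu> b * ((\<alpha> b)\<^sup>2 * (real n * lam b)))"
    using Ky yt by (intro sum.cong refl) (simp add: power2_eq_square)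
  finally have "\<mu> a * dot n y y \<le> K y y"
    unfolding yy sum_distrib_left
    using a rp pos n lam_mono \<gamma>_pos
    by (auto intro!: sum_mono mult_right_mono divide_right_mono mult_nonneg_nonneg simp: \<mu>_def less_imp_le)
  also have "\<dots> \<le> (1 + \<delta>) * dot n y y + c * ((1 + r * \<delta>) * dot n y y)"
  proof -
    have "(\<Sum>k<p. (dot n (z k) y)\<^sup>2) / real p \<le> (1 + \<delta>) * dot n y y"
      using noise[of y] by (auto simp: algebra_simps abs_le_iff)
    moreover have "(\<Sum>k<r. \<rho> k * (dot n (h k) y)\<^sup>2) \<le> c * ((1 + r * \<delta>) * dot n y y)"
    proof -
      have "c \<ge> 0" using c[of a] a \<rho>_nonneg[of a] by simp
      have hy: "dot n (h k) y = 0" if "k < a" for k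
        using \<alpha>(2)[OF that] by (simp add: dot_commute[of n "h k"] y_dot)
      have "(\<Sum>k<r. \<rho> k * (dot n (h k) y)\<^sup>2) \<le> (\<Sum>k<r. c * (dot n (h k) y)\<^sup>2)"
      proof (rule sum_mono)
        fix k assume "k \<in> {..<r}"
        then show "\<rho> k * (dot n (h k) y)\<^sup>2 \<le> c * (dot n (h k) y)\<^sup>2"
          using hy[of k] c[of k] by (cases "k < a") (auto intro!: mult_right_mono)
      qed
      also have "\<dots> \<le> c * ((1 + r * \<delta>) * dot n y y)"
        unfolding sum_distrib_left[symmetric] using \<open>c \<ge> 0\<close> by (intro mult_left_mono Bessel) auto
      finally show ?thesis .
    qed
    ultimately show ?thesis unfolding K_diag by linarith
  qed
  also have "\<dots> = ((1 + \<delta>) + c * (1 + r * \<delta>)) * dot n y y" by (simp add: algebra_simps)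
  finally show ?thesis using y0 by simp
qed

context
  fixes a :: nat
  assumes a: "a < r" and lam_pos: "0 < lam a"
begin

definition "yv i = t a i / sqrt (real n * lam a)"

lemma yv_unit: "dot n yv yv = 1"
  using dot_scale_left[of n "1 / sqrt (real n * lam a)" "t a" yv]
    dot_scale_right[of n "t a" "1 / sqrt (real n * lam a)" "t a"] dot_t[of a a] a rp lam_pos n
  by (simp add: yv_def[abs_def])

lemma dot_h_yv: "dot n (h l) yv = w l a"
  using dot_scale_right[of n "h l" "1 / sqrt (real n * lam a)" "t a"] by (simp add: yv_def[abs_def] w_def)

lemma K_yv: "K yv y = \<mu> a * dot n yv y"
proof -
  have "X yv = (\<lambda>j. (1 / sqrt (real n * lam a)) * X (t a) j)"
    by (rule ext) (simp add: X_def yv_def sum_divide_distrib)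
  then have "K yv y = (1 / sqrt (real n * lam a)) * K (t a) y"
    unfolding K_def by (simp add: dot_scale_left del: times_divide_eq_left)
  moreover have "dot n yv y = (1 / sqrt (real n * lam a)) * dot n (t a) y"
    using dot_scale_left[of n "1 / sqrt (real n * lam a)" "t a" y] by (simp add: yv_def[abs_def])
  ultimately show ?thesis using a rp by (simp add: K_t)
qed

lemma w_bound: "\<bar>w l a\<bar> \<le> 2" if "l < r"
proof -
  have "(w l a)\<^sup>2 \<le> (\<Sum>k<r. (w k a)\<^sup>2)"
    by (rule member_le_sum) (use that in auto)
  also have "\<dots> \<le> 1 + r * \<delta>"
    using Bessel[of "{..<r}" yv] by (simp add: dot_h_yv yv_unit)
  also have "\<dots> \<le> 2\<^sup>2" using small by simp
  finally show ?thesis using abs_le_square_iff[of "w l a" 2] by simp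
qed

text \<open>This is the decomposition of K on the diagonal, evaluated at the unit dual eigenvector,
  where K equals \<mu>_a and the noise part is 1 up to \<delta>.\<close>

lemma energy: "\<bar>\<mu> a - 1 - (\<Sum>k<r. \<rho> k * (w k a)\<^sup>2)\<bar> \<le> \<delta>"
  using noise[of yv] K_diag[of yv] by (simp add: yv_unit K_yv dot_h_yv)

text \<open>Near-orthonormality replaces the coupled sum of \<rho>_k w_k <h_k, h_l> by \<rho>_l w_l.
  The first error 2 \<delta> is the polarised noise form against a vector of length at most 2, the
  others use |w_k| \<le> 2. For separated spikes it forces the off-diagonal w to 0.\<close>

lemma eigen_equation:
  assumes l: "l < r"
  shows "\<bar>(1 + \<rho> l - \<mu> a) * w l a\<bar> \<le> 2 * \<delta> * (1 + (\<Sum>k<r. \<rho> k))"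
proof -
  define N where "N y y' = (\<Sum>k<p. dot n (z k) y * dot n (z k) y') / real p - dot n y y'" for y y'
  have N: "\<bar>N yv (h l)\<bar> \<le> \<delta> * (sqrt (dot n yv yv) * sqrt (dot n (h l) (h l)))"
    unfolding N_def
    by (rule symmetric_bilinear_polarization[OF symmetric_bilinear_gram])
      (use noise small in \<open>simp_all add: power2_eq_square\<close>)
  have "dot n (h l) (h l) \<le> 2\<^sup>2" using h_gram[OF l l] small by (simp add: abs_le_iff)
  then have "sqrt (dot n (h l) (h l)) \<le> 2" by (intro real_le_lsqrt) auto
  then have N2: "\<bar>N yv (h l)\<bar> \<le> 2 * \<delta>"
    using N small mult_left_mono[of "sqrt (dot n (h l) (h l))" 2 \<delta>] by (simp add: yv_unit)
  have "K yv (h l) = N yv (h l) + w l a + (\<Sum>k<r. \<rho> k * (w k a * dot n (h k) (h l)))"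
    unfolding K_decomp N_def dot_h_yv by (simp add: dot_commute[of n yv] dot_h_yv)
  moreover have "K yv (h l) = \<mu> a * w l a"
    unfolding K_yv by (simp add: dot_commute[of n yv] dot_h_yv)
  moreover have "(\<Sum>k<r. \<rho> k * (w k a * dot n (h k) (h l)))
      = (\<Sum>k<r. \<rho> k * (w k a * (dot n (h k) (h l) - (if k = l then 1 else 0)))) + \<rho> l * w l a"
  proof -
    have "(\<Sum>k<r. \<rho> k * (w k a * (if k = l then 1 else 0))) = (\<Sum>k<r. if k = l then \<rho> l * w l a else 0)"
      by (intro sum.cong) auto
    also have "\<dots> = \<rho> l * w l a" using l by simp
    finally show ?thesis by (simp add: right_diff_distrib sum_subtractf)
  qed
  ultimately have "(1 + \<rho> l - \<mu> a) * w l a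
      = - N yv (h l) - (\<Sum>k<r. \<rho> k * (w k a * (dot n (h k) (h l) - (if k = l then 1 else 0))))"
    by (simp add: algebra_simps)
  then have "\<bar>(1 + \<rho> l - \<mu> a) * w l a\<bar>
      \<le> \<bar>N yv (h l)\<bar> + \<bar>\<Sum>k<r. \<rho> k * (w k a * (dot n (h k) (h l) - (if k = l then 1 else 0)))\<bar>" by linarith
  also have "\<bar>\<Sum>k<r. \<rho> k * (w k a * (dot n (h k) (h l) - (if k = l then 1 else 0)))\<bar> \<le> (\<Sum>k<r. \<rho> k * (2 * \<delta>))"
  proof (rule order.trans[OF sum_abs], rule sum_mono)
    fix k assume "k \<in> {..<r}"
    then have "\<bar>w k a * (dot n (h k) (h l) - (if k = l then 1 else 0))\<bar> \<le> 2 * \<delta>"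
      unfolding abs_mult using w_bound[of k] h_gram[of k l] l by (intro mult_mono) auto
    then show "\<bar>\<rho> k * (w k a * (dot n (h k) (h l) - (if k = l then 1 else 0)))\<bar> \<le> \<rho> k * (2 * \<delta>)"
      unfolding abs_mult[of "\<rho> k"] using \<rho>_nonneg[of k] by (simp add: mult_left_mono)
  qed
  also have "(\<Sum>k<r. \<rho> k * (2 * \<delta>)) = 2 * \<delta> * (\<Sum>k<r. \<rho> k)" by (simp add: sum_distrib_right[symmetric])
  finally show ?thesis using N2 by (simp add: algebra_simps)
qed

end

end

end

section \<open>Near-isometry of white noise\<close>

text \<open>Gaussianity of the p by n matrix is expressed through the functionals b^T Z y, with
  variance |b|^2 |y|^2. A unit y yields an isotropic vector in R^p, a unit b one in R^n; both
  directions are used.\<close>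

definition white_noise :: "'a measure \<Rightarrow> nat \<Rightarrow> nat \<Rightarrow> (nat \<Rightarrow> nat \<Rightarrow> 'a \<Rightarrow> real) \<Rightarrow> bool" where
  "white_noise M n p z \<longleftrightarrow>
     (\<forall>k<p. \<forall>i<n. z k i \<in> borel_measurable M) \<and>
     (\<forall>b y. (\<exists>k<p. b k \<noteq> 0) \<longrightarrow> (\<exists>i<n. y i \<noteq> 0) \<longrightarrow>
        distributed M lborel (\<lambda>\<omega>. \<Sum>k<p. \<Sum>i<n. b k * y i * z k i \<omega>)
          (normal_density 0 (sqrt ((\<Sum>k<p. (b k)\<^sup>2) * (\<Sum>i<n. (y i)\<^sup>2)))))"

lemma white_noise_measurable: "white_noise M n p z \<Longrightarrow> k < p \<Longrightarrow> i < n \<Longrightarrow> z k i \<in> borel_measurable M"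
  by (simp add: white_noise_def)

lemma sum_squares_pos_imp_ex: "0 < (\<Sum>i<n. (y i :: real)\<^sup>2) \<Longrightarrow> \<exists>i<n. y i \<noteq> 0"
  by (metis (no_types, lifting) less_irrefl lessThan_iff power_zero_numeral sum.neutral)

lemma white_noise_isotropic_left:
  assumes z: "white_noise M n p z" and q: "dot n q q = 1"
  shows "isotropic_gaussian M p (\<lambda>k \<omega>. dot n (\<lambda>i. z k i \<omega>) q)"
  unfolding isotropic_gaussian_def
proof (intro conjI allI impI)
  note [measurable] = white_noise_measurable[OF z]
  show "(\<lambda>\<omega>. dot n (\<lambda>i. z k i \<omega>) q) \<in> borel_measurable M" if "k < p" for k
    using that unfolding dot_def by measurable
  fix b :: "nat \<Rightarrow> real" assume b: "\<exists>k<p. b k \<noteq> 0"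
  have q1: "(\<Sum>i<n. (q i)\<^sup>2) = 1" using q by (simp add: dot_def power2_eq_square)
  then have "\<exists>i<n. q i \<noteq> 0" by (intro sum_squares_pos_imp_ex) simp
  then have "distributed M lborel (\<lambda>\<omega>. \<Sum>k<p. \<Sum>i<n. b k * q i * z k i \<omega>)
      (normal_density 0 (sqrt ((\<Sum>k<p. (b k)\<^sup>2) * (\<Sum>i<n. (q i)\<^sup>2))))"
    using z b by (simp add: white_noise_def)
  moreover have "(\<lambda>\<omega>. \<Sum>k<p. \<Sum>i<n. b k * q i * z k i \<omega>) = (\<lambda>\<omega>. \<Sum>k<p. b k * dot n (\<lambda>i. z k i \<omega>) q)"
    by (simp add: dot_def sum_distrib_left mult_ac)
  ultimately show "distributed M lborel (\<lambda>\<omega>. \<Sum>k<p. b k * dot n (\<lambda>i. z k i \<omega>) q)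
      (normal_density 0 (sqrt (\<Sum>k<p. (b k)\<^sup>2)))"
    using q1 by simp
qed

lemma white_noise_isotropic_right:
  assumes z: "white_noise M n p z" and a: "(\<Sum>k<p. (a k)\<^sup>2) = 1"
  shows "isotropic_gaussian M n (\<lambda>i \<omega>. \<Sum>k<p. a k * z k i \<omega>)"
  unfolding isotropic_gaussian_def
proof (intro conjI allI impI)
  note [measurable] = white_noise_measurable[OF z]
  show "(\<lambda>\<omega>. \<Sum>k<p. a k * z k i \<omega>) \<in> borel_measurable M" if "i < n" for i
    using that by measurable
  fix y :: "nat \<Rightarrow> real" assume y: "\<exists>i<n. y i \<noteq> 0"
  have "\<exists>k<p. a k \<noteq> 0" using a by (intro sum_squares_pos_imp_ex) simp
  then have "distributed M lborel (\<lambda>\<omega>. \<Sum>k<p. \<Sum>i<n. a k * y i * z k i \<omega>)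
      (normal_density 0 (sqrt ((\<Sum>k<p. (a k)\<^sup>2) * (\<Sum>i<n. (y i)\<^sup>2))))"
    using z y by (simp add: white_noise_def)
  moreover have "(\<Sum>k<p. \<Sum>i<n. a k * y i * z k i \<omega>) = (\<Sum>i<n. y i * (\<Sum>k<p. a k * z k i \<omega>))" for \<omega>
    by (subst sum.swap) (simp add: sum_distrib_left mult_ac)
  ultimately show "distributed M lborel (\<lambda>\<omega>. \<Sum>i<n. y i * (\<Sum>k<p. a k * z k i \<omega>))
      (normal_density 0 (sqrt (\<Sum>i<n. (y i)\<^sup>2)))"
    using a by simp
qed

text \<open>Take the smallest tolerance 1 / (m + 1) with m \<le> n that works at n; the cutoff on m
  keeps the choice finite.\<close>

lemma eventually_vanishing_parameter:
  assumes P: "\<And>m. \<forall>\<^sub>F n in sequentially. P n (1 / real (Suc m))"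
  obtains \<delta> where "\<delta> \<longlonglongrightarrow> (0::real)" "\<And>n. 0 \<le> \<delta> n" "\<forall>\<^sub>F n in sequentially. P n (\<delta> n)"
proof -
  \<comment> \<open>The default 1 is the tolerance for m = 0, which works eventually, so falling
    back on it is harmless in the limit.\<close>
  define D where "D n = insert 1 {1 / real (Suc m) | m. m \<le> n \<and> P n (1 / real (Suc m))}" for n
  have fin: "finite (D n)" for n by (simp add: D_def)
  define \<delta> where "\<delta> n = Min (D n)" for n
  have mem: "\<delta> n \<in> D n" for n unfolding \<delta>_def by (rule Min_in[OF fin]) (simp add: D_def)
  have pos: "0 \<le> \<delta> n" for n using mem[of n] by (auto simp: D_def)
  have le: "\<forall>\<^sub>F n in sequentially. \<delta> n \<le> 1 / real (Suc m)" for m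
    using P[of m] eventually_ge_at_top[of m]
  proof eventually_elim
    case (elim n)
    then have "1 / real (Suc m) \<in> D n" by (auto simp: D_def)
    then show ?case unfolding \<delta>_def using fin by simp
  qed
  have "\<delta> \<longlonglongrightarrow> 0"
  proof (rule LIMSEQ_I)
    fix e :: real assume "0 < e"
    then obtain m where "1 / real (Suc m) < e" using nat_approx_posE by (metis)
    with le[of m] have "\<forall>\<^sub>F n in sequentially. norm (\<delta> n - 0) < e"
      using pos by (auto elim!: eventually_mono)
    then show "\<exists>N. \<forall>n\<ge>N. norm (\<delta> n - 0) < e" by (simp add: eventually_sequentially)
  qed
  moreover have "\<forall>\<^sub>F n in sequentially. P n (\<delta> n)"
    using P[of 0]
  proof eventually_elim
    case (elim n)
    then show ?case using mem[of n] by (auto simp: D_def)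
  qed
  ultimately show ?thesis using that pos by blast
qed

context prob_space begin

text \<open>Normalising q makes the rows' projections isotropic in R^p. As |q|^2 \<le> 25 / 16 < 2,
  a deviation \<delta> forces a normalised deviation \<delta> / 2, which turns the rate \<delta>^2 /
  16 into \<delta>^2 / 64.\<close>

lemma white_noise_form_concentration:
  assumes z: "white_noise M n p z" and p: "0 < p" and d: "0 < \<delta>" "\<delta> < 1" and q: "dot n q q \<le> 25 / 16"
  shows "prob {\<omega>\<in>space M. \<delta> < \<bar>(\<Sum>k<p. (dot n (\<lambda>i. z k i \<omega>) q)\<^sup>2) / real p - dot n q q\<bar>}
    \<le> 2 * exp (- (\<delta>\<^sup>2 / 64) * real p)"
proof (cases "dot n q q = 0")
  case True
  then have "dot n f q = 0" for f
    using dot_Cauchy_Schwarz_square[of n f q] by simp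
  then have "{\<omega>\<in>space M. \<delta> < \<bar>(\<Sum>k<p. (dot n (\<lambda>i. z k i \<omega>) q)\<^sup>2) / real p - dot n q q\<bar>} = {}"
    using d True by simp
  then show ?thesis by (simp only: measure_empty) simp
next
  case False
  define c where "c = sqrt (dot n q q)"
  have c: "0 < c" "c\<^sup>2 = dot n q q" using False dot_nonneg[of n q] by (auto simp: c_def less_le)
  define q' where "q' = (\<lambda>i. (1 / c) * q i)"
  have "dot n q' q' = 1"
    unfolding q'_def dot_scale_left dot_scale_right c(2)[symmetric] using c(1) by (simp add: power2_eq_square)
  note iso = white_noise_isotropic_left[OF z this]
  have [measurable]: "k < p \<Longrightarrow> (\<lambda>\<omega>. dot n (\<lambda>i. z k i \<omega>) q') \<in> borel_measurable M" for k
    using iso by (simp add: isotropic_gaussian_def)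
  have dq: "dot n f q = c * dot n f q'" for f
    unfolding q'_def dot_scale_right using c by simp
  have "prob {\<omega>\<in>space M. \<delta> < \<bar>(\<Sum>k<p. (dot n (\<lambda>i. z k i \<omega>) q)\<^sup>2) / real p - dot n q q\<bar>}
      \<le> prob {\<omega>\<in>space M. \<delta> / 2 * real p \<le> \<bar>(\<Sum>k<p. (dot n (\<lambda>i. z k i \<omega>) q')\<^sup>2) - real p\<bar>}"
  proof (rule finite_measure_mono)
    show "{\<omega>\<in>space M. \<delta> < \<bar>(\<Sum>k<p. (dot n (\<lambda>i. z k i \<omega>) q)\<^sup>2) / real p - dot n q q\<bar>}
      \<subseteq> {\<omega>\<in>space M. \<delta> / 2 * real p \<le> \<bar>(\<Sum>k<p. (dot n (\<lambda>i. z k i \<omega>) q')\<^sup>2) - real p\<bar>}"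
    proof safe
      fix \<omega> assume w: "\<delta> < \<bar>(\<Sum>k<p. (dot n (\<lambda>i. z k i \<omega>) q)\<^sup>2) / real p - dot n q q\<bar>"
      let ?S = "\<Sum>k<p. (dot n (\<lambda>i. z k i \<omega>) q')\<^sup>2"
      have "(\<Sum>k<p. (dot n (\<lambda>i. z k i \<omega>) q)\<^sup>2) / real p - dot n q q = c\<^sup>2 * ((?S - real p) / real p)"
        unfolding dq[of "\<lambda>i. z _ i \<omega>"] power_mult_distrib sum_distrib_left[symmetric] c(2)[symmetric]
        using p by (simp add: field_simps)
      then have "\<delta> < c\<^sup>2 * (\<bar>?S - real p\<bar> / real p)" using w by (simp add: abs_mult)
      also have "\<dots> \<le> 2 * (\<bar>?S - real p\<bar> / real p)" using q c(2) by (intro mult_right_mono) auto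
      finally show "\<delta> / 2 * real p \<le> \<bar>?S - real p\<bar>" using p by (simp add: field_simps)
    qed
  qed measurable
  also have "\<dots> \<le> 2 * exp (- ((\<delta> / 2)\<^sup>2 / 16) * real p)"
    by (rule isotropic_gaussian_concentration[OF iso]) (use d in auto)
  finally show ?thesis by (simp add: power_divide)
qed

text \<open>A diagonal entry is the squared norm of an isotropic row. Off the diagonal, (z_k + z_l)
  / sqrt 2 and (z_k - z_l) / sqrt 2 are both isotropic, and their squared norms differ by 2 <z_k,
  z_l>; if that exceeds 2 \<delta> n, one of them is off by at least \<delta> n.\<close>

lemma white_noise_gram_concentration:
  assumes z: "white_noise M n p z" and n: "0 < n" and d: "0 < \<delta>" "\<delta> < 1" and kl: "k < p" "l < p"
  shows "prob {\<omega>\<in>space M. \<delta> < \<bar>dot n (\<lambda>i. z k i \<omega>) (\<lambda>i. z l i \<omega>) / real n - (if k = l then 1 else 0)\<bar>}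
    \<le> 4 * exp (- (\<delta>\<^sup>2 / 16) * real n)"
proof (cases "k = l")
  case True
  have col: "(\<Sum>j<p. (if j = k then 1 else 0) * z j i \<omega>) = z k i \<omega>" for i \<omega>
    using kl by (simp add: if_distrib[of "\<lambda>c. c * _"] cong: if_cong)
  have "(\<Sum>j<p. (if j = k then 1 else 0 :: real)\<^sup>2) = 1"
    using kl by (simp add: if_distrib[of "\<lambda>c. c\<^sup>2"] cong: if_cong)
  from white_noise_isotropic_right[OF z this]
  have iso: "isotropic_gaussian M n (\<lambda>i. z k i)" unfolding col .
  have [measurable]: "i < n \<Longrightarrow> z k i \<in> borel_measurable M" for i
    using iso by (simp add: isotropic_gaussian_def)
  have "prob {\<omega>\<in>space M. \<delta> < \<bar>dot n (\<lambda>i. z k i \<omega>) (\<lambda>i. z l i \<omega>) / real n - (if k = l then 1 else 0)\<bar>}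
      \<le> prob {\<omega>\<in>space M. \<delta> * real n \<le> \<bar>(\<Sum>i<n. (z k i \<omega>)\<^sup>2) - real n\<bar>}"
  proof (rule finite_measure_mono)
    show "{\<omega>\<in>space M. \<delta> < \<bar>dot n (\<lambda>i. z k i \<omega>) (\<lambda>i. z l i \<omega>) / real n - (if k = l then 1 else 0)\<bar>}
      \<subseteq> {\<omega>\<in>space M. \<delta> * real n \<le> \<bar>(\<Sum>i<n. (z k i \<omega>)\<^sup>2) - real n\<bar>}"
    proof safe
      fix \<omega> assume w: "\<delta> < \<bar>dot n (\<lambda>i. z k i \<omega>) (\<lambda>i. z l i \<omega>) / real n - (if k = l then 1 else 0)\<bar>"
      have "dot n (\<lambda>i. z k i \<omega>) (\<lambda>i. z l i \<omega>) / real n - (if k = l then 1 else 0)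
          = ((\<Sum>i<n. (z k i \<omega>)\<^sup>2) - real n) / real n"
        using n True by (simp add: dot_def power2_eq_square field_simps)
      with w show "\<delta> * real n \<le> \<bar>(\<Sum>i<n. (z k i \<omega>)\<^sup>2) - real n\<bar>"
        using n by (simp add: field_simps)
    qed
  qed measurable
  also have "\<dots> \<le> 2 * exp (- (\<delta>\<^sup>2 / 16) * real n)"
    by (rule isotropic_gaussian_concentration[OF iso d])
  finally show ?thesis by (rule order.trans) simp
next
  case False
  define G where "G = (\<lambda>s i \<omega>. (z k i \<omega> + s * z l i \<omega>) / sqrt 2)"
  have iso: "isotropic_gaussian M n (G s)" if "s\<^sup>2 = 1" for s
  proof -
    define a where "a = (\<lambda>j. (if j = k then 1 / sqrt 2 else 0) + (if j = l then s / sqrt 2 else 0))"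
    have col: "(\<Sum>j<p. a j * z j i \<omega>) = G s i \<omega>" for i \<omega>
    proof -
      have "a j * z j i \<omega> = (if j = k then z k i \<omega> / sqrt 2 else 0) + (if j = l then s * z l i \<omega> / sqrt 2 else 0)" for j
        using False by (simp add: a_def)
      then show ?thesis using kl by (simp add: sum.distrib G_def add_divide_distrib)
    qed
    have "(a j)\<^sup>2 = (if j = k then 1 / 2 else 0) + (if j = l then 1 / 2 else 0)" for j
      using False that by (simp add: a_def power_divide)
    then have "(\<Sum>j<p. (a j)\<^sup>2) = 1" using kl by (simp add: sum.distrib)
    from white_noise_isotropic_right[OF z this] show ?thesis unfolding col by (simp cong: if_cong)
  qed
  have [measurable]: "i < n \<Longrightarrow> G 1 i \<in> borel_measurable M" "i < n \<Longrightarrow> G (-1) i \<in> borel_measurable M" for i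
    using iso[of 1] iso[of "-1"] by (auto simp: isotropic_gaussian_def)
  let ?B = "\<lambda>s. {\<omega>\<in>space M. \<delta> * real n \<le> \<bar>(\<Sum>i<n. (G s i \<omega>)\<^sup>2) - real n\<bar>}"
  have "prob {\<omega>\<in>space M. \<delta> < \<bar>dot n (\<lambda>i. z k i \<omega>) (\<lambda>i. z l i \<omega>) / real n - (if k = l then 1 else 0)\<bar>}
      \<le> prob (?B 1 \<union> ?B (-1))"
  proof (rule finite_measure_mono)
    show "{\<omega>\<in>space M. \<delta> < \<bar>dot n (\<lambda>i. z k i \<omega>) (\<lambda>i. z l i \<omega>) / real n - (if k = l then 1 else 0)\<bar>}
      \<subseteq> ?B 1 \<union> ?B (-1)"
    proof
      fix \<omega> assume "\<omega> \<in> {\<omega>\<in>space M. \<delta> < \<bar>dot n (\<lambda>i. z k i \<omega>) (\<lambda>i. z l i \<omega>) / real n - (if k = l then 1 else 0)\<bar>}"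
      then have w: "\<omega> \<in> space M" "\<delta> * real n < \<bar>dot n (\<lambda>i. z k i \<omega>) (\<lambda>i. z l i \<omega>)\<bar>"
        using False n by (auto simp: field_simps)
      have sq: "(G s i \<omega>)\<^sup>2 = ((z k i \<omega>)\<^sup>2 + s\<^sup>2 * (z l i \<omega>)\<^sup>2) / 2 + s * (z k i \<omega> * z l i \<omega>)" for s i
        by (simp add: G_def power_divide power2_eq_square field_simps)
      have "(\<Sum>i<n. (G 1 i \<omega>)\<^sup>2) - (\<Sum>i<n. (G (-1) i \<omega>)\<^sup>2) = 2 * dot n (\<lambda>i. z k i \<omega>) (\<lambda>i. z l i \<omega>)"
        unfolding sum_subtractf[symmetric] sq dot_def sum_distrib_left by (rule sum.cong) auto
      then have "\<delta> * real n \<le> \<bar>(\<Sum>i<n. (G 1 i \<omega>)\<^sup>2) - real n\<bar> \<or> \<delta> * real n \<le> \<bar>(\<Sum>i<n. (G (-1) i \<omega>)\<^sup>2) - real n\<bar>"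
        using w(2) by linarith
      then show "\<omega> \<in> ?B 1 \<union> ?B (-1)" using w(1) by auto
    qed
  qed measurable
  also have "\<dots> \<le> prob (?B 1) + prob (?B (-1))" by (rule measure_Un_le) measurable
  also have "\<dots> \<le> 2 * exp (- (\<delta>\<^sup>2 / 16) * real n) + 2 * exp (- (\<delta>\<^sup>2 / 16) * real n)"
    by (intro add_mono isotropic_gaussian_concentration iso d) auto
  finally show ?thesis by simp
qed

definition bad_event :: "nat \<Rightarrow> nat \<Rightarrow> nat \<Rightarrow> (nat \<Rightarrow> nat \<Rightarrow> 'a \<Rightarrow> real) \<Rightarrow> real \<Rightarrow> 'a set" where
  "bad_event n p r z \<delta> =
     (\<Union>q\<in>ball_net n. {\<omega>\<in>space M. \<delta> < \<bar>(\<Sum>k<p. (dot n (\<lambda>i. z k i \<omega>) q)\<^sup>2) / real p - dot n q q\<bar>}) \<union>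
     (\<Union>k<r. \<Union>l<r. {\<omega>\<in>space M. \<delta> < \<bar>dot n (\<lambda>i. z k i \<omega>) (\<lambda>i. z l i \<omega>) / real n - (if k = l then 1 else 0)\<bar>})"

lemma bad_event_prob:
  assumes z: "white_noise M n p z" and n: "0 < n" "0 < p" "r \<le> p" and d: "0 < \<delta>" "\<delta> < 1"
  shows "bad_event n p r z \<delta> \<in> sets M"
    and "prob (bad_event n p r z \<delta>) \<le> (exp 25 * 3) ^ n * (2 * exp (- (\<delta>\<^sup>2 / 64) * real p))
      + real r * (real r * (4 * exp (- (\<delta>\<^sup>2 / 16) * real n)))"
proof -
  note [measurable] = white_noise_measurable[OF z]
  let ?A = "\<lambda>q. {\<omega>\<in>space M. \<delta> < \<bar>(\<Sum>k<p. (dot n (\<lambda>i. z k i \<omega>) q)\<^sup>2) / real p - dot n q q\<bar>}"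
  let ?B = "\<lambda>k l. {\<omega>\<in>space M. \<delta> < \<bar>dot n (\<lambda>i. z k i \<omega>) (\<lambda>i. z l i \<omega>) / real n - (if k = l then 1 else 0)\<bar>}"
  have dm [measurable]: "(\<lambda>\<omega>. dot n (\<lambda>i. z k i \<omega>) q) \<in> borel_measurable M" if "k < p" for k q
    using that unfolding dot_def by measurable
  have dm' [measurable]: "(\<lambda>\<omega>. dot n (\<lambda>i. z k i \<omega>) (\<lambda>i. z l i \<omega>)) \<in> borel_measurable M" if "k < p" "l < p" for k l
    using that unfolding dot_def by measurable
  have A: "?A q \<in> sets M" for q by measurable
  have B: "?B k l \<in> sets M" if "k < r" "l < r" for k l
  proof -
    have [measurable]: "(\<lambda>\<omega>. dot n (\<lambda>i. z k i \<omega>) (\<lambda>i. z l i \<omega>)) \<in> borel_measurable M"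
      using that n by (intro dm') auto
    show ?thesis by measurable
  qed
  have A': "(\<Union>q\<in>ball_net n. ?A q) \<in> sets M" by (rule sets.finite_UN[OF finite_ball_net A])
  have B': "(\<Union>l<r. ?B k l) \<in> sets M" if "k < r" for k
  proof (rule sets.finite_UN[OF finite_lessThan])
    show "?B k l \<in> sets M" if "l \<in> {..<r}" for l
      using that by (intro B \<open>k < r\<close>) (simp only: lessThan_iff)
  qed
  have B'': "(\<Union>k<r. \<Union>l<r. ?B k l) \<in> sets M"
  proof (rule sets.finite_UN[OF finite_lessThan])
    show "(\<Union>l<r. ?B k l) \<in> sets M" if "k \<in> {..<r}" for k
      using that by (intro B') (simp only: lessThan_iff)
  qed
  show "bad_event n p r z \<delta> \<in> sets M" unfolding bad_event_def by (rule sets.Un[OF A' B''])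
  have "prob (bad_event n p r z \<delta>) \<le> prob (\<Union>q\<in>ball_net n. ?A q) + prob (\<Union>k<r. \<Union>l<r. ?B k l)"
    unfolding bad_event_def by (rule measure_Un_le[OF A' B''])
  moreover have "prob (\<Union>q\<in>ball_net n. ?A q) \<le> (exp 25 * 3) ^ n * (2 * exp (- (\<delta>\<^sup>2 / 64) * real p))"
  proof -
    have "prob (\<Union>q\<in>ball_net n. ?A q) \<le> (\<Sum>q\<in>ball_net n. prob (?A q))"
      by (rule measure_UNION_le[OF finite_ball_net]) (rule A)
    also have "\<dots> \<le> (\<Sum>q\<in>ball_net n. 2 * exp (- (\<delta>\<^sup>2 / 64) * real p))"
      by (rule sum_mono, rule white_noise_form_concentration[OF z n(2) d], rule ball_net_norm[OF n(1)])
    also have "\<dots> = real (card (ball_net n)) * (2 * exp (- (\<delta>\<^sup>2 / 64) * real p))" by (rule sum_constant)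
    also have "\<dots> \<le> (exp 25 * 3) ^ n * (2 * exp (- (\<delta>\<^sup>2 / 64) * real p))"
      by (rule mult_right_mono[OF card_ball_net]) simp
    finally show ?thesis .
  qed
  moreover have "prob (\<Union>k<r. \<Union>l<r. ?B k l) \<le> real r * (real r * (4 * exp (- (\<delta>\<^sup>2 / 16) * real n)))"
  proof -
    have "prob (\<Union>k<r. \<Union>l<r. ?B k l) \<le> (\<Sum>k<r. prob (\<Union>l<r. ?B k l))"
      by (rule measure_UNION_le[OF finite_lessThan], rule B') (simp only: lessThan_iff)
    also have "\<dots> \<le> (\<Sum>k<r. \<Sum>l<r. prob (?B k l))"
      by (rule sum_mono, rule measure_UNION_le[OF finite_lessThan], rule B) (simp_all only: lessThan_iff)
    also have "\<dots> \<le> (\<Sum>k<r. \<Sum>l<r. 4 * exp (- (\<delta>\<^sup>2 / 16) * real n))"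
      by (intro sum_mono white_noise_gram_concentration[OF z n(1) d]) (use n in auto)
    also have "\<dots> = real r * (real r * (4 * exp (- (\<delta>\<^sup>2 / 16) * real n)))" by simp
    finally show ?thesis .
  qed
  ultimately show "prob (bad_event n p r z \<delta>) \<le> (exp 25 * 3) ^ n * (2 * exp (- (\<delta>\<^sup>2 / 64) * real p))
      + real r * (real r * (4 * exp (- (\<delta>\<^sup>2 / 16) * real n)))" by linarith
qed

lemma near_isometric_if_not_bad:
  assumes n: "0 < n" and d: "0 \<le> \<delta>" and w: "\<omega> \<in> space M" "\<omega> \<notin> bad_event n p r z \<delta>"
  shows "near_isometric n p r (\<lambda>k i. z k i \<omega>) (3 * \<delta>)"
  unfolding near_isometric_def
proof (intro conjI allI impI)
  fix y
  define B where "B = (\<lambda>x y. (\<Sum>k<p. dot n (\<lambda>i. z k i \<omega>) x * dot n (\<lambda>i. z k i \<omega>) y) / real p - dot n x y)"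
  have B: "symmetric_bilinear B" unfolding B_def by (rule symmetric_bilinear_gram)
  \<comment> \<open>A crude trace bound from Cauchy-Schwarz; it depends on the realisation and
    merely provides the finiteness that the net argument asks for.\<close>
  define C where "C = (\<Sum>k<p. dot n (\<lambda>i. z k i \<omega>) (\<lambda>i. z k i \<omega>)) / real p + 1"
  have "\<bar>B x x\<bar> \<le> C * dot n x x" for x
  proof -
    have "\<bar>B x x\<bar> \<le> (\<Sum>k<p. (dot n (\<lambda>i. z k i \<omega>) x)\<^sup>2) / real p + dot n x x"
    proof -
      have "0 \<le> (\<Sum>k<p. (dot n (\<lambda>i. z k i \<omega>) x)\<^sup>2) / real p" by (simp add: sum_nonneg)
      moreover have "B x x = (\<Sum>k<p. (dot n (\<lambda>i. z k i \<omega>) x)\<^sup>2) / real p - dot n x x"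
        by (simp add: B_def power2_eq_square)
      ultimately show ?thesis using dot_nonneg[of n x] by linarith
    qed
    also have "\<dots> \<le> (\<Sum>k<p. dot n (\<lambda>i. z k i \<omega>) (\<lambda>i. z k i \<omega>) * dot n x x) / real p + dot n x x"
      by (intro add_right_mono divide_right_mono sum_mono dot_Cauchy_Schwarz_square) simp
    also have "\<dots> = C * dot n x x"
      by (simp add: C_def sum_distrib_right[symmetric] distrib_right)
    finally show ?thesis .
  qed
  moreover have "\<bar>B q q\<bar> \<le> \<delta>" if "q \<in> ball_net n" for q
    using w that by (auto simp: bad_event_def B_def power2_eq_square not_less)
  ultimately have "\<bar>B y y\<bar> \<le> 16 / 7 * \<delta> * dot n y y"
    by (rule symmetric_bilinear_net_bound[OF B n])
  also have "\<dots> \<le> 3 * \<delta> * dot n y y" using d by (intro mult_right_mono) auto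
  finally show "\<bar>(\<Sum>k<p. (dot n (\<lambda>i. z k i \<omega>) y)\<^sup>2) / real p - dot n y y\<bar> \<le> 3 * \<delta> * dot n y y"
    by (simp add: B_def power2_eq_square)
next
  fix k l assume "k < r" "l < r"
  then have "\<bar>dot n (\<lambda>i. z k i \<omega>) (\<lambda>i. z l i \<omega>) / real n - (if k = l then 1 else 0)\<bar> \<le> \<delta>"
    using w unfolding bad_event_def by (auto simp: not_less simp del: abs_le_iff)
  then show "\<bar>dot n (\<lambda>i. z k i \<omega>) (\<lambda>i. z l i \<omega>) / real n - (if k = l then 1 else 0)\<bar> \<le> 3 * \<delta>"
    using d by linarith
qed

text \<open>exp (L n) bounds the size of the net, and once p \<ge> 64 / \<delta>^2 * (L + 1) * n the
  union bound is of order exp (- n). The Gram part decays like exp (- \<delta>^2 n / 16). Both are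
  geometric in n, so the first Borel-Cantelli lemma applies. The factor 3 covers the 16/7 of the net
  argument.\<close>

lemma AE_eventually_near_isometric:
  assumes p: "filterlim (aspect p) at_top sequentially"
    and rp: "\<And>n. 0 < n \<Longrightarrow> r \<le> p n"
    and z: "\<And>n. 0 < n \<Longrightarrow> white_noise M n (p n) (z n)" and d: "0 < \<delta>" "\<delta> < 1"
  shows "AE \<omega> in M. \<forall>\<^sub>F n in sequentially. near_isometric n (p n) r (\<lambda>k i. z n k i \<omega>) (3 * \<delta>)"
proof -
  define L where "L = ln (exp 25 * 3 :: real)"
  define A where "A n = (if 0 < n \<and> 0 < p n then bad_event n (p n) r (z n) \<delta> else {})" for n
  have A: "A n \<in> sets M" for n
    unfolding A_def using bad_event_prob(1)[OF z _ _ rp d] by auto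
  have large: "\<forall>\<^sub>F n in sequentially. 0 < n \<and> 64 / \<delta>\<^sup>2 * (L + 1) * real n \<le> real (p n) \<and> 0 < p n"
  proof -
    have "\<forall>\<^sub>F n in sequentially. max 1 (64 / \<delta>\<^sup>2 * (L + 1)) \<le> aspect p n"
      using p unfolding filterlim_at_top by blast
    then show ?thesis using eventually_gt_at_top[of 0]
    proof eventually_elim
      case (elim n)
      then have "1 * real n \<le> real (p n)" "64 / \<delta>\<^sup>2 * (L + 1) * real n \<le> real (p n)"
        by (auto simp: aspect_def pos_le_divide_eq)
      then show ?case using elim by auto
    qed
  qed
  have bound: "\<forall>\<^sub>F n in sequentially. norm (prob (A n)) \<le> 2 * exp (- 1) ^ n + 4 * (real r)\<^sup>2 * exp (- (\<delta>\<^sup>2 / 16)) ^ n"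
    using large
  proof eventually_elim
    case (elim n)
    have "(exp 25 * 3 :: real) ^ n = exp (L * real n)"
      by (simp add: L_def exp_of_nat_mult mult.commute[of _ "real n"])
    moreover have "exp (- (\<delta>\<^sup>2 / 64) * real (p n)) \<le> exp (- (L + 1) * real n)"
    proof -
      have "\<delta>\<^sup>2 / 64 * (64 / \<delta>\<^sup>2 * (L + 1) * real n) \<le> \<delta>\<^sup>2 / 64 * real (p n)"
        using elim by (intro mult_left_mono) auto
      moreover have "\<delta>\<^sup>2 / 64 * (64 / \<delta>\<^sup>2 * (L + 1) * real n) = (L + 1) * real n" using d by simp
      ultimately have "(L + 1) * real n \<le> \<delta>\<^sup>2 / 64 * real (p n)" by (simp only:)
      then show ?thesis by (simp only: exp_le_cancel_iff mult_minus_left neg_le_iff_le)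
    qed
    ultimately have "(exp 25 * 3) ^ n * (2 * exp (- (\<delta>\<^sup>2 / 64) * real (p n)))
        \<le> exp (L * real n) * (2 * exp (- (L + 1) * real n))" by (simp add: mult_left_mono)
    also have "\<dots> = 2 * exp (- 1) ^ n"
      by (simp add: exp_of_nat_mult[symmetric] exp_add[symmetric] algebra_simps)
    finally have "(exp 25 * 3) ^ n * (2 * exp (- (\<delta>\<^sup>2 / 64) * real (p n))) \<le> 2 * exp (- 1) ^ n" .
    moreover have "real r * (real r * (4 * exp (- (\<delta>\<^sup>2 / 16) * real n))) = 4 * (real r)\<^sup>2 * exp (- (\<delta>\<^sup>2 / 16)) ^ n"
      by (simp add: exp_of_nat_mult[symmetric] power2_eq_square mult_ac)
    moreover have "prob (A n) \<le> (exp 25 * 3) ^ n * (2 * exp (- (\<delta>\<^sup>2 / 64) * real (p n)))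
      + real r * (real r * (4 * exp (- (\<delta>\<^sup>2 / 16) * real n)))"
      unfolding A_def using elim bad_event_prob(2)[OF z _ _ rp d] by simp
    ultimately show ?case by simp
  qed
  have "summable (\<lambda>n. 2 * exp (- 1 :: real) ^ n + 4 * (real r)\<^sup>2 * exp (- (\<delta>\<^sup>2 / 16)) ^ n)"
    using d by (intro summable_add summable_mult summable_geometric) auto
  then have "summable (\<lambda>n. prob (A n))"
    using bound by (rule summable_comparison_test_ev[rotated])
  then have "AE \<omega> in M. \<forall>\<^sub>F n in sequentially. \<omega> \<in> space M - A n"
    by (intro borel_cantelli_AE1 A) (auto simp: less_top[symmetric])
  then show ?thesis
  proof (rule AE_mp, intro AE_I2 impI)
    fix \<omega> assume "\<forall>\<^sub>F n in sequentially. \<omega> \<in> space M - A n"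
    then show "\<forall>\<^sub>F n in sequentially. near_isometric n (p n) r (\<lambda>k i. z n k i \<omega>) (3 * \<delta>)"
      using large
    proof eventually_elim
      case (elim n)
      then show ?case using d by (intro near_isometric_if_not_bad) (auto simp: A_def)
    qed
  qed
qed

text \<open>The exceptional null set depends on the tolerance, so countably many tolerances are
  treated first; they are then merged, separately for each sample point, into one null
  sequence.\<close>

lemma AE_near_isometric:
  assumes p: "filterlim (aspect p) at_top sequentially"
    and rp: "\<And>n. 0 < n \<Longrightarrow> r \<le> p n"
    and z: "\<And>n. 0 < n \<Longrightarrow> white_noise M n (p n) (z n)"
  shows "AE \<omega> in M. \<exists>\<delta>. \<delta> \<longlonglongrightarrow> 0 \<and> (\<forall>n. 0 \<le> \<delta> n) \<and>
    (\<forall>\<^sub>F n in sequentially. near_isometric n (p n) r (\<lambda>k i. z n k i \<omega>) (\<delta> n))"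
proof -
  have "AE \<omega> in M. \<forall>m. \<forall>\<^sub>F n in sequentially. near_isometric n (p n) r (\<lambda>k i. z n k i \<omega>) (1 / real (Suc m))"
    unfolding AE_all_countable
  proof
    fix m
    have "3 * (1 / (3 * real (Suc m))) = 1 / real (Suc m)" by (simp del: of_nat_Suc)
    then show "AE \<omega> in M. \<forall>\<^sub>F n in sequentially. near_isometric n (p n) r (\<lambda>k i. z n k i \<omega>) (1 / real (Suc m))"
      using AE_eventually_near_isometric[OF p rp z, of "1 / (3 * real (Suc m))"] by simp
  qed
  then show ?thesis
  proof (rule AE_mp, intro AE_I2 impI)
    fix \<omega> assume "\<forall>m. \<forall>\<^sub>F n in sequentially. near_isometric n (p n) r (\<lambda>k i. z n k i \<omega>) (1 / real (Suc m))"
    then have "\<forall>\<^sub>F n in sequentially. near_isometric n (p n) r (\<lambda>k i. z n k i \<omega>) (1 / real (Suc m))" for m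
      by (rule spec)
    then obtain \<delta> where "\<delta> \<longlonglongrightarrow> 0" "\<And>n. 0 \<le> \<delta> n"
      "\<forall>\<^sub>F n in sequentially. near_isometric n (p n) r (\<lambda>k i. z n k i \<omega>) (\<delta> n)"
      by (rule eventually_vanishing_parameter[where P = "\<lambda>n. near_isometric n (p n) r (\<lambda>k i. z n k i \<omega>)"]) blast
    then show "\<exists>\<delta>. \<delta> \<longlonglongrightarrow> 0 \<and> (\<forall>n. 0 \<le> \<delta> n) \<and>
      (\<forall>\<^sub>F n in sequentially. near_isometric n (p n) r (\<lambda>k i. z n k i \<omega>) (\<delta> n))" by blast
  qed
qed

end

section \<open>Limits of spiked eigenvalues and eigenvectors\<close>

lemma tendsto_mult_bounded_zero:
  fixes f g :: "nat \<Rightarrow> real"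
  assumes "f \<longlonglongrightarrow> 0" "\<forall>\<^sub>F n in sequentially. \<bar>g n\<bar> \<le> B"
  shows "(\<lambda>n. f n * g n) \<longlonglongrightarrow> 0"
proof (rule Lim_null_comparison)
  show "\<forall>\<^sub>F n in sequentially. norm (f n * g n) \<le> \<bar>f n\<bar> * B"
    using assms(2) by eventually_elim (simp add: abs_mult mult_left_mono)
  show "(\<lambda>n. \<bar>f n\<bar> * B) \<longlonglongrightarrow> 0"
    using tendsto_mult_right[OF tendsto_rabs[OF assms(1)], of B] by simp
qed

text \<open>A pathwise statement: the sequences are those of one sample point, and \<delta> n is its
  isometry defect, which makes all errors vanish.\<close>

lemma spectral_limits:
  fixes e lam :: "nat \<Rightarrow> nat \<Rightarrow> real" and u v x :: "nat \<Rightarrow> nat \<Rightarrow> nat \<Rightarrow> real"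
  assumes S: "\<And>n. 0 < n \<Longrightarrow> sample_spectrum n (p n) r (e n) (lam n) (u n) (v n) (x n)"
    and asp: "filterlim (aspect p) at_top sequentially"
    and rho: "\<And>i j. i < j \<Longrightarrow> j < r \<Longrightarrow> rho j < rho i" "\<And>i. i < r \<Longrightarrow> 0 \<le> rho i"
    and e: "\<And>i. i < r \<Longrightarrow> (\<lambda>n. (e n i - 1) / aspect p n) \<longlonglongrightarrow> rho i"
    and \<delta>: "\<delta> \<longlonglongrightarrow> 0" "\<And>n. 0 \<le> \<delta> n"
    and iso: "\<forall>\<^sub>F n in sequentially. near_isometric n (p n) r (\<lambda>k i. dot (p n) (u n k) (x n i) / sqrt (e n k)) (\<delta> n)"
    and a: "a < r"
  shows "(\<lambda>n. lam n a / aspect p n) \<longlonglongrightarrow> 1 + rho a"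
    and "\<And>k. k < r \<Longrightarrow> (\<lambda>n. (dot (p n) (u n k) (v n a))\<^sup>2) \<longlonglongrightarrow> (if k = a then rho a / (1 + rho a) else 0)"
proof -
  define \<mu> where "\<mu> n a = lam n a / aspect p n" for n a
  define R where "R n k = (e n k - 1) / aspect p n" for n k
  define E where "E n = (\<Sum>k<r. \<bar>R n k - rho k\<bar>)" for n
  have R: "(\<lambda>n. R n k) \<longlonglongrightarrow> rho k" if "k < r" for k
    using e[OF that] by (simp add: R_def)
  have E: "E \<longlonglongrightarrow> 0"
    unfolding E_def using R by (auto intro!: tendsto_null_sum tendsto_rabs_zero LIM_zero)
  have E_bound: "\<bar>R n k - rho k\<bar> \<le> E n" if "k < r" for k n
    unfolding E_def by (rule member_le_sum) (use that in auto)
  have rdelta: "(\<lambda>n. real r * \<delta> n) \<longlonglongrightarrow> 0"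
    using tendsto_mult_left[OF \<delta>(1), of "real r"] by simp
  have small: "\<forall>\<^sub>F n in sequentially. 0 < n \<and>
      near_isometric n (p n) r (sample_spectrum.z (p n) (e n) (u n) (x n)) (\<delta> n) \<and> \<delta> n \<le> 1 \<and> real r * \<delta> n \<le> 1 / 2"
  proof -
    have "\<forall>\<^sub>F n in sequentially. \<delta> n < 1" using \<delta>(1) by (rule order_tendstoD) simp
    moreover have "\<forall>\<^sub>F n in sequentially. real r * \<delta> n < 1 / 2" using rdelta by (rule order_tendstoD) simp
    ultimately show ?thesis using iso eventually_gt_at_top[of 0]
    proof eventually_elim
      case (elim n)
      interpret sample_spectrum n "p n" r "e n" "lam n" "u n" "v n" "x n" by (rule S) (rule elim)
      have "z = (\<lambda>k i. dot (p n) (u n k) (x n i) / sqrt (e n k))" by (intro ext) (simp add: z_def)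
      then show ?case using elim by simp
    qed
  qed
  define W where "W n l = sample_spectrum.w n (p n) (e n) (lam n) (u n) (v n) (x n) l a" for n l
  have \<gamma>_eq: "sample_spectrum.\<gamma> n (p n) = aspect p n" if "0 < n" for n
  proof -
    interpret sample_spectrum n "p n" r "e n" "lam n" "u n" "v n" "x n" by (rule S) (rule that)
    show ?thesis by (simp add: \<gamma>_def aspect_def)
  qed
  have \<mu>_eq: "sample_spectrum.\<mu> n (p n) (lam n) = \<mu> n" if "0 < n" for n
  proof -
    interpret S: sample_spectrum n "p n" r "e n" "lam n" "u n" "v n" "x n" by (rule S) (rule that)
    show ?thesis by (rule ext) (simp add: S.\<mu>_def \<mu>_def \<gamma>_eq[OF that])
  qed
  have R_eq: "sample_spectrum.\<rho> n (p n) (e n) = R n" if "0 < n" for n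
  proof -
    interpret S: sample_spectrum n "p n" r "e n" "lam n" "u n" "v n" "x n" by (rule S) (rule that)
    show ?thesis by (rule ext) (simp add: S.\<rho>_def R_def \<gamma>_eq[OF that])
  qed
  have asp_pos: "0 < aspect p n" if "0 < n" for n
  proof -
    interpret S: sample_spectrum n "p n" r "e n" "lam n" "u n" "v n" "x n" by (rule S) (rule that)
    show ?thesis using S.\<gamma>_pos \<gamma>_eq[OF that] by simp
  qed
  have R_nonneg: "0 \<le> R n k" if "0 < n" for n k
  proof -
    interpret S: sample_spectrum n "p n" r "e n" "lam n" "u n" "v n" "x n" by (rule S) (rule that)
    show ?thesis using S.\<rho>_nonneg[of k] R_eq[OF that] by simp
  qed
  have mono: "rho j \<le> rho i" if "i \<le> j" "j < r" for i j
    using rho(1)[of i j] that by (cases "i = j") auto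
  \<comment> \<open>\<open>E n\<close> bounds all deviations of the spike strengths at once. The
    maximum with 0 keeps the constant nonnegative, as the lower bound requires, and does not affect
    the limit because rho b \<ge> 0.\<close>
  have lower: "\<forall>\<^sub>F n in sequentially. (1 - \<delta> n) + max 0 (rho b - E n) * (1 - real r * \<delta> n) \<le> \<mu> n b" if b: "b < r" for b
    using small
  proof eventually_elim
    case (elim n)
    interpret S: sample_spectrum n "p n" r "e n" "lam n" "u n" "v n" "x n" by (rule S) (use elim in simp)
    have "max 0 (rho b - E n) \<le> R n k" if "k \<le> b" for k
      using mono[OF that b] E_bound[of k n] R_nonneg[of n k] that b elim by (auto simp: abs_le_iff)
    then show ?case
      using S.\<mu>_lower[of "\<delta> n" b "max 0 (rho b - E n)"] elim \<delta>(2)[of n] b \<mu>_eq R_eq by simp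
  qed
  have lower_lim: "(\<lambda>n. (1 - \<delta> n) + max 0 (rho b - E n) * (1 - real r * \<delta> n)) \<longlonglongrightarrow> 1 + rho b" if b: "b < r" for b
  proof -
    have "(\<lambda>n. (1 - \<delta> n) + max 0 (rho b - E n) * (1 - real r * \<delta> n)) \<longlonglongrightarrow> (1 - 0) + max 0 (rho b - 0) * (1 - 0)"
      by (intro tendsto_intros E \<delta>(1) rdelta)
    then show ?thesis using rho(2)[OF b] by (simp add: max_def)
  qed
  \<comment> \<open>The lower bounds tend to 1 + rho b > 0. Positivity of these eigenvalues is what
    the upper bound and the unit dual eigenvector rest on.\<close>
  have pos: "\<forall>\<^sub>F n in sequentially. \<forall>b\<in>{..a}. 0 < lam n b"
  proof (rule eventually_ball_finite)
    show "\<forall>b\<in>{..a}. \<forall>\<^sub>F n in sequentially. 0 < lam n b"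
    proof
      fix b assume "b \<in> {..a}"
      then have b: "b < r" using a by simp
      have "\<forall>\<^sub>F n in sequentially. 0 < (1 - \<delta> n) + max 0 (rho b - E n) * (1 - real r * \<delta> n)"
        using lower_lim[OF b] by (rule order_tendstoD) (use rho(2)[OF b] in simp)
      then show "\<forall>\<^sub>F n in sequentially. 0 < lam n b"
        using lower[OF b] eventually_gt_at_top[of 0]
      proof eventually_elim
        case (elim n)
        then have "0 < \<mu> n b" by linarith
        then show ?case using asp_pos[of n] elim by (simp add: \<mu>_def zero_less_divide_iff)
      qed
    qed
  qed simp
  have upper: "\<forall>\<^sub>F n in sequentially. \<mu> n a \<le> (1 + \<delta> n) + (rho a + E n) * (1 + real r * \<delta> n)"
    using small pos
  proof eventually_elim
    case (elim n)
    interpret S: sample_spectrum n "p n" r "e n" "lam n" "u n" "v n" "x n" by (rule S) (use elim in simp)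
    have "R n k \<le> rho a + E n" if "a \<le> k" "k < r" for k
      using mono[OF that] E_bound[of k n] that by (auto simp: abs_le_iff)
    then show ?case
      using S.\<mu>_upper[of "\<delta> n" a "rho a + E n"] elim \<delta>(2)[of n] a \<mu>_eq R_eq by simp
  qed
  have upper_lim: "(\<lambda>n. (1 + \<delta> n) + (rho a + E n) * (1 + real r * \<delta> n)) \<longlonglongrightarrow> 1 + rho a"
  proof -
    have "(\<lambda>n. (1 + \<delta> n) + (rho a + E n) * (1 + real r * \<delta> n)) \<longlonglongrightarrow> (1 + 0) + (rho a + 0) * (1 + 0)"
      by (intro tendsto_intros E \<delta>(1) rdelta)
    then show ?thesis by simp
  qed
  have \<mu>: "(\<lambda>n. \<mu> n a) \<longlonglongrightarrow> 1 + rho a"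
    by (rule tendsto_sandwich[OF lower[OF a] upper lower_lim[OF a] upper_lim])
  then show "(\<lambda>n. lam n a / aspect p n) \<longlonglongrightarrow> 1 + rho a" by (simp add: \<mu>_def)
  have Wb: "\<forall>\<^sub>F n in sequentially. \<bar>W n l\<bar> \<le> 2" if l: "l < r" for l
    using small pos
  proof eventually_elim
    case (elim n)
    interpret S: sample_spectrum n "p n" r "e n" "lam n" "u n" "v n" "x n" by (rule S) (use elim in simp)
    show ?case using S.w_bound[of "\<delta> n" a l] elim \<delta>(2)[of n] a l by (simp add: W_def)
  qed
  have Wb2: "\<forall>\<^sub>F n in sequentially. \<bar>(W n l)\<^sup>2\<bar> \<le> 4" if l: "l < r" for l
    using Wb[OF l]
  proof eventually_elim
    case (elim n)
    then have "\<bar>W n l\<bar>\<^sup>2 \<le> 2\<^sup>2" by (intro power_mono) auto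
    then show ?case by simp
  qed
  have W0: "(\<lambda>n. W n l) \<longlonglongrightarrow> 0" if l: "l < r" "l \<noteq> a" for l
  proof -
    have eig: "\<forall>\<^sub>F n in sequentially. norm ((1 + R n l - \<mu> n a) * W n l) \<le> 2 * \<delta> n * (1 + (\<Sum>k<r. R n k))"
      using small pos
    proof eventually_elim
      case (elim n)
      interpret S: sample_spectrum n "p n" r "e n" "lam n" "u n" "v n" "x n" by (rule S) (use elim in simp)
      show ?case using S.eigen_equation[of "\<delta> n" a l] elim \<delta>(2)[of n] a l \<mu>_eq R_eq by (simp add: W_def)
    qed
    have "(\<lambda>n. 2 * \<delta> n * (1 + (\<Sum>k<r. R n k))) \<longlonglongrightarrow> 2 * 0 * (1 + (\<Sum>k<r. rho k))"
      using R by (intro tendsto_intros \<delta>(1)) auto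
    then have 1: "(\<lambda>n. (1 + R n l - \<mu> n a) * W n l) \<longlonglongrightarrow> 0"
      using Lim_null_comparison[OF eig] by simp
    \<comment> \<open>As W is bounded, its coefficient may be replaced by the limit rho l - rho a,
      which is nonzero by the strict ordering; hence W itself tends to 0.\<close>
    have "(\<lambda>n. (1 + R n l - \<mu> n a) - (rho l - rho a)) \<longlonglongrightarrow> (1 + rho l - (1 + rho a)) - (rho l - rho a)"
      by (intro tendsto_intros R l \<mu>)
    then have 2: "(\<lambda>n. ((1 + R n l - \<mu> n a) - (rho l - rho a)) * W n l) \<longlonglongrightarrow> 0"
      by (intro tendsto_mult_bounded_zero[OF _ Wb]) (use l in simp_all)
    have "(\<lambda>n. (rho l - rho a) * W n l) \<longlonglongrightarrow> 0 - 0"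
      using tendsto_diff[OF 1 2] by (simp add: algebra_simps)
    then have "(\<lambda>n. (rho l - rho a) * W n l / (rho l - rho a)) \<longlonglongrightarrow> (0 - 0) / (rho l - rho a)"
      by (rule tendsto_divide) (use rho(1)[of a l] rho(1)[of l a] l a in \<open>auto simp: neq_iff\<close>)
    moreover have "rho l - rho a \<noteq> 0" using rho(1)[of a l] rho(1)[of l a] l a by (cases "a < l") auto
    ultimately show ?thesis by simp
  qed
  have energy: "(\<lambda>n. \<Sum>k<r. R n k * (W n k)\<^sup>2) \<longlonglongrightarrow> rho a"
  proof -
    have en: "\<forall>\<^sub>F n in sequentially. norm (\<mu> n a - 1 - (\<Sum>k<r. R n k * (W n k)\<^sup>2)) \<le> \<delta> n"
      using small pos
    proof eventually_elim
      case (elim n)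
      interpret S: sample_spectrum n "p n" r "e n" "lam n" "u n" "v n" "x n" by (rule S) (use elim in simp)
      show ?case using S.energy[of "\<delta> n" a] elim \<delta>(2)[of n] a \<mu>_eq R_eq by (simp add: W_def)
    qed
    have "(\<lambda>n. \<mu> n a - 1 - (\<Sum>k<r. R n k * (W n k)\<^sup>2)) \<longlonglongrightarrow> 0"
      by (rule Lim_null_comparison[OF en \<delta>(1)])
    from tendsto_diff[OF tendsto_diff[OF \<mu> tendsto_const[of 1]] this] show ?thesis by simp
  qed
  \<comment> \<open>The product is tracked instead of W, since for rho a = 0 the diagonal projection
    need not converge. In the overlap formula the term left over is 1 / \<gamma> times a bounded
    quantity.\<close>
  have RW: "(\<lambda>n. R n k * (W n k)\<^sup>2) \<longlonglongrightarrow> (if k = a then rho a else 0)" if k: "k < r" for k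
  proof (cases "k = a")
    case False
    have "(\<lambda>n. R n k * (W n k)\<^sup>2) \<longlonglongrightarrow> rho k * 0\<^sup>2"
      by (intro tendsto_intros R k W0 False)
    then show ?thesis using False by simp
  next
    case True
    have "(\<lambda>n. \<Sum>l\<in>{..<r} - {a}. R n l * (W n l)\<^sup>2) \<longlonglongrightarrow> (\<Sum>l\<in>{..<r} - {a}. rho l * 0\<^sup>2)"
      by (intro tendsto_intros R W0) auto
    from tendsto_diff[OF energy this] have "(\<lambda>n. (\<Sum>l<r. R n l * (W n l)\<^sup>2) - (\<Sum>l\<in>{..<r} - {a}. R n l * (W n l)\<^sup>2)) \<longlonglongrightarrow> rho a"
      by simp
    moreover have "(\<Sum>l<r. R n l * (W n l)\<^sup>2) - (\<Sum>l\<in>{..<r} - {a}. R n l * (W n l)\<^sup>2) = R n a * (W n a)\<^sup>2" for n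
      using a sum.remove[of "{..<r}" a "\<lambda>l. R n l * (W n l)\<^sup>2"] by simp
    ultimately show ?thesis using True by simp
  qed
  fix k assume k: "k < r"
  have ov: "\<forall>\<^sub>F n in sequentially. (R n k * (W n k)\<^sup>2 + 1 / aspect p n * (W n k)\<^sup>2) / \<mu> n a = (dot (p n) (u n k) (v n a))\<^sup>2"
    using small pos
  proof eventually_elim
    case (elim n)
    interpret S: sample_spectrum n "p n" r "e n" "lam n" "u n" "v n" "x n" by (rule S) (use elim in simp)
    show ?case using S.overlap[of a k] elim a S.rp \<mu>_eq[of n] R_eq[of n] \<gamma>_eq[of n] by (simp add: W_def algebra_simps add_divide_distrib)
  qed
  have "(\<lambda>n. 1 / aspect p n) \<longlonglongrightarrow> 0"
    using tendsto_inverse_0_at_top[OF asp] by (simp add: inverse_eq_divide)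
  then have "(\<lambda>n. 1 / aspect p n * (W n k)\<^sup>2) \<longlonglongrightarrow> 0"
    by (rule tendsto_mult_bounded_zero[OF _ Wb2[OF k]])
  then have "(\<lambda>n. (R n k * (W n k)\<^sup>2 + 1 / aspect p n * (W n k)\<^sup>2) / \<mu> n a) \<longlonglongrightarrow> ((if k = a then rho a else 0) + 0) / (1 + rho a)"
    using rho(2)[OF a] by (intro tendsto_intros RW k \<mu>) auto
  then have "(\<lambda>n. (R n k * (W n k)\<^sup>2 + 1 / aspect p n * (W n k)\<^sup>2) / \<mu> n a) \<longlonglongrightarrow> (if k = a then rho a / (1 + rho a) else 0)"
    by (simp split: if_splits)
  then show "(\<lambda>n. (dot (p n) (u n k) (v n a))\<^sup>2) \<longlonglongrightarrow> (if k = a then rho a / (1 + rho a) else 0)"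
    by (rule Lim_transform_eventually[OF _ ov])
qed

section \<open>Nuclear norms of matrices of low rank\<close>

text \<open>The block matrix [[x I, F], [H, I]] is eliminated in two ways: one gives det (x I - F
  H), the other x^d det (x I - H F) after a factor x^m. The powers of X keep the identity free of
  division and independent of which dimension is larger.\<close>

lemma Sylvester_char_poly:
  fixes F H :: "real mat"
  assumes F: "F \<in> carrier_mat d m" and H: "H \<in> carrier_mat m d"
  shows "char_poly (F * H) * [:0, 1:] ^ m = char_poly (H * F) * [:0, 1:] ^ d"
proof -
  have "poly (char_poly (F * H)) x * x ^ m = poly (char_poly (H * F)) x * x ^ d" for x
  proof -
    let ?xd = "x \<cdot>\<^sub>m 1\<^sub>m d" and ?xm = "x \<cdot>\<^sub>m 1\<^sub>m m"
    have FH: "F * H \<in> carrier_mat d d" and HF: "H * F \<in> carrier_mat m m" using F H by auto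
    have FH': "?xd - F * H \<in> carrier_mat d d" and HF': "?xm - H * F \<in> carrier_mat m m"
      by (rule minus_carrier_mat[OF FH], rule minus_carrier_mat[OF HF])
    let ?P = "four_block_mat ?xd F H (1\<^sub>m m)"
    have P: "?P \<in> carrier_mat (d + m) (d + m)" using F H by auto
    have char: "poly (char_poly A) x = det (x \<cdot>\<^sub>m 1\<^sub>m k - A)" if "A \<in> carrier_mat k k" for A k
      unfolding char_poly_matrix[OF that]
      by (rule arg_cong[where f = det], rule eq_matI) (use that in \<open>auto simp: char_matrix_def\<close>)
    have "?P * four_block_mat (1\<^sub>m d) (0\<^sub>m d m) (- H) (1\<^sub>m m) = four_block_mat (?xd - F * H) F (0\<^sub>m m d) (1\<^sub>m m)"
      by (subst mult_four_block_mat[of _ d d _ m _ m], use F H in \<open>auto intro!: cong_four_block_mat eq_matI\<close>)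
    then have "det ?P * det (four_block_mat (1\<^sub>m d) (0\<^sub>m d m) (- H) (1\<^sub>m m)) = det (four_block_mat (?xd - F * H) F (0\<^sub>m m d) (1\<^sub>m m))"
      using det_mult[OF P, of "four_block_mat (1\<^sub>m d) (0\<^sub>m d m) (- H) (1\<^sub>m m)"] H by simp
    then have 1: "det ?P = det (?xd - F * H)"
      using det_four_block_mat_upper_right_zero[of "1\<^sub>m d" d "0\<^sub>m d m" m "- H" "1\<^sub>m m"]
        det_four_block_mat_lower_left_zero[of "?xd - F * H" d F m "0\<^sub>m m d" "1\<^sub>m m"] F H FH' by simp
    let ?Q = "four_block_mat (1\<^sub>m d) (0\<^sub>m d m) (- H) ?xm"
    have Q: "?Q \<in> carrier_mat (d + m) (d + m)" using H by auto
    have "?Q * ?P = four_block_mat ?xd F (0\<^sub>m m d) (?xm - H * F)"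
      by (subst mult_four_block_mat[of _ d d _ m _ m], use F H in \<open>auto intro!: cong_four_block_mat eq_matI\<close>)
    then have "det ?Q * det ?P = det (four_block_mat ?xd F (0\<^sub>m m d) (?xm - H * F))"
      using det_mult[OF Q P] by simp
    then have 2: "x ^ m * det ?P = x ^ d * det (?xm - H * F)"
      using det_four_block_mat_upper_right_zero[of "1\<^sub>m d" d "0\<^sub>m d m" m "- H" ?xm]
        det_four_block_mat_lower_left_zero[of ?xd d F m "0\<^sub>m m d" "?xm - H * F"] F H HF' by simp
    show ?thesis using 1 2 char[OF FH] char[OF HF] by (simp add: mult.commute)
  qed
  then have "poly (char_poly (F * H) * [:0, 1:] ^ m) = poly (char_poly (H * F) * [:0, 1:] ^ d)"
    by (intro ext) (simp add: poly_power)
  then show ?thesis by (simp only: poly_eq_poly_eq_iff)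
qed

definition sqrt_root_sum :: "real poly \<Rightarrow> real" where
  "sqrt_root_sum q = (\<Sum>s\<in>#proots q. sqrt s)"

lemma sqrt_root_sum_mult: "p \<noteq> 0 \<Longrightarrow> q \<noteq> 0 \<Longrightarrow> sqrt_root_sum (p * q) = sqrt_root_sum p + sqrt_root_sum q"
  by (simp add: sqrt_root_sum_def proots_mult)

lemma sqrt_root_sum_linear_factors:
  "sqrt_root_sum (\<Prod>a\<leftarrow>as. [:- a, 1:]) = (\<Sum>a\<leftarrow>as. sqrt a)"
proof (induction as)
  case Nil
  then show ?case by (simp add: sqrt_root_sum_def)
next
  case (Cons a as)
  have "(\<Prod>a\<leftarrow>as. [:- a, 1:]) \<noteq> (0 :: real poly)" by (auto simp: prod_list_zero_iff)
  then have "sqrt_root_sum (\<Prod>a\<leftarrow>a # as. [:- a, 1:]) = sqrt_root_sum [:- a, 1:] + sqrt_root_sum (\<Prod>a\<leftarrow>as. [:- a, 1:])"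
    using sqrt_root_sum_mult[of "[:- a, 1:]" "\<Prod>a\<leftarrow>as. [:- a, 1:]"] by (simp del: mult_pCons_left)
  moreover have "sqrt_root_sum [:- a, 1:] = sqrt a" by (simp add: sqrt_root_sum_def)
  ultimately show ?case using Cons by simp
qed

lemma sqrt_root_sum_X_power: "sqrt_root_sum ([:0, 1:] ^ m) = 0"
proof -
  have "[:0, 1:] ^ m = (\<Prod>a\<leftarrow>replicate m 0. [:- a, 1:] :: real poly)" by (induction m) auto
  then show ?thesis using sqrt_root_sum_linear_factors[of "replicate m 0"] by (simp add: sum_list_replicate)
qed

lemma char_poly_nonzero:
  fixes A :: "real mat" assumes "A \<in> carrier_mat n n" shows "char_poly A \<noteq> 0"
  using degree_monic_char_poly[OF assms] by auto

lemma sqrt_root_sum_Sylvester: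
  fixes F H :: "real mat"
  assumes F: "F \<in> carrier_mat d m" and H: "H \<in> carrier_mat m d"
  shows "sqrt_root_sum (char_poly (F * H)) = sqrt_root_sum (char_poly (H * F))"
proof -
  have nz: "char_poly (F * H) \<noteq> 0" "char_poly (H * F) \<noteq> 0"
    using char_poly_nonzero[of "F * H" d] char_poly_nonzero[of "H * F" m] F H by auto
  have "sqrt_root_sum (char_poly (F * H) * [:0, 1:] ^ m) = sqrt_root_sum (char_poly (H * F) * [:0, 1:] ^ d)"
    using Sylvester_char_poly[OF assms] by simp
  then show ?thesis
    using nz by (simp add: sqrt_root_sum_mult sqrt_root_sum_X_power)
qed

section \<open>Real nonnegative spectra\<close>

text \<open>All complex roots are quantified over: the nuclear norm is defined through real roots,
  and only control of the complex ones guarantees that the polynomial splits over the reals and no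
  root is missed.\<close>

definition nonneg_roots :: "real poly \<Rightarrow> bool" where
  "nonneg_roots q \<longleftrightarrow> (\<forall>z :: complex. poly (map_poly of_real q) z = 0 \<longrightarrow> Im z = 0 \<and> 0 \<le> Re z)"

text \<open>For a complex eigenvector v, pairing A^T A v = z v with the conjugate of v gives z |v|^2
  = |A v|^2; the entries of A are real, so conjugating them changes nothing.\<close>

lemma nonneg_roots_char_poly_gram:
  fixes A :: "real mat" assumes A: "A \<in> carrier_mat n n"
  shows "nonneg_roots (char_poly (transpose_mat A * A))"
  unfolding nonneg_roots_def
proof (intro allI impI)
  fix z :: complex
  let ?B = "transpose_mat A * A"
  let ?C = "map_mat complex_of_real ?B"
  assume "poly (map_poly of_real (char_poly ?B)) z = 0"
  moreover have B: "?B \<in> carrier_mat n n" using A by auto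
  ultimately have "poly (char_poly ?C) z = 0"
    by (simp add: of_real_hom.char_poly_hom[OF B])
  then have "eigenvalue ?C z" using B by (subst eigenvalue_root_char_poly[of _ n]) auto
  then obtain v where v: "v \<in> carrier_vec n" "v \<noteq> 0\<^sub>v n" "?C *\<^sub>v v = z \<cdot>\<^sub>v v"
    using B by (auto simp: eigenvalue_def eigenvector_def)
  define a where "a i j = complex_of_real (A $$ (i, j))" for i j
  define y where "y k = (\<Sum>j<n. a k j * v $ j)" for k
  have comp: "(\<Sum>k<n. cnj (a k i) * y k) = z * v $ i" if i: "i < n" for i
  proof -
    have "z * v $ i = (?C *\<^sub>v v) $ i" using v i by simp
    also have "\<dots> = (\<Sum>j<n. (\<Sum>k<n. a k i * a k j) * v $ j)"
      using A v(1) i by (simp add: scalar_prod_def a_def lessThan_atLeast0)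
    also have "\<dots> = (\<Sum>k<n. cnj (a k i) * y k)"
      unfolding y_def sum_distrib_left sum_distrib_right
      by (subst sum.swap) (simp add: a_def mult.assoc)
    finally show ?thesis ..
  qed
  have "z * (\<Sum>i<n. cnj (v $ i) * v $ i) = (\<Sum>i<n. cnj (v $ i) * (z * v $ i))"
    by (simp add: sum_distrib_left mult_ac)
  also have "\<dots> = (\<Sum>i<n. cnj (v $ i) * (\<Sum>k<n. cnj (a k i) * y k))"
    by (rule sum.cong[OF refl]) (simp add: comp)
  also have "\<dots> = (\<Sum>k<n. cnj (y k) * y k)"
    unfolding y_def cnj_sum sum_distrib_left[of "cnj _"] sum_distrib_right
    by (subst sum.swap) (simp add: mult_ac sum_distrib_left)
  finally have eq: "z * (\<Sum>i<n. cnj (v $ i) * v $ i) = (\<Sum>k<n. cnj (y k) * y k)" .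
  have norm: "(\<Sum>i<n. cnj (f i) * f i) = of_real (\<Sum>i<n. (cmod (f i))\<^sup>2)" for f :: "nat \<Rightarrow> complex"
    unfolding of_real_sum
    by (rule sum.cong[OF refl]) (simp only: complex_norm_square mult.commute)
  have "0 < (\<Sum>i<n. (cmod (v $ i))\<^sup>2)"
  proof -
    obtain i where "i < n" "v $ i \<noteq> 0" using v by (metis carrier_vecD eq_vecI index_zero_vec)
    then show ?thesis by (auto intro!: sum_pos2[of _ i])
  qed
  moreover define N Y where "N = (\<Sum>i<n. (cmod (v $ i))\<^sup>2)" and "Y = (\<Sum>k<n. (cmod (y k))\<^sup>2)"
  ultimately have "z * of_real N = of_real Y" "0 < N"
    using eq unfolding norm[of y] norm[of "\<lambda>i. v $ i"] by simp_all
  then have "z = of_real (Y / N)" by (simp add: field_simps)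
  moreover have "0 \<le> Y / N" unfolding N_def Y_def by (intro divide_nonneg_nonneg sum_nonneg) simp_all
  ultimately show "Im z = 0 \<and> 0 \<le> Re z" by simp
qed

lemma nonneg_roots_transfer:
  assumes "p * [:0, 1:] ^ m = q * [:0, 1:] ^ d" "nonneg_roots p"
  shows "nonneg_roots q"
  unfolding nonneg_roots_def
proof (intro allI impI)
  interpret R: map_poly_inj_idom_hom complex_of_real ..
  fix z :: complex assume q: "poly (map_poly of_real q) z = 0"
  have "map_poly complex_of_real (p * [:0, 1:] ^ m) = map_poly of_real (q * [:0, 1:] ^ d)" using assms(1) by simp
  then have "poly (map_poly of_real p * map_poly of_real ([:0, 1:] ^ m)) z = poly (map_poly of_real q * map_poly of_real ([:0, 1:] ^ d)) z"
    by (simp only: R.hom_mult)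
  then have "poly (map_poly of_real p) z * z ^ m = poly (map_poly of_real q) z * z ^ d"
    by (simp add: R.hom_power map_poly_pCons poly_power)
  then have "poly (map_poly of_real p) z = 0 \<or> z = 0" using q by auto
  then show "Im z = 0 \<and> 0 \<le> Re z" using assms(2) by (auto simp: nonneg_roots_def)
qed

text \<open>Factor over the complex numbers, observe that all roots are real, and pull the
  factorisation back along the injective embedding of real polynomials.\<close>

lemma char_poly_real_split:
  fixes K :: "real mat" assumes K: "K \<in> carrier_mat m m" and nn: "nonneg_roots (char_poly K)"
  shows "\<exists>as. char_poly K = (\<Prod>a\<leftarrow>as. [:- a, 1:]) \<and> length as = m \<and> (\<forall>a\<in>set as. 0 \<le> a)"
proof -
  interpret R: map_poly_inj_idom_hom complex_of_real ..
  let ?C = "map_mat complex_of_real K"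
  have "?C \<in> carrier_mat m m" using K by simp
  from char_poly_factorized[OF this] obtain as where as: "char_poly ?C = (\<Prod>a\<leftarrow>as. [:- a, 1:])" "length as = m" by blast
  have C: "char_poly ?C = map_poly of_real (char_poly K)" by (rule of_real_hom.char_poly_hom[OF K])
  have root: "Im a = 0 \<and> 0 \<le> Re a" if "a \<in> set as" for a
  proof -
    have "poly (char_poly ?C) a = 0" unfolding as(1) using that by (auto simp: poly_prod_list prod_list_zero_iff)
    then show ?thesis using nn C by (simp add: nonneg_roots_def)
  qed
  have "(\<Prod>a\<leftarrow>as. [:- a, 1:]) = map_poly complex_of_real (\<Prod>a\<leftarrow>map Re as. [:- a, 1:])"
    using root
  proof (induction as)
    case (Cons a as)
    have "map_poly complex_of_real ([:- Re a, 1:]) = [:- a, 1:]"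
      using Cons.prems[of a] by (simp add: map_poly_pCons complex_eq_iff)
    then show ?case using Cons by (simp add: R.hom_mult del: mult_pCons_left)
  qed simp
  then have "map_poly complex_of_real (char_poly K) = map_poly complex_of_real (\<Prod>a\<leftarrow>map Re as. [:- a, 1:])"
    using as(1) C by simp
  then have "char_poly K = (\<Prod>a\<leftarrow>map Re as. [:- a, 1:])"
    by (rule R.injectivity)
  then show ?thesis using as(2) root by (intro exI[of _ "map Re as"]) auto
qed

section \<open>Continuity of the roots by compactness\<close>

lemma bounded_coordinates_subsequence:
  fixes s :: "nat \<Rightarrow> nat \<Rightarrow> real"
  assumes "\<And>n i. i < m \<Longrightarrow> \<bar>s n i\<bar> \<le> C"
  shows "\<exists>\<sigma> t. strict_mono \<sigma> \<and> (\<forall>i<m. (\<lambda>n. s (\<sigma> n) i) \<longlonglongrightarrow> t i)"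
  using assms
proof (induction m)
  case 0
  show ?case by (intro exI[of _ id]) (simp add: strict_mono_id)
next
  case (Suc m)
  then obtain \<sigma> t where \<sigma>: "strict_mono \<sigma>" "\<And>i. i < m \<Longrightarrow> (\<lambda>n. s (\<sigma> n) i) \<longlonglongrightarrow> t i"
    by (metis less_Suc_eq)
  have "bounded (range (\<lambda>n. s (\<sigma> n) m))"
    unfolding bounded_iff using Suc.prems[of m] by (intro exI[of _ C]) auto
  then obtain l \<tau> where \<tau>: "strict_mono \<tau>" "((\<lambda>n. s (\<sigma> n) m) \<circ> \<tau>) \<longlonglongrightarrow> l"
    using bounded_imp_convergent_subsequence by blast
  have "(\<lambda>n. s ((\<sigma> \<circ> \<tau>) n) i) \<longlonglongrightarrow> (if i = m then l else t i)" if "i < Suc m" for i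
    using \<tau>(2) LIMSEQ_subseq_LIMSEQ[OF \<sigma>(2) \<tau>(1), of i] that by (cases "i = m") (auto simp: o_def)
  then show ?case
    using strict_mono_o[OF \<sigma>(1) \<tau>(1)]
    by (intro exI[of _ "\<sigma> \<circ> \<tau>"] exI[of _ "\<lambda>i. if i = m then l else t i"] conjI allI impI)
qed

lemma tendsto_if_subsubsequence:
  fixes X :: "nat \<Rightarrow> real"
  assumes sub: "\<And>\<sigma> :: nat \<Rightarrow> nat. strict_mono \<sigma> \<Longrightarrow> \<exists>\<tau> :: nat \<Rightarrow> nat. strict_mono \<tau> \<and> (\<lambda>n. X (\<sigma> (\<tau> n))) \<longlonglongrightarrow> L"
  shows "X \<longlonglongrightarrow> L"
proof (rule ccontr)
  assume "\<not> ?thesis"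
  then obtain e where e: "0 < e" "\<And>N. \<exists>n\<ge>N. e \<le> \<bar>X n - L\<bar>"
    unfolding LIMSEQ_iff by (auto simp: not_less)
  then have "infinite {n. e \<le> \<bar>X n - L\<bar>}" unfolding infinite_nat_iff_unbounded_le by auto
  then obtain \<sigma> :: "nat \<Rightarrow> nat" where \<sigma>: "strict_mono \<sigma>" "\<And>n. \<sigma> n \<in> {n. e \<le> \<bar>X n - L\<bar>}"
    using infinite_enumerate by blast
  obtain \<tau> where "(\<lambda>n. X (\<sigma> (\<tau> n))) \<longlonglongrightarrow> L" using sub[OF \<sigma>(1)] by blast
  then have "(\<lambda>n. \<bar>X (\<sigma> (\<tau> n)) - L\<bar>) \<longlonglongrightarrow> 0" by (intro tendsto_rabs_zero LIM_zero)
  then have "\<forall>\<^sub>F n in sequentially. \<bar>X (\<sigma> (\<tau> n)) - L\<bar> < e" using e(1) by (rule order_tendstoD)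
  then obtain n where "\<bar>X (\<sigma> (\<tau> n)) - L\<bar> < e" by (auto simp: eventually_sequentially)
  then show False using \<sigma>(2)[of "\<tau> n"] by simp
qed

lemma poly_linear_factors: "poly (\<Prod>a\<leftarrow>as. [:- a, 1:]) x = (\<Prod>i<length as. x - as ! i)" for x :: real
  by (induction as) (simp_all add: prod.lessThan_Suc_shift algebra_simps del: prod.lessThan_Suc)

text \<open>Roots of a polynomial that splits are bounded through its value at \<open>-1\<close>, so a limit of
  such polynomials inherits the limits of the roots along subsequences.\<close>

lemma sqrt_root_sum_tendsto:
  fixes as :: "nat \<Rightarrow> real list"
  assumes len: "\<And>n. length (as n) = m" and nn: "\<And>n a. a \<in> set (as n) \<Longrightarrow> 0 \<le> a"
    and lim: "\<And>x. (\<lambda>n. poly (\<Prod>a\<leftarrow>as n. [:- a, 1:]) x) \<longlonglongrightarrow> poly q x"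
  shows "(\<lambda>n. \<Sum>a\<leftarrow>as n. sqrt a) \<longlonglongrightarrow> sqrt_root_sum q"
proof (rule tendsto_if_subsubsequence)
  fix \<sigma> :: "nat \<Rightarrow> nat" assume \<sigma>: "strict_mono \<sigma>"
  define s where "s n i = as (\<sigma> n) ! i" for n i
  have s0: "0 \<le> s n i" if "i < m" for n i
    unfolding s_def using that len[of "\<sigma> n"] by (intro nn[of _ "\<sigma> n"]) simp
  obtain C where C: "\<And>n. \<bar>poly (\<Prod>a\<leftarrow>as n. [:- a, 1:]) (- 1)\<bar> \<le> C"
    using Bseq_def[THEN iffD1, OF convergent_imp_Bseq[OF convergentI[OF lim[of "- 1"]]]] by auto
  have "\<bar>s n i\<bar> \<le> C" if i: "i < m" for n i
  proof -
    have "1 + s n i \<le> (\<Prod>j<m. 1 + s n j)"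
    proof -
      have "(\<Prod>j\<in>{i}. 1 + s n j) \<le> (\<Prod>j<m. 1 + s n j)"
        by (rule prod_mono2) (use i s0 in \<open>auto intro: add_nonneg_nonneg\<close>)
      then show ?thesis by simp
    qed
    also have "\<dots> = (\<Prod>j<m. \<bar>- 1 - s n j\<bar>)"
    proof (rule prod.cong[OF refl])
      fix j assume "j \<in> {..<m}"
      then show "1 + s n j = \<bar>- 1 - s n j\<bar>" using s0[of j n] by simp
    qed
    also have "\<dots> = \<bar>poly (\<Prod>a\<leftarrow>as (\<sigma> n). [:- a, 1:]) (- 1)\<bar>"
      by (simp add: poly_linear_factors len s_def abs_prod)
    finally show ?thesis using C[of "\<sigma> n"] s0[OF i, of n] by linarith
  qed
  then obtain \<tau> t where \<tau>: "strict_mono \<tau>" "\<And>i. i < m \<Longrightarrow> (\<lambda>n. s (\<tau> n) i) \<longlonglongrightarrow> t i"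
    using bounded_coordinates_subsequence[of m s C] by blast
  have "poly q x = poly (\<Prod>a\<leftarrow>map t [0..<m]. [:- a, 1:]) x" for x
  proof (rule LIMSEQ_unique)
    show "(\<lambda>n. poly (\<Prod>a\<leftarrow>as (\<sigma> (\<tau> n)). [:- a, 1:]) x) \<longlonglongrightarrow> poly q x"
      using LIMSEQ_subseq_LIMSEQ[OF lim strict_mono_o[OF \<sigma> \<tau>(1)]] by (simp add: o_def)
    have "(\<lambda>n. \<Prod>i<m. x - s (\<tau> n) i) \<longlonglongrightarrow> (\<Prod>i<m. x - t i)"
      by (intro tendsto_prod tendsto_diff tendsto_const \<tau>(2)) auto
    then show "(\<lambda>n. poly (\<Prod>a\<leftarrow>as (\<sigma> (\<tau> n)). [:- a, 1:]) x) \<longlonglongrightarrow> poly (\<Prod>a\<leftarrow>map t [0..<m]. [:- a, 1:]) x"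
      by (simp only: poly_linear_factors len s_def length_map length_upt) simp
  qed
  then have "q = (\<Prod>a\<leftarrow>map t [0..<m]. [:- a, 1:])" by (intro poly_ext) simp
  then have q: "sqrt_root_sum q = (\<Sum>i<m. sqrt (t i))"
    by (simp only: sqrt_root_sum_linear_factors) (simp add: interv_sum_list_conv_sum_set_nat o_def lessThan_atLeast0)
  have "(\<lambda>n. \<Sum>i<m. sqrt (s (\<tau> n) i)) \<longlonglongrightarrow> (\<Sum>i<m. sqrt (t i))"
    by (intro tendsto_sum tendsto_real_sqrt \<tau>(2)) auto
  moreover have "(\<Sum>i<m. sqrt (s (\<tau> n) i)) = (\<Sum>a\<leftarrow>as (\<sigma> (\<tau> n)). sqrt a)" for n
    by (simp add: sum_list_sum_nth len s_def lessThan_atLeast0)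
  ultimately show "\<exists>\<tau>. strict_mono \<tau> \<and> (\<lambda>n. \<Sum>a\<leftarrow>as (\<sigma> (\<tau> n)). sqrt a) \<longlonglongrightarrow> sqrt_root_sum q"
    using \<tau>(1) q by auto
qed

lemma char_poly_value_tendsto:
  fixes K :: "nat \<Rightarrow> real mat"
  assumes K: "\<And>n. K n \<in> carrier_mat m m" "K' \<in> carrier_mat m m"
    and lim: "\<And>i j. i < m \<Longrightarrow> j < m \<Longrightarrow> (\<lambda>n. K n $$ (i, j)) \<longlonglongrightarrow> K' $$ (i, j)"
  shows "(\<lambda>n. poly (char_poly (K n)) x) \<longlonglongrightarrow> poly (char_poly K') x"
proof -
  have char: "poly (char_poly A) x = (\<Sum>\<pi> | \<pi> permutes {0..<m}. signof \<pi> *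
      (\<Prod>i = 0..<m. (if i = \<pi> i then x else 0) - A $$ (i, \<pi> i)))" if A: "A \<in> carrier_mat m m" for A
  proof -
    have "- char_matrix A x \<in> carrier_mat m m" using A by simp
    then have "poly (char_poly A) x = (\<Sum>\<pi> | \<pi> permutes {0..<m}. signof \<pi> *
      (\<Prod>i = 0..<m. (- char_matrix A x) $$ (i, \<pi> i)))"
      unfolding char_poly_matrix[OF A] by (rule det_def')
    also have "\<dots> = (\<Sum>\<pi> | \<pi> permutes {0..<m}. signof \<pi> *
      (\<Prod>i = 0..<m. (if i = \<pi> i then x else 0) - A $$ (i, \<pi> i)))"
    proof (intro sum.cong refl arg_cong2[where f = "(*)"] prod.cong)
      fix \<pi> i assume "\<pi> \<in> {\<pi>. \<pi> permutes {0..<m}}" "i \<in> {0..<m}"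
      then have "\<pi> i < m" "i < m" using permutes_in_image[of \<pi> "{0..<m}" i] by auto
      then show "(- char_matrix A x) $$ (i, \<pi> i) = (if i = \<pi> i then x else 0) - A $$ (i, \<pi> i)"
        using A by (simp add: char_matrix_def)
    qed
    finally show ?thesis .
  qed
  show ?thesis
    unfolding char[OF K(1)] char[OF K(2)]
  proof (intro tendsto_sum tendsto_mult tendsto_const tendsto_prod tendsto_diff)
    fix \<pi> i assume "\<pi> \<in> {\<pi>. \<pi> permutes {0..<m}}" "i \<in> {0..<m}"
    then have "\<pi> i < m" "i < m" using permutes_in_image[of \<pi> "{0..<m}" i] by auto
    then show "(\<lambda>n. K n $$ (i, \<pi> i)) \<longlonglongrightarrow> K' $$ (i, \<pi> i)" by (intro lim)
  qed
qed

section \<open>Reduction to a core of fixed size\<close>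

definition rank_form :: "nat \<Rightarrow> nat \<Rightarrow> (nat \<Rightarrow> real) \<Rightarrow> (nat \<Rightarrow> nat \<Rightarrow> real) \<Rightarrow> real mat" where
  "rank_form d m D f = mat d d (\<lambda>(i, j). \<Sum>k<m. D k * f k i * f k j)"

text \<open>If \<open>F\<close> has the columns \<open>f k\<close> and \<open>G = F\<^sup>T F\<close>, then \<open>A = F D F\<^sup>T\<close> satisfies \<open>A\<^sup>T A = F (D G D F\<^sup>T)\<close>, whose
  nonzero spectrum is that of \<open>D G D G\<close>.  This replaces a matrix of growing dimension by one of
  fixed size.\<close>

definition gram_core :: "nat \<Rightarrow> (nat \<Rightarrow> real) \<Rightarrow> (nat \<Rightarrow> nat \<Rightarrow> real) \<Rightarrow> real mat" where
  "gram_core m D g = mat m m (\<lambda>(k, l). \<Sum>q<m. D k * g k q * D q * g q l)"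

lemma rank_form_factorisation:
  fixes d m :: nat and D :: "nat \<Rightarrow> real" and f :: "nat \<Rightarrow> nat \<Rightarrow> real"
  defines "F \<equiv> mat d m (\<lambda>(i, k). f k i)"
    and "H \<equiv> mat m d (\<lambda>(k, j). \<Sum>q<m. D k * dot d (f k) (f q) * D q * f q j)"
  shows "transpose_mat (rank_form d m D f) * rank_form d m D f = F * H"
    and "H * F = gram_core m D (\<lambda>k l. dot d (f k) (f l))"
    and "F \<in> carrier_mat d m" "H \<in> carrier_mat m d" "rank_form d m D f \<in> carrier_mat d d"
proof -
  show c: "F \<in> carrier_mat d m" "H \<in> carrier_mat m d" "rank_form d m D f \<in> carrier_mat d d"
    by (simp_all add: F_def H_def rank_form_def)
  show "transpose_mat (rank_form d m D f) * rank_form d m D f = F * H"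
  proof (rule eq_matI)
    fix i j assume "i < dim_row (F * H)" "j < dim_col (F * H)"
    then have ij: "i < d" "j < d" by (simp_all add: F_def H_def)
    have "(transpose_mat (rank_form d m D f) * rank_form d m D f) $$ (i, j)
        = (\<Sum>a<d. (\<Sum>k<m. D k * f k a * f k i) * (\<Sum>q<m. D q * f q a * f q j))"
      using ij by (simp add: rank_form_def scalar_prod_def lessThan_atLeast0)
    also have "\<dots> = (\<Sum>a<d. \<Sum>k<m. \<Sum>q<m. (D k * f k a * f k i) * (D q * f q a * f q j))"
      by (simp only: sum_product)
    also have "\<dots> = (\<Sum>k<m. \<Sum>q<m. \<Sum>a<d. (D k * f k a * f k i) * (D q * f q a * f q j))"
      by (subst sum.swap, rule sum.cong[OF refl], rule sum.swap)
    also have "\<dots> = (\<Sum>k<m. f k i * (\<Sum>q<m. D k * dot d (f k) (f q) * D q * f q j))"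
      by (rule sum.cong[OF refl]) (simp add: dot_def sum_distrib_left sum_distrib_right mult_ac)
    also have "\<dots> = (F * H) $$ (i, j)"
      using ij by (simp add: F_def H_def scalar_prod_def lessThan_atLeast0)
    finally show "(transpose_mat (rank_form d m D f) * rank_form d m D f) $$ (i, j) = (F * H) $$ (i, j)" .
  qed (simp_all add: F_def H_def rank_form_def)
  show "H * F = gram_core m D (\<lambda>k l. dot d (f k) (f l))"
  proof (rule eq_matI)
    fix k l assume "k < dim_row (gram_core m D (\<lambda>k l. dot d (f k) (f l)))" "l < dim_col (gram_core m D (\<lambda>k l. dot d (f k) (f l)))"
    then have kl: "k < m" "l < m" by (simp_all add: gram_core_def)
    have "(H * F) $$ (k, l) = (\<Sum>j<d. \<Sum>q<m. (D k * dot d (f k) (f q) * D q * f q j) * f l j)"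
      using kl by (simp add: F_def H_def scalar_prod_def lessThan_atLeast0 sum_distrib_right)
    also have "\<dots> = (\<Sum>q<m. \<Sum>j<d. (D k * dot d (f k) (f q) * D q * f q j) * f l j)"
      by (rule sum.swap)
    also have "\<dots> = (\<Sum>q<m. D k * dot d (f k) (f q) * D q * dot d (f q) (f l))"
      by (rule sum.cong[OF refl]) (simp add: dot_def[of d "f _" "f l"] sum_distrib_left mult.assoc)
    finally show "(H * F) $$ (k, l) = gram_core m D (\<lambda>k l. dot d (f k) (f l)) $$ (k, l)"
      using kl by (simp add: gram_core_def)
  qed (simp_all add: F_def H_def gram_core_def)
qed

lemma gram_core_carrier [simp]: "gram_core m D g \<in> carrier_mat m m"
  by (simp add: gram_core_def)

lemma nuclear_norm_rank_form:
  "nuclear_norm (rank_form d m D f) = sqrt_root_sum (char_poly (gram_core m D (\<lambda>k l. dot d (f k) (f l))))"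
  unfolding nuclear_norm_def sqrt_root_sum_def[symmetric] rank_form_factorisation(1)
  using sqrt_root_sum_Sylvester[OF rank_form_factorisation(3,4)] by (simp only: rank_form_factorisation(2))

text \<open>D G D G is not symmetric, so its roots are not visibly real. Up to powers of X its
  characteristic polynomial is that of A^T A, from which reality and nonnegativity are
  inherited.\<close>

lemma gram_core_split:
  "\<exists>as. char_poly (gram_core m D (\<lambda>k l. dot d (f k) (f l))) = (\<Prod>a\<leftarrow>as. [:- a, 1:]) \<and> length as = m \<and> (\<forall>a\<in>set as. 0 \<le> a)"
proof (rule char_poly_real_split)
  show "nonneg_roots (char_poly (gram_core m D (\<lambda>k l. dot d (f k) (f l))))"
    using nonneg_roots_transfer[OF Sylvester_char_poly[OF rank_form_factorisation(3)[where d = d and m = m and f = f]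
          rank_form_factorisation(4)[where d = d and m = m and f = f and D = D]]]
      nonneg_roots_char_poly_gram[OF rank_form_factorisation(5)[where d = d and m = m and f = f and D = D]]
    by (simp only: rank_form_factorisation(1,2))
qed simp

text \<open>The ambient dimension may vary with n: coefficients and Gram entries determine the norm
  through a matrix of size m, so their convergence suffices.\<close>

lemma nuclear_norm_rank_form_tendsto:
  assumes D: "\<And>k. k < m \<Longrightarrow> (\<lambda>n. D n k) \<longlonglongrightarrow> D' k"
    and g: "\<And>k l. k < m \<Longrightarrow> l < m \<Longrightarrow> (\<lambda>n. dot (d n) (f n k) (f n l)) \<longlonglongrightarrow> g k l"
  shows "(\<lambda>n. nuclear_norm (rank_form (d n) m (D n) (f n))) \<longlonglongrightarrow> sqrt_root_sum (char_poly (gram_core m D' g))"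
proof -
  let ?K = "\<lambda>n. gram_core m (D n) (\<lambda>k l. dot (d n) (f n k) (f n l))"
  have "\<forall>n. \<exists>as. char_poly (?K n) = (\<Prod>a\<leftarrow>as. [:- a, 1:]) \<and> length as = m \<and> (\<forall>a\<in>set as. 0 \<le> a)"
    using gram_core_split by blast
  then obtain as where as: "\<And>n. char_poly (?K n) = (\<Prod>a\<leftarrow>as n. [:- a, 1:])" "\<And>n. length (as n) = m"
    "\<And>n a. a \<in> set (as n) \<Longrightarrow> 0 \<le> a" by metis
  have "(\<lambda>n. \<Sum>a\<leftarrow>as n. sqrt a) \<longlonglongrightarrow> sqrt_root_sum (char_poly (gram_core m D' g))"
  proof (rule sqrt_root_sum_tendsto[OF as(2) as(3)])
    fix x
    have "(\<lambda>n. poly (char_poly (?K n)) x) \<longlonglongrightarrow> poly (char_poly (gram_core m D' g)) x"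
      by (rule char_poly_value_tendsto[of _ m])
        (auto simp: gram_core_def intro!: tendsto_sum tendsto_mult D g)
    then show "(\<lambda>n. poly (\<Prod>a\<leftarrow>as n. [:- a, 1:]) x) \<longlonglongrightarrow> poly (char_poly (gram_core m D' g)) x"
      unfolding as(1) .
  qed
  then show ?thesis
    unfolding nuclear_norm_rank_form as(1) sqrt_root_sum_linear_factors .
qed

section \<open>Splitting into orthogonal planes\<close>

definition block_form :: "nat \<Rightarrow> (nat \<Rightarrow> nat \<Rightarrow> nat \<Rightarrow> real) \<Rightarrow> real mat" where
  "block_form r k = mat (2 * r) (2 * r) (\<lambda>(i, j). if i div 2 = j div 2 then k (i div 2) (i mod 2) (j mod 2) else 0)"

lemma char_poly_block_form: "char_poly (block_form r k) = (\<Prod>b<r. char_poly (mat 2 2 (\<lambda>(i, j). k b i j)))"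
proof (induction r)
  case 0
  then show ?case by (simp add: block_form_def char_poly_defs)
next
  case (Suc r)
  let ?B = "mat 2 2 (\<lambda>(i, j). k r i j)"
  let ?A = "block_form r k"
  have A: "?A \<in> carrier_mat (2 * r) (2 * r)" by (simp add: block_form_def)
  have B: "?B \<in> carrier_mat 2 2" by simp
  have "char_poly_matrix (block_form (Suc r) k)
      = four_block_mat (char_poly_matrix ?A) (0\<^sub>m (2 * r) 2) (0\<^sub>m 2 (2 * r)) (char_poly_matrix ?B)"
  proof (rule eq_matI)
    fix i j
    assume "i < dim_row (four_block_mat (char_poly_matrix ?A) (0\<^sub>m (2 * r) 2) (0\<^sub>m 2 (2 * r)) (char_poly_matrix ?B))"
      "j < dim_col (four_block_mat (char_poly_matrix ?A) (0\<^sub>m (2 * r) 2) (0\<^sub>m 2 (2 * r)) (char_poly_matrix ?B))"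
    then have ij: "i < 2 * r + 2" "j < 2 * r + 2" by (simp_all add: block_form_def char_poly_matrix_def)
    have hi: "\<exists>y<2. x = 2 * r + y" if "\<not> x < 2 * r" "x < 2 * r + 2" for x
      using that by (intro exI[of _ "x - 2 * r"]) auto
    have lo: "x div 2 \<noteq> r" if "x < 2 * r" for x :: nat using that by linarith
    have dm: "(2 * r + y) div 2 = r" "(2 * r + y) mod 2 = y" if "y < 2" for y :: nat using that by auto
    show "char_poly_matrix (block_form (Suc r) k) $$ (i, j)
      = four_block_mat (char_poly_matrix ?A) (0\<^sub>m (2 * r) 2) (0\<^sub>m 2 (2 * r)) (char_poly_matrix ?B) $$ (i, j)"
    proof (cases "i < 2 * r"; cases "j < 2 * r")
      assume "i < 2 * r" "j < 2 * r"
      then show ?thesis by (simp add: block_form_def char_poly_matrix_def)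
    next
      assume c: "i < 2 * r" "\<not> j < 2 * r"
      then obtain y where "y < 2" "j = 2 * r + y" using hi ij by blast
      then show ?thesis using c lo[of i] dm[of y] by (simp add: block_form_def char_poly_matrix_def)
    next
      assume c: "\<not> i < 2 * r" "j < 2 * r"
      then obtain y where "y < 2" "i = 2 * r + y" using hi ij by blast
      then show ?thesis using c lo[of j] dm[of y] by (simp add: block_form_def char_poly_matrix_def)
    next
      assume c: "\<not> i < 2 * r" "\<not> j < 2 * r"
      then obtain y y' where "y < 2" "i = 2 * r + y" "y' < 2" "j = 2 * r + y'" using hi ij by metis
      then show ?thesis using dm[of y] dm[of y'] by (simp add: block_form_def char_poly_matrix_def)
    qed
  qed (simp_all add: block_form_def char_poly_matrix_def)
  then have "char_poly (block_form (Suc r) k) = char_poly ?A * char_poly ?B"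
    unfolding char_poly_def using A B
    by (simp only:) (rule det_four_block_mat_lower_left_zero[of _ "2 * r" _ 2], auto)
  then show ?case using Suc by simp
qed

lemma sum_pairs: "(\<Sum>q<2 * r. f q) = (\<Sum>b<r. \<Sum>i<2. f (2 * b + i))" for f :: "nat \<Rightarrow> real"
proof (induction r)
  case (Suc r)
  have "(\<Sum>q<2 * Suc r. f q) = (\<Sum>q<2 * r. f q) + f (2 * r) + f (2 * r + 1)" by simp
  then show ?case using Suc by (simp add: numeral_2_eq_2)
qed simp

text \<open>Indices 2 b and 2 b + 1 belong to plane b. Vanishing Gram entries between planes make
  the core block diagonal, so its characteristic polynomial factors and the root sum is
  additive.\<close>

lemma gram_core_block:
  assumes g: "\<And>k l. g k l = (if k div 2 = l div 2 then gg (k div 2) (k mod 2) (l mod 2) else 0)"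
  shows "sqrt_root_sum (char_poly (gram_core (2 * r) D g))
     = (\<Sum>b<r. sqrt_root_sum (char_poly (gram_core 2 (\<lambda>i. D (2 * b + i)) (gg b))))"
proof -
  have "gram_core (2 * r) D g = block_form r (\<lambda>b i j. \<Sum>q<2. D (2 * b + i) * gg b i q * D (2 * b + q) * gg b q j)"
  proof (rule eq_matI)
    fix k l assume "k < dim_row (block_form r (\<lambda>b i j. \<Sum>q<2. D (2 * b + i) * gg b i q * D (2 * b + q) * gg b q j))"
      "l < dim_col (block_form r (\<lambda>b i j. \<Sum>q<2. D (2 * b + i) * gg b i q * D (2 * b + q) * gg b q j))"
    then have kl: "k < 2 * r" "l < 2 * r" by (simp_all add: block_form_def)
    have "(\<Sum>q<2 * r. D k * g k q * D q * g q l)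
        = (\<Sum>b<r. if b = k div 2 then (if k div 2 = l div 2 then \<Sum>i<2. D k * gg b (k mod 2) i * D (2 * b + i) * gg b i (l mod 2) else 0) else 0)"
      unfolding sum_pairs
    proof (rule sum.cong[OF refl])
      fix b
      have "(2 * b + i) div 2 = b" "(2 * b + i) mod 2 = i" if "i < 2" for i :: nat using that by auto
      then show "(\<Sum>i<2. D k * g k (2 * b + i) * D (2 * b + i) * g (2 * b + i) l)
        = (if b = k div 2 then (if k div 2 = l div 2 then \<Sum>i<2. D k * gg b (k mod 2) i * D (2 * b + i) * gg b i (l mod 2) else 0) else 0)"
        by (auto simp: g intro!: sum.cong sum.neutral)
    qed
    also have "\<dots> = (if k div 2 = l div 2 then \<Sum>i<2. D k * gg (k div 2) (k mod 2) i * D (2 * (k div 2) + i) * gg (k div 2) i (l mod 2) else 0)"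
      using kl by (subst sum.delta) auto
    finally have "(\<Sum>q<2 * r. D k * g k q * D q * g q l) = (if k div 2 = l div 2 then \<Sum>i<2. D k * gg (k div 2) (k mod 2) i * D (2 * (k div 2) + i) * gg (k div 2) i (l mod 2) else 0)" .
    then have "(\<Sum>q<2 * r. D k * g k q * D q * g q l) = (if k div 2 = l div 2 then \<Sum>i<2. D (2 * (k div 2) + k mod 2) * gg (k div 2) (k mod 2) i * D (2 * (k div 2) + i) * gg (k div 2) i (l mod 2) else 0)"
      by (simp only: mult_div_mod_eq)
    then show "gram_core (2 * r) D g $$ (k, l)
        = block_form r (\<lambda>b i j. \<Sum>q<2. D (2 * b + i) * gg b i q * D (2 * b + q) * gg b q j) $$ (k, l)"
      by (simp only: gram_core_def block_form_def index_mat(1) kl prod.case)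
  qed (simp_all add: block_form_def gram_core_def)
  then have "char_poly (gram_core (2 * r) D g) = (\<Prod>b<r. char_poly (gram_core 2 (\<lambda>i. D (2 * b + i)) (gg b)))"
    by (simp add: char_poly_block_form gram_core_def)
  moreover have "sqrt_root_sum (\<Prod>b<r. char_poly (gram_core 2 (\<lambda>i. D (2 * b + i)) (gg b)))
     = (\<Sum>b<r. sqrt_root_sum (char_poly (gram_core 2 (\<lambda>i. D (2 * b + i)) (gg b))))"
  proof (induction r)
    case 0
    then show ?case by (simp add: sqrt_root_sum_def)
  next
    case (Suc r)
    have "char_poly (gram_core 2 (\<lambda>i. D (2 * b + i)) (gg b)) \<noteq> 0" for b
      by (rule char_poly_nonzero[OF gram_core_carrier])
    then show ?case using Suc by (simp add: sqrt_root_sum_mult)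
  qed
  ultimately show ?thesis by simp
qed

section \<open>The two-dimensional losses\<close>

lemma frobenius_norm_rank_form:
  "frobenius_norm (rank_form d m D f) = sqrt (\<Sum>k<m. \<Sum>l<m. D k * D l * (dot d (f k) (f l))\<^sup>2)"
proof -
  have "(\<Sum>i<d. \<Sum>j<d. (\<Sum>k<m. D k * f k i * f k j)\<^sup>2)
      = (\<Sum>i<d. \<Sum>j<d. \<Sum>k<m. \<Sum>l<m. (D k * f k i * f k j) * (D l * f l i * f l j))"
    by (simp only: power2_eq_square sum_product)
  also have "\<dots> = (\<Sum>i<d. \<Sum>k<m. \<Sum>l<m. \<Sum>j<d. (D k * f k i * f k j) * (D l * f l i * f l j))"
    by (rule sum.cong[OF refl], rule trans[OF sum.swap sum.cong[OF refl sum.swap]])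
  also have "\<dots> = (\<Sum>k<m. \<Sum>l<m. \<Sum>i<d. \<Sum>j<d. (D k * f k i * f k j) * (D l * f l i * f l j))"
    by (rule trans[OF sum.swap sum.cong[OF refl sum.swap]])
  also have "\<dots> = (\<Sum>k<m. \<Sum>l<m. D k * D l * (dot d (f k) (f l))\<^sup>2)"
  proof (rule sum.cong[OF refl], rule sum.cong[OF refl])
    fix k l
    have "(dot d (f k) (f l))\<^sup>2 = (\<Sum>i<d. \<Sum>j<d. (f k i * f l i) * (f k j * f l j))"
      by (simp only: dot_def power2_eq_square sum_product)
    then show "(\<Sum>i<d. \<Sum>j<d. (D k * f k i * f k j) * (D l * f l i * f l j)) = D k * D l * (dot d (f k) (f l))\<^sup>2"
      by (simp add: sum_distrib_left mult_ac)
  qed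
  finally show ?thesis by (simp add: frobenius_norm_def rank_form_def)
qed

text \<open>The singular values of \<open>B = [[x, y], [y, z]]\<close> are \<open>M\<close> and \<open>\<bar>m\<bar>\<close> with \<open>M + m = sqrt ((x - z)\<^sup>2 + 4 y\<^sup>2)\<close> and
  \<open>M - m = \<bar>x + z\<bar>\<close>; the form \<open>M\<^sup>2 - B\<^sup>2\<close> is positive semidefinite and singular.\<close>

lemma symmetric_two_form:
  fixes x y z :: real
  defines "M \<equiv> (\<bar>x + z\<bar> + sqrt ((x - z)\<^sup>2 + 4 * y\<^sup>2)) / 2"
  shows "(x * a + y * b)\<^sup>2 + (y * a + z * b)\<^sup>2 \<le> M\<^sup>2 * (a\<^sup>2 + b\<^sup>2)"
    and "\<exists>a b. a\<^sup>2 + b\<^sup>2 = 1 \<and> (x * a + y * b)\<^sup>2 + (y * a + z * b)\<^sup>2 = M\<^sup>2"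
    and "0 \<le> M"
proof -
  define t q where "t = \<bar>x + z\<bar>" and "q = sqrt ((x - z)\<^sup>2 + 4 * y\<^sup>2)"
  have q2: "q\<^sup>2 = (x - z)\<^sup>2 + 4 * y\<^sup>2" by (simp add: q_def)
  have t2: "t\<^sup>2 = (x + z)\<^sup>2" by (simp add: t_def)
  have pos: "0 \<le> t" "0 \<le> q" by (simp_all add: t_def q_def)
  have M: "M = (t + q) / 2" by (simp add: M_def t_def q_def)
  show "0 \<le> M" using pos by (simp add: M)
  \<comment> \<open>P, Q and - R are the diagonal and off-diagonal entries of M^2 I - B^2.\<close>
  define P Q R where "P = M\<^sup>2 - x\<^sup>2 - y\<^sup>2" and "Q = M\<^sup>2 - y\<^sup>2 - z\<^sup>2" and "R = y * (x + z)"
  have M2: "M\<^sup>2 = (t\<^sup>2 + q\<^sup>2) / 4 + t * q / 2" by (simp add: M power2_eq_square field_simps)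
  have PQ: "P + Q = t * q"
    unfolding P_def Q_def M2 t2 q2 by (simp add: power2_eq_square field_simps)
  have PmQ: "P - Q = (z - x) * (x + z)" by (simp add: P_def Q_def power2_eq_square algebra_simps)
  have "4 * (P * Q) = (P + Q)\<^sup>2 - (P - Q)\<^sup>2" by (simp add: power2_eq_square algebra_simps)
  also have "\<dots> = 4 * R\<^sup>2"
    unfolding PQ PmQ power_mult_distrib t2 q2 R_def by (simp add: power2_eq_square algebra_simps)
  finally have det: "P * Q = R\<^sup>2" by simp
  have nn: "0 \<le> P" "0 \<le> Q"
  proof -
    have "0 \<le> P * Q" "0 \<le> P + Q" using det PQ pos by simp_all
    then show "0 \<le> P" "0 \<le> Q" by (auto simp: zero_le_mult_iff)
  qed
  have form: "M\<^sup>2 * (a\<^sup>2 + b\<^sup>2) - ((x * a + y * b)\<^sup>2 + (y * a + z * b)\<^sup>2) = P * a\<^sup>2 - 2 * R * a * b + Q * b\<^sup>2" for a b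
    by (simp add: P_def Q_def R_def power2_eq_square algebra_simps)
  have sq: "P * (P * a\<^sup>2 - 2 * R * a * b + Q * b\<^sup>2) = (P * a - R * b)\<^sup>2" for a b
  proof -
    have "P * (P * a\<^sup>2 - 2 * R * a * b + Q * b\<^sup>2) = (P * a)\<^sup>2 - 2 * (P * a) * (R * b) + (P * Q) * b\<^sup>2"
      by (simp add: power2_eq_square algebra_simps)
    then show ?thesis unfolding det by (simp add: power2_eq_square algebra_simps)
  qed
  have psd: "0 \<le> P * a\<^sup>2 - 2 * R * a * b + Q * b\<^sup>2" for a b
  proof (cases "P = 0")
    case True
    then have "R = 0" using det by simp
    then show ?thesis using True nn by simp
  next
    case False
    then have "0 < P" using nn by simp
    moreover have "0 \<le> P * (P * a\<^sup>2 - 2 * R * a * b + Q * b\<^sup>2)" unfolding sq by simp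
    ultimately show ?thesis by (simp add: zero_le_mult_iff)
  qed
  show "(x * a + y * b)\<^sup>2 + (y * a + z * b)\<^sup>2 \<le> M\<^sup>2 * (a\<^sup>2 + b\<^sup>2)"
    using form[of a b] psd[of a b] by linarith
  show "\<exists>a b. a\<^sup>2 + b\<^sup>2 = 1 \<and> (x * a + y * b)\<^sup>2 + (y * a + z * b)\<^sup>2 = M\<^sup>2"
  proof (cases "P = 0")
    case True
    have "P * 1\<^sup>2 - 2 * R * 1 * 0 + Q * 0\<^sup>2 = 0" using True by simp
    then show ?thesis using form[of 1 0] by (intro exI[of _ 1] exI[of _ 0]) simp
  next
    case False
    \<comment> \<open>The vector (R, P) spans the kernel of M^2 I - B^2, since it makes P a - R b
      vanish; normalised, it attains the maximum.\<close>
    define N where "N = sqrt (R\<^sup>2 + P\<^sup>2)"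
    have N: "0 < N" "N\<^sup>2 = R\<^sup>2 + P\<^sup>2" using False by (auto simp: N_def add_nonneg_pos)
    have "(R / N)\<^sup>2 + (P / N)\<^sup>2 = 1"
      using N(1) by (simp add: power_divide add_divide_distrib[symmetric] N(2)[symmetric])
    moreover have "P * (R / N)\<^sup>2 - 2 * R * (R / N) * (P / N) + Q * (P / N)\<^sup>2 = 0"
      using sq[of "R / N" "P / N"] False by simp
    ultimately show ?thesis
      using form[of "R / N" "P / N"] by (intro exI[of _ "R / N"] exI[of _ "P / N"]) simp
  qed
qed

text \<open>The matrix acts as [[x, y], [y, z]] on the plane of e1 and e2 and kills its orthogonal
  complement. Bessel's inequality bounds the projection onto the plane, so the supremum reduces to
  the two-dimensional form.\<close>

lemma operator_norm_orthonormal_pair: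
  fixes e1 e2 :: "nat \<Rightarrow> real" and x y z :: real
  assumes e: "dot d e1 e1 = 1" "dot d e2 e2 = 1" "dot d e1 e2 = 0"
  shows "operator_norm (mat d d (\<lambda>(i, j). x * e1 i * e1 j + y * (e1 i * e2 j + e2 i * e1 j) + z * e2 i * e2 j))
    = (\<bar>x + z\<bar> + sqrt ((x - z)\<^sup>2 + 4 * y\<^sup>2)) / 2" (is "operator_norm ?A = ?M")
proof -
  note M1 = symmetric_two_form(1)[where x = x and y = y and z = z]
    and M2 = symmetric_two_form(2)[where x = x and y = y and z = z]
    and M3 = symmetric_two_form(3)[where x = x and y = y and z = z]
  have comb: "dot d (\<lambda>i. a * e1 i + b * e2 i) (\<lambda>i. a * e1 i + b * e2 i) = a\<^sup>2 + b\<^sup>2" for a b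
    unfolding dot_linear symmetric_bilinear_right[OF symmetric_bilinear_dot] e dot_commute[of d e2 e1]
    by (simp add: power2_eq_square)
  have vdot: "v \<bullet> w = dot d (($) v) (($) w)" if "w \<in> carrier_vec d" for v w :: "real vec"
    using that by (simp add: scalar_prod_def dot_def lessThan_atLeast0)
  have Av: "(?A *\<^sub>v v) \<bullet> (?A *\<^sub>v v) = (x * dot d e1 (($) v) + y * dot d e2 (($) v))\<^sup>2 + (y * dot d e1 (($) v) + z * dot d e2 (($) v))\<^sup>2"
    if v: "v \<in> carrier_vec d" for v
  proof -
    let ?a = "x * dot d e1 (($) v) + y * dot d e2 (($) v)" and ?b = "y * dot d e1 (($) v) + z * dot d e2 (($) v)"
    have carr: "?A *\<^sub>v v \<in> carrier_vec d" using v by (intro mult_mat_vec_carrier[of _ d d]) auto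
    have coord: "(?A *\<^sub>v v) $ i = ?a * e1 i + ?b * e2 i" if "i < d" for i
      using v that
      by (simp add: scalar_prod_def dot_def lessThan_atLeast0 sum_distrib_left sum_distrib_right sum.distrib algebra_simps)
    have "(?A *\<^sub>v v) \<bullet> (?A *\<^sub>v v) = dot d (\<lambda>i. ?a * e1 i + ?b * e2 i) (\<lambda>i. ?a * e1 i + ?b * e2 i)"
      unfolding vdot[OF carr] dot_def[of d "($) (?A *\<^sub>v v)"] dot_def[of d "\<lambda>i. ?a * e1 i + ?b * e2 i"]
      by (rule sum.cong[OF refl]) (simp only: coord lessThan_iff)
    then show ?thesis unfolding comb .
  qed
  have le: "sqrt ((?A *\<^sub>v v) \<bullet> (?A *\<^sub>v v)) \<le> ?M" if v: "v \<in> carrier_vec d" "v \<bullet> v \<le> 1" for v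
  proof -
    let ?p = "dot d e1 (($) v)" and ?q = "dot d e2 (($) v)"
    have "?p\<^sup>2 + ?q\<^sup>2 \<le> 1"
    proof -
      define w where "w = (\<lambda>i. ?p * e1 i + ?q * e2 i)"
      have "dot d w w = ?p\<^sup>2 + ?q\<^sup>2" unfolding w_def by (rule comb)
      moreover have "dot d w (($) v) = ?p\<^sup>2 + ?q\<^sup>2"
        unfolding w_def dot_linear by (simp add: power2_eq_square)
      ultimately have "(?p\<^sup>2 + ?q\<^sup>2)\<^sup>2 \<le> (?p\<^sup>2 + ?q\<^sup>2) * dot d (($) v) (($) v)"
        using dot_Cauchy_Schwarz_square[of d w "($) v"] by simp
      also have "\<dots> \<le> (?p\<^sup>2 + ?q\<^sup>2) * 1"
        using v vdot[of v v] by (intro mult_left_mono) auto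
      finally have S: "(?p\<^sup>2 + ?q\<^sup>2)\<^sup>2 \<le> (?p\<^sup>2 + ?q\<^sup>2) * 1" .
      show ?thesis
      proof (rule ccontr)
        assume "\<not> ?thesis"
        then have "(?p\<^sup>2 + ?q\<^sup>2) * 1 < (?p\<^sup>2 + ?q\<^sup>2) * (?p\<^sup>2 + ?q\<^sup>2)"
          by (intro mult_strict_left_mono) auto
        then show False using S unfolding power2_eq_square[of "?p\<^sup>2 + ?q\<^sup>2"] by linarith
      qed
    qed
    then have "?M\<^sup>2 * (?p\<^sup>2 + ?q\<^sup>2) \<le> ?M\<^sup>2 * 1" by (rule mult_left_mono) simp
    then have "(?A *\<^sub>v v) \<bullet> (?A *\<^sub>v v) \<le> ?M\<^sup>2"
      unfolding Av[OF v(1)] using M1[where a = ?p and b = ?q] by linarith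
    then show ?thesis using M3 by (rule real_le_lsqrt[rotated])
  qed
  obtain a b where ab: "a\<^sup>2 + b\<^sup>2 = 1" "(x * a + y * b)\<^sup>2 + (y * a + z * b)\<^sup>2 = ?M\<^sup>2"
    using M2 by blast
  define w where "w = vec d (\<lambda>i. a * e1 i + b * e2 i)"
  have w: "w \<in> carrier_vec d" by (simp add: w_def)
  have dw: "dot d f (($) w) = a * dot d f e1 + b * dot d f e2" for f
  proof -
    have "dot d f (($) w) = dot d f (\<lambda>i. a * e1 i + b * e2 i)" by (simp add: dot_def w_def)
    then show ?thesis unfolding symmetric_bilinear_right[OF symmetric_bilinear_dot] .
  qed
  have "w \<bullet> w = 1"
    unfolding vdot[OF w] using comb[of a b] ab(1) by (simp add: dot_def w_def)
  moreover have "sqrt ((?A *\<^sub>v w) \<bullet> (?A *\<^sub>v w)) = ?M"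
    unfolding Av[OF w] dw using e ab(2) M3 by (simp add: dot_commute[of d e2 e1])
  ultimately have mem: "?M \<in> (\<lambda>v. sqrt ((?A *\<^sub>v v) \<bullet> (?A *\<^sub>v v))) ` {v \<in> carrier_vec (dim_col ?A). v \<bullet> v \<le> 1}"
    using w by (intro image_eqI[of _ _ w]) auto
  show ?thesis
    unfolding operator_norm_def by (rule cSup_eq_maximum[OF mem]) (use le in auto)
qed

text \<open>Gram-Schmidt of f 1 against f 0 yields a symmetric 2 by 2 matrix with trace D 0 + D 1
  and determinant D 0 * D 1 * (1 - c^2); the radicand is trace^2 - 4 * determinant. Strictness of
  c^2 < 1 allows the normalisation.\<close>

lemma operator_norm_rank_two:
  assumes f: "dot d (f 0) (f 0) = 1" "dot d (f 1) (f 1) = 1" and c: "(dot d (f 0) (f 1))\<^sup>2 < 1"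
  shows "operator_norm (rank_form d 2 D f)
    = (\<bar>D 0 + D 1\<bar> + sqrt ((D 0 + D 1)\<^sup>2 - 4 * D 0 * D 1 * (1 - (dot d (f 0) (f 1))\<^sup>2))) / 2"
proof -
  define c where "c = dot d (f 0) (f 1)"
  define s where "s = sqrt (1 - c\<^sup>2)"
  have s: "0 < s" "s\<^sup>2 = 1 - c\<^sup>2" using c by (simp_all add: s_def c_def)
  define e2 where "e2 = (\<lambda>i. (1 / s) * f 1 i + (- c / s) * f 0 i)"
  have e: "dot d (f 0) e2 = 0" "dot d e2 e2 = 1"
  proof -
    show "dot d (f 0) e2 = 0"
      unfolding e2_def symmetric_bilinear_right[OF symmetric_bilinear_dot] f c_def[symmetric] by simp
    have "dot d e2 e2 = (1 / s) * dot d (f 1) e2"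
      using \<open>dot d (f 0) e2 = 0\<close> unfolding e2_def dot_linear by simp
    also have "dot d (f 1) e2 = (1 / s) - (c / s) * c"
      unfolding e2_def symmetric_bilinear_right[OF symmetric_bilinear_dot] f dot_commute[of d "f 1" "f 0"] c_def[symmetric] by simp
    also have "(1 / s) * ((1 / s) - (c / s) * c) = (1 - c\<^sup>2) / s\<^sup>2"
      using s(1) by (simp add: power2_eq_square field_simps)
    finally show "dot d e2 e2 = 1" unfolding s(2)[symmetric] using s(1) by simp
  qed
  have f1: "f 1 i = c * f 0 i + s * e2 i" for i using s(1) by (simp add: e2_def field_simps)
  have "rank_form d 2 D f = mat d d (\<lambda>(i, j). (D 0 + D 1 * c\<^sup>2) * f 0 i * f 0 j
      + (D 1 * c * s) * (f 0 i * e2 j + e2 i * f 0 j) + (D 1 * s\<^sup>2) * e2 i * e2 j)"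
    unfolding rank_form_def
    by (rule eq_matI) (simp_all add: numeral_2_eq_2 f1[unfolded One_nat_def] power2_eq_square algebra_simps)
  then have "operator_norm (rank_form d 2 D f)
    = (\<bar>(D 0 + D 1 * c\<^sup>2) + D 1 * s\<^sup>2\<bar> + sqrt (((D 0 + D 1 * c\<^sup>2) - D 1 * s\<^sup>2)\<^sup>2 + 4 * (D 1 * c * s)\<^sup>2)) / 2"
    using operator_norm_orthonormal_pair[OF f(1) e(2,1)] by simp
  moreover have "(D 0 + D 1 * c\<^sup>2) + D 1 * s\<^sup>2 = D 0 + D 1" unfolding s(2) by (simp add: algebra_simps)
  moreover have "((D 0 + D 1 * c\<^sup>2) - D 1 * s\<^sup>2)\<^sup>2 + 4 * (D 1 * c * s)\<^sup>2 = (D 0 + D 1)\<^sup>2 - 4 * D 0 * D 1 * (1 - c\<^sup>2)"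
    unfolding power_mult_distrib s(2) by (simp add: power2_eq_square algebra_simps)
  ultimately show ?thesis by (simp add: c_def)
qed

lemma det_two:
  fixes A :: "real mat" assumes A: "A \<in> carrier_mat 2 2"
  shows "det A = A $$ (0, 0) * A $$ (1, 1) - A $$ (0, 1) * A $$ (1, 0)"
proof -
  have "det A = (\<Sum>i<2. A $$ (i, 0) * cofactor A i 0)"
    by (rule laplace_expansion_column[OF A]) simp
  also have "\<dots> = A $$ (0, 0) * A $$ (1, 1) - A $$ (1, 0) * A $$ (0, 1)"
    using A det_single[of "mat_delete A 0 0"] det_single[of "mat_delete A 1 0"]
    by (simp add: numeral_2_eq_2 cofactor_def mat_delete_def)
  finally show ?thesis by simp
qed

text \<open>The singular values are (t + q) / 2 and |q - t| / 2, where t is the absolute trace and q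
  the root of the discriminant; their sum is max t q.\<close>

lemma nuclear_norm_symmetric_two:
  fixes x y z :: real
  shows "nuclear_norm (mat 2 2 (\<lambda>(i, j). if i = j then (if i = 0 then x else z) else y))
    = max \<bar>x + z\<bar> (sqrt ((x - z)\<^sup>2 + 4 * y\<^sup>2))" (is "nuclear_norm ?A = _")
proof -
  define t q where "t = \<bar>x + z\<bar>" and "q = sqrt ((x - z)\<^sup>2 + 4 * y\<^sup>2)"
  have q2: "q\<^sup>2 = (x - z)\<^sup>2 + 4 * y\<^sup>2" by (simp add: q_def)
  have t2: "t\<^sup>2 = (x + z)\<^sup>2" by (simp add: t_def)
  have pos: "0 \<le> t" "0 \<le> q" by (simp_all add: t_def q_def)
  define M m where "M = (t + q) / 2" and "m = (q - t) / 2"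
  let ?G = "transpose_mat ?A * ?A"
  have G: "?G \<in> carrier_mat 2 2" unfolding carrier_mat_def by simp
  have entries: "?G $$ (0, 0) = x\<^sup>2 + y\<^sup>2" "?G $$ (1, 1) = y\<^sup>2 + z\<^sup>2" "?G $$ (0, 1) = y * (x + z)" "?G $$ (1, 0) = y * (x + z)"
    by (simp_all add: scalar_prod_def numeral_2_eq_2 power2_eq_square algebra_simps)
  have "poly (char_poly ?G) k = poly (\<Prod>a\<leftarrow>[M\<^sup>2, m\<^sup>2]. [:- a, 1:]) k" for k
  proof -
    have "- char_matrix ?G k \<in> carrier_mat 2 2" using G by simp
    then have "poly (char_poly ?G) k = (k - ?G $$ (0, 0)) * (k - ?G $$ (1, 1)) - ?G $$ (0, 1) * ?G $$ (1, 0)"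
      unfolding char_poly_matrix[OF G] using G by (subst det_two) (simp_all add: char_matrix_def del: index_mult_mat)
    also have "\<dots> = k\<^sup>2 - (x\<^sup>2 + 2 * y\<^sup>2 + z\<^sup>2) * k + (x * z - y\<^sup>2)\<^sup>2"
      unfolding entries by (simp add: power2_eq_square algebra_simps)
    also have "x\<^sup>2 + 2 * y\<^sup>2 + z\<^sup>2 = M\<^sup>2 + m\<^sup>2"
    proof -
      have "M\<^sup>2 + m\<^sup>2 = (t\<^sup>2 + q\<^sup>2) / 2" by (simp add: M_def m_def power2_eq_square field_simps)
      then show ?thesis unfolding t2 q2 by (simp add: power2_eq_square field_simps)
    qed
    also have "(x * z - y\<^sup>2)\<^sup>2 = M\<^sup>2 * m\<^sup>2"
    proof -
      have "M * m = (q\<^sup>2 - t\<^sup>2) / 4" by (simp add: M_def m_def power2_eq_square field_simps)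
      then have Mm: "M * m = - (x * z - y\<^sup>2)" unfolding t2 q2 by (simp add: power2_eq_square field_simps)
      have "(M * m)\<^sup>2 = (x * z - y\<^sup>2)\<^sup>2" unfolding Mm power2_minus ..
      then show ?thesis by (simp add: power_mult_distrib)
    qed
    finally show ?thesis by (simp add: power2_eq_square algebra_simps)
  qed
  then have "char_poly ?G = (\<Prod>a\<leftarrow>[M\<^sup>2, m\<^sup>2]. [:- a, 1:])" by (intro poly_ext)
  then have "nuclear_norm ?A = sqrt (M\<^sup>2) + sqrt (m\<^sup>2)"
    unfolding nuclear_norm_def sqrt_root_sum_def[symmetric]
    using sqrt_root_sum_linear_factors[of "[M\<^sup>2, m\<^sup>2]"] by simp
  also have "\<dots> = \<bar>M\<bar> + \<bar>m\<bar>" by simp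
  also have "\<dots> = max t q" using pos by (simp add: M_def m_def max_def abs_if field_simps)
  finally show ?thesis by (simp add: t_def q_def)
qed

text \<open>Row 0 is the population spike direction (1, 0), row 1 the limiting sample direction (c,
  s).\<close>

definition plane_pair :: "real \<Rightarrow> nat \<Rightarrow> nat \<Rightarrow> real" where
  "plane_pair \<rho> k i = (if k = 0 then (if i = 0 then 1 else 0) else (if i = 0 then sqrt (\<rho> / (1 + \<rho>)) else sqrt (1 / (1 + \<rho>))))"

lemma asym_loss_rank_form:
  "asym_loss \<kappa> \<rho> \<theta> = mat_norm \<kappa> (rank_form 2 2 (\<lambda>k. if k = 0 then \<rho> else - \<theta>) (plane_pair \<rho>))"
proof -
  have "mat_of_rows_list 2
        [[\<rho> - \<theta> * c\<^sup>2, - \<theta> * c * s],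
         [- \<theta> * c * s, - \<theta> * s\<^sup>2]] = rank_form 2 2 (\<lambda>k. if k = 0 then \<rho> else - \<theta>) (plane_pair \<rho>)"
    if "c = sqrt (\<rho> / (1 + \<rho>))" "s = sqrt (1 / (1 + \<rho>))" for c s
    by (rule eq_matI)
      (auto simp: mat_of_rows_list_def rank_form_def less_2_cases_iff numeral_2_eq_2 plane_pair_def that[symmetric] power2_eq_square less_Suc_eq)
  then show ?thesis by (simp add: asym_loss_def)
qed

lemma plane_pair_gram:
  assumes "0 \<le> \<rho>" "k < 2" "l < 2"
  shows "dot 2 (plane_pair \<rho> k) (plane_pair \<rho> l) = (if k = l then 1 else sqrt (\<rho> / (1 + \<rho>)))"
proof -
  have "\<rho> / (1 + \<rho>) + 1 / (1 + \<rho>) = 1" using assms(1) by (simp add: add_divide_distrib[symmetric])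
  moreover have "sqrt (\<rho> / (1 + \<rho>)) * sqrt (\<rho> / (1 + \<rho>)) = \<rho> / (1 + \<rho>)" "sqrt (1 / (1 + \<rho>)) * sqrt (1 / (1 + \<rho>)) = 1 / (1 + \<rho>)"
    using assms(1) by simp_all
  ultimately show ?thesis
    using assms(2,3) by (auto simp: dot_def plane_pair_def numeral_2_eq_2 less_Suc_eq simp del: real_sqrt_mult_self)
qed

lemma asym_loss_Frobenius:
  assumes "0 \<le> \<rho>"
  shows "asym_loss Frobenius \<rho> \<theta> = sqrt (\<rho>\<^sup>2 - 2 * \<rho> * \<theta> * (\<rho> / (1 + \<rho>)) + \<theta>\<^sup>2)"
proof -
  have sum2: "(\<Sum>k<2. h k) = h 0 + h 1" for h :: "nat \<Rightarrow> real" by (simp add: numeral_2_eq_2)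
  have c: "(sqrt (\<rho> / (1 + \<rho>)))\<^sup>2 = \<rho> / (1 + \<rho>)" using assms by simp
  have g: "(dot 2 (plane_pair \<rho> 0) (plane_pair \<rho> 0))\<^sup>2 = 1" "(dot 2 (plane_pair \<rho> 1) (plane_pair \<rho> 1))\<^sup>2 = 1"
    "(dot 2 (plane_pair \<rho> 0) (plane_pair \<rho> 1))\<^sup>2 = \<rho> / (1 + \<rho>)"
    "(dot 2 (plane_pair \<rho> 1) (plane_pair \<rho> 0))\<^sup>2 = \<rho> / (1 + \<rho>)"
    using plane_pair_gram[OF assms] c by simp_all
  show ?thesis
    unfolding asym_loss_rank_form mat_norm.simps frobenius_norm_rank_form sum2 g
    by (intro arg_cong[where f = sqrt]) (simp add: power2_eq_square)
qed

lemma asym_loss_Operator: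
  assumes "0 \<le> \<rho>"
  shows "asym_loss Operator \<rho> \<theta> = (\<bar>\<rho> - \<theta>\<bar> + sqrt ((\<rho> - \<theta>)\<^sup>2 + 4 * \<rho> * \<theta> * (1 / (1 + \<rho>)))) / 2"
proof -
  have "(sqrt (\<rho> / (1 + \<rho>)))\<^sup>2 = 1 - 1 / (1 + \<rho>)" using assms by (simp add: field_simps)
  moreover have "1 - 1 / (1 + \<rho>) < 1" using assms by simp
  ultimately show ?thesis
    unfolding asym_loss_rank_form mat_norm.simps
    using assms by (subst operator_norm_rank_two) (simp_all add: plane_pair_gram)
qed

lemma asym_loss_Nuclear:
  assumes "0 \<le> \<rho>"
  shows "asym_loss Nuclear \<rho> \<theta> = max \<bar>\<rho> - \<theta>\<bar> (sqrt ((\<rho> - \<theta>)\<^sup>2 + 4 * \<rho> * \<theta> * (1 / (1 + \<rho>))))"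
proof -
  define c s where "c = sqrt (\<rho> / (1 + \<rho>))" and "s = sqrt (1 / (1 + \<rho>))"
  have s2: "s\<^sup>2 = 1 / (1 + \<rho>)" using assms by (simp add: s_def)
  have c2: "c\<^sup>2 = 1 - s\<^sup>2" unfolding s2 using assms by (simp add: c_def field_simps)
  have "asym_loss Nuclear \<rho> \<theta> = nuclear_norm (mat 2 2 (\<lambda>(i, j). if i = j then (if i = 0 then \<rho> - \<theta> * c\<^sup>2 else - \<theta> * s\<^sup>2) else - \<theta> * c * s))"
    unfolding asym_loss_def c_def[symmetric] s_def[symmetric] Let_def mat_norm.simps
    by (rule arg_cong[where f = nuclear_norm], rule eq_matI) (auto simp: mat_of_rows_list_def numeral_2_eq_2 less_Suc_eq)
  also have "\<dots> = max \<bar>\<rho> - \<theta> * c\<^sup>2 + - \<theta> * s\<^sup>2\<bar> (sqrt ((\<rho> - \<theta> * c\<^sup>2 - - \<theta> * s\<^sup>2)\<^sup>2 + 4 * (- \<theta> * c * s)\<^sup>2))"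
    by (rule nuclear_norm_symmetric_two)
  also have "\<rho> - \<theta> * c\<^sup>2 + - \<theta> * s\<^sup>2 = \<rho> - \<theta>" unfolding c2 by (simp add: algebra_simps)
  also have "(\<rho> - \<theta> * c\<^sup>2 - - \<theta> * s\<^sup>2)\<^sup>2 + 4 * (- \<theta> * c * s)\<^sup>2 = (\<rho> - \<theta>)\<^sup>2 + 4 * \<rho> * \<theta> * s\<^sup>2"
    unfolding power_mult_distrib c2 by (simp add: power2_eq_square algebra_simps)
  finally show ?thesis unfolding s2 .
qed

section \<open>The optimal descriptors as unique minimisers\<close>

lemma opt_descriptor_nonneg: "0 \<le> opt_descriptor \<kappa> \<rho>"
  by (cases \<kappa>) (simp_all add: opt_descriptor_def)

lemma opt_descriptor_eq:
  assumes "0 \<le> \<rho>"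
  shows "opt_descriptor \<kappa> \<rho> = opt_descriptor_pos \<kappa> \<rho>"
  using assms by (cases \<kappa>; cases "\<rho> = 0") (simp_all add: opt_descriptor_def)

text \<open>Frobenius: complete the square about \<rho> c^2. Nuclear: the radical equals sqrt
  ((\<theta> - \<tau>)^2 + \<rho>^2 - \<tau>^2) with vertex \<tau> = \<rho> (c^2 - s^2). Operator:
  the loss at \<theta> = \<rho> is \<rho> s, and it rises strictly on both sides.\<close>

lemma asym_loss_unique_minimum:
  assumes r: "0 \<le> \<rho>" and ne: "\<theta> \<noteq> opt_descriptor \<kappa> \<rho>"
  shows "asym_loss \<kappa> \<rho> (opt_descriptor \<kappa> \<rho>) < asym_loss \<kappa> \<rho> \<theta>"
proof (cases \<kappa>)
  case Frobenius
  define \<tau> where "\<tau> = \<rho>\<^sup>2 / (1 + \<rho>)"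
  have \<tau>: "opt_descriptor \<kappa> \<rho> = \<tau>" by (simp add: opt_descriptor_eq[OF r] Frobenius \<tau>_def)
  have "asym_loss \<kappa> \<rho> \<theta> = sqrt ((\<theta> - \<tau>)\<^sup>2 + (\<rho>\<^sup>2 - \<tau>\<^sup>2))" for \<theta>
  proof -
    have "2 * \<rho> * \<theta> * (\<rho> / (1 + \<rho>)) = 2 * \<theta> * \<tau>" by (simp add: \<tau>_def power2_eq_square)
    then show ?thesis
      unfolding Frobenius asym_loss_Frobenius[OF r] by (intro arg_cong[where f = sqrt]) (simp add: power2_eq_square algebra_simps)
  qed
  then show ?thesis using ne \<tau> by simp
next
  case Nuclear
  define \<tau> where "\<tau> = \<rho> * ((\<rho> - 1) / (\<rho> + 1))"
  have opt: "opt_descriptor \<kappa> \<rho> = max 0 \<tau>"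
    using r by (simp add: opt_descriptor_eq[OF r] Nuclear \<tau>_def max_mult_distrib_left)
  have Q: "(\<rho> - \<theta>)\<^sup>2 + 4 * \<rho> * \<theta> * (1 / (1 + \<rho>)) = (\<theta> - \<tau>)\<^sup>2 + (\<rho>\<^sup>2 - \<tau>\<^sup>2)" for \<theta>
  proof -
    obtain q where q: "1 / (1 + \<rho>) = q" by blast
    have \<tau>: "\<tau> = \<rho> - 2 * \<rho> * q" using r by (simp add: \<tau>_def q[symmetric] field_simps)
    show ?thesis unfolding q \<tau> by (simp add: power2_eq_square algebra_simps)
  qed
  have loss: "asym_loss \<kappa> \<rho> \<theta> = max \<bar>\<rho> - \<theta>\<bar> (sqrt ((\<theta> - \<tau>)\<^sup>2 + (\<rho>\<^sup>2 - \<tau>\<^sup>2)))" for \<theta>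
    unfolding Nuclear asym_loss_Nuclear[OF r] Q ..
  show ?thesis
  proof (cases "0 \<le> \<tau>")
    case True
    have "(\<rho> - 1) / (\<rho> + 1) \<le> 1" using r by simp
    then have le: "\<tau> \<le> \<rho>" using mult_left_mono[of "(\<rho> - 1) / (\<rho> + 1)" 1 \<rho>] r by (simp add: \<tau>_def)
    \<comment> \<open>At the vertex the radical dominates the other entry of the maximum, so the
      loss there equals the global minimum of the radical.\<close>
    have "(\<rho> - \<tau>) * (\<rho> - \<tau>) \<le> (\<rho> - \<tau>) * (\<rho> + \<tau>)" using le True by (intro mult_left_mono) auto
    then have "\<bar>\<rho> - \<tau>\<bar> \<le> sqrt (\<rho>\<^sup>2 - \<tau>\<^sup>2)"
      by (intro real_le_rsqrt) (simp add: power2_eq_square algebra_simps)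
    then have "asym_loss \<kappa> \<rho> \<tau> = sqrt (\<rho>\<^sup>2 - \<tau>\<^sup>2)" unfolding loss by simp
    also have "\<dots> < sqrt ((\<theta> - \<tau>)\<^sup>2 + (\<rho>\<^sup>2 - \<tau>\<^sup>2))" using ne opt True by simp
    also have "\<dots> \<le> asym_loss \<kappa> \<rho> \<theta>" unfolding loss by simp
    finally show ?thesis using opt True by simp
  next
    case False
    \<comment> \<open>For \<tau> < 0, that is 0 < \<rho> < 1, the minimum sits at the kink 0: to its
      left |\<rho> - \<theta>| exceeds \<rho>, to its right the radical does.\<close>
    then have o: "opt_descriptor \<kappa> \<rho> = 0" "\<theta> \<noteq> 0" using opt ne by auto
    have "asym_loss \<kappa> \<rho> 0 = \<rho>" unfolding loss using r by simp
    also have "\<rho> < asym_loss \<kappa> \<rho> \<theta>"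
    proof (cases "\<theta> < 0")
      case True
      then show ?thesis unfolding loss using r by simp
    next
      case th: False
      have "\<theta> * \<tau> \<le> 0" using th False by (simp add: mult_nonneg_nonpos)
      moreover have "0 < \<theta>\<^sup>2" using o by simp
      ultimately have "\<rho>\<^sup>2 < (\<theta> - \<tau>)\<^sup>2 + (\<rho>\<^sup>2 - \<tau>\<^sup>2)" by (simp add: power2_eq_square algebra_simps)
      then have "\<rho> < sqrt ((\<theta> - \<tau>)\<^sup>2 + (\<rho>\<^sup>2 - \<tau>\<^sup>2))" by (rule real_less_rsqrt)
      then show ?thesis unfolding loss by simp
    qed
    finally show ?thesis using o by simp
  qed
next
  case Operator
  define s where "s = sqrt (1 / (1 + \<rho>))"
  have s2: "s\<^sup>2 = 1 / (1 + \<rho>)" using r by (simp add: s_def)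
  have s: "0 < s" "s \<le> 1" using r by (auto simp: s_def)
  have opt: "opt_descriptor \<kappa> \<rho> = \<rho>" by (simp add: opt_descriptor_eq[OF r] Operator)
  have loss: "asym_loss \<kappa> \<rho> \<theta> = (\<bar>\<rho> - \<theta>\<bar> + sqrt ((\<rho> - \<theta>)\<^sup>2 + 4 * \<rho> * \<theta> * s\<^sup>2)) / 2" for \<theta>
    unfolding Operator asym_loss_Operator[OF r] s2 ..
  have at_opt: "asym_loss \<kappa> \<rho> \<rho> = (2 * \<rho> * s) / 2"
  proof -
    have "4 * \<rho> * \<rho> * s\<^sup>2 = (2 * \<rho> * s)\<^sup>2" by (simp add: power2_eq_square)
    then show ?thesis unfolding loss using r s by simp
  qed
  have "2 * \<rho> * s < \<bar>\<rho> - \<theta>\<bar> + sqrt ((\<rho> - \<theta>)\<^sup>2 + 4 * \<rho> * \<theta> * s\<^sup>2)"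
  proof (cases "\<rho> = 0")
    case True
    then show ?thesis using ne opt by simp
  next
    case False
    then have r0: "0 < \<rho>" using r by simp
    have s1: "s < 1" using r0 by (simp add: s_def)
    show ?thesis
    proof (cases "\<theta> < \<rho>")
      case True
      define t where "t = \<rho> - \<theta>"
      have t: "0 < t" "\<theta> = \<rho> - t" using True by (simp_all add: t_def)
      \<comment> \<open>Below \<rho> the gain is 4 \<rho> s t (1 - s), positive because s < 1; above
        \<rho> the radical does not decrease and |\<rho> - \<theta>| is already positive.\<close>
      have "0 < 4 * \<rho> * s * t * (1 - s)" using r0 s s1 t by (intro mult_pos_pos) auto
      moreover have "t\<^sup>2 + 4 * \<rho> * \<theta> * s\<^sup>2 - (2 * \<rho> * s - t)\<^sup>2 = 4 * \<rho> * s * t * (1 - s)"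
        unfolding t(2) by (simp add: power2_eq_square algebra_simps)
      ultimately have "(2 * \<rho> * s - t)\<^sup>2 < t\<^sup>2 + 4 * \<rho> * \<theta> * s\<^sup>2" by linarith
      then have "2 * \<rho> * s - t < sqrt (t\<^sup>2 + 4 * \<rho> * \<theta> * s\<^sup>2)" by (rule real_less_rsqrt)
      then show ?thesis using True by (simp add: t_def)
    next
      case False
      then have th: "\<rho> < \<theta>" using ne opt by simp
      have "4 * \<rho> * \<rho> * s\<^sup>2 \<le> 4 * \<rho> * \<theta> * s\<^sup>2" using th r0 by (intro mult_right_mono mult_left_mono) auto
      moreover have "(2 * \<rho> * s)\<^sup>2 = 4 * \<rho> * \<rho> * s\<^sup>2" by (simp add: power2_eq_square)
      ultimately have "(2 * \<rho> * s)\<^sup>2 \<le> (\<rho> - \<theta>)\<^sup>2 + 4 * \<rho> * \<theta> * s\<^sup>2"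
        using zero_le_power2[of "\<rho> - \<theta>"] by linarith
      then have "2 * \<rho> * s \<le> sqrt ((\<rho> - \<theta>)\<^sup>2 + 4 * \<rho> * \<theta> * s\<^sup>2)" by (rule real_le_rsqrt)
      then show ?thesis using th by linarith
    qed
  qed
  then show ?thesis using at_opt opt loss[of \<theta>] by simp
qed

lemma min_asym_loss_eq:
  assumes "0 \<le> \<rho>"
  shows "min_asym_loss \<kappa> \<rho> = asym_loss \<kappa> \<rho> (opt_descriptor \<kappa> \<rho>)"
  unfolding min_asym_loss_def
proof (rule cInf_eq_minimum)
  fix x assume "x \<in> range (asym_loss \<kappa> \<rho>)"
  then obtain \<theta> where "x = asym_loss \<kappa> \<rho> \<theta>" by auto
  then show "asym_loss \<kappa> \<rho> (opt_descriptor \<kappa> \<rho>) \<le> x"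
    using asym_loss_unique_minimum[OF assms, of \<theta> \<kappa>] by (cases "\<theta> = opt_descriptor \<kappa> \<rho>") auto
qed simp

text \<open>The argument may be negative along the sequence when \<rho> = 0. The formula for
  positive arguments vanishes at 0, so the truncated descriptor is that formula after max 0, which
  is continuous.\<close>

lemma opt_descriptor_tendsto:
  assumes "x \<longlonglongrightarrow> \<rho>" "0 \<le> \<rho>"
  shows "(\<lambda>n. opt_descriptor \<kappa> (x n)) \<longlonglongrightarrow> opt_descriptor \<kappa> \<rho>"
proof -
  have eq: "opt_descriptor \<kappa> y = opt_descriptor_pos \<kappa> (max 0 y)" for y
    by (cases \<kappa>; cases "0 < y") (simp_all add: opt_descriptor_def max_def)
  have "(\<lambda>n. opt_descriptor_pos \<kappa> (y n)) \<longlonglongrightarrow> opt_descriptor_pos \<kappa> \<rho>" if "y \<longlonglongrightarrow> \<rho>" for y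
    by (cases \<kappa>) (use assms(2) that in \<open>auto intro!: tendsto_intros\<close>)
  moreover have "(\<lambda>n. max 0 (x n)) \<longlonglongrightarrow> max 0 \<rho>" by (intro tendsto_intros assms)
  ultimately show ?thesis unfolding eq using assms(2) by (simp add: max_def)
qed

section \<open>Convergence of the matrix norms\<close>

lemma gram_core_cong:
  assumes "\<And>k. k < m \<Longrightarrow> D k = D' k" "\<And>k l. k < m \<Longrightarrow> l < m \<Longrightarrow> g k l = g' k l"
  shows "gram_core m D g = gram_core m D' g'"
  unfolding gram_core_def by (rule eq_matI) (auto intro!: sum.cong simp: assms)

text \<open>The difference is a weighted sum of 2 r rank-one terms whose Gram matrix converges to
  one that is block diagonal with r planes. Frobenius and nuclear norms then add over the planes,
  while a single plane has an explicit operator norm.\<close>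

lemma mat_norm_spike_difference_tendsto:
  fixes u v :: "nat \<Rightarrow> nat \<Rightarrow> nat \<Rightarrow> real" and a \<theta> :: "nat \<Rightarrow> nat \<Rightarrow> real"
  assumes u: "\<And>n b c. 0 < n \<Longrightarrow> b < r \<Longrightarrow> c < r \<Longrightarrow> dot (d n) (u n b) (u n c) = (if b = c then 1 else 0)"
    and v: "\<And>n b c. 0 < n \<Longrightarrow> b < r \<Longrightarrow> c < r \<Longrightarrow> dot (d n) (v n b) (v n c) = (if b = c then 1 else 0)"
    and uv: "\<And>b c. b < r \<Longrightarrow> c < r \<Longrightarrow>
      (\<lambda>n. (dot (d n) (u n b) (v n c))\<^sup>2) \<longlonglongrightarrow> (if b = c then \<rho> c / (1 + \<rho> c) else 0)"
    and \<rho>: "\<And>b. b < r \<Longrightarrow> 0 \<le> \<rho> b"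
    and a: "\<And>b. b < r \<Longrightarrow> (\<lambda>n. a n b) \<longlonglongrightarrow> \<rho> b"
    and \<theta>: "\<And>b. b < r \<Longrightarrow> (\<lambda>n. \<theta> n b) \<longlonglongrightarrow> t b"
    and \<kappa>: "\<kappa> = Frobenius \<or> \<kappa> = Nuclear \<or> (\<kappa> = Operator \<and> r = 1)"
  shows "(\<lambda>n. mat_norm \<kappa> (mat (d n) (d n) (\<lambda>(i, j). \<Sum>b<r. a n b * u n b i * u n b j - \<theta> n b * v n b i * v n b j)))
    \<longlonglongrightarrow> aggregate \<kappa> r (\<lambda>b. asym_loss \<kappa> (\<rho> b) (t b))"
proof -
  text \<open>The eigenvectors are determined up to sign only; orient \<open>v\<close> along \<open>u\<close>.\<close>
  define \<sigma> where "\<sigma> n b = (if dot (d n) (u n b) (v n b) < 0 then -1 else 1 :: real)" for n b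
  \<comment> \<open>Population and sample directions are interleaved, population at even and sample
    at odd positions with negated weight, so that plane b occupies 2 b and 2 b + 1.\<close>
  define D where "D n k = (if even k then a n (k div 2) else - \<theta> n (k div 2))" for n k
  define f where "f n k = (if even k then u n (k div 2) else (\<lambda>i. \<sigma> n (k div 2) * v n (k div 2) i))" for n k
  define D' where "D' k = (if even k then \<rho> (k div 2) else - t (k div 2))" for k
  define gg where "gg b i j = (if i = j then 1 else sqrt (\<rho> b / (1 + \<rho> b)))" for b and i j :: nat
  define g where "g k l = (if k div 2 = l div 2 then gg (k div 2) (k mod 2) (l mod 2) else 0)" for k l
  have \<sigma>2: "\<sigma> n b * \<sigma> n b = 1" for n b by (simp add: \<sigma>_def)
  have sum2: "(\<Sum>i<2. h i) = h 0 + h 1" for h :: "nat \<Rightarrow> real" by (simp add: numeral_2_eq_2)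
  have pair: "(2 * b + 1) div 2 = b" "even (2 * b)" "odd (2 * b + 1)" "(2 * b) div 2 = b" for b :: nat by simp_all
  have form: "mat (d n) (d n) (\<lambda>(i, j). \<Sum>b<r. a n b * u n b i * u n b j - \<theta> n b * v n b i * v n b j)
      = rank_form (d n) (2 * r) (D n) (f n)" for n
  proof -
    have "(\<Sum>k<2 * r. D n k * f n k i * f n k j) = (\<Sum>b<r. a n b * u n b i * u n b j - \<theta> n b * v n b i * v n b j)" for i j
    proof -
      have "\<theta> n b * (\<sigma> n b * v n b i) * (\<sigma> n b * v n b j) = \<theta> n b * v n b i * v n b j" for b
      proof -
        have "\<theta> n b * (\<sigma> n b * v n b i) * (\<sigma> n b * v n b j) = (\<sigma> n b * \<sigma> n b) * (\<theta> n b * v n b i * v n b j)"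
          by (simp only: mult_ac)
        then show ?thesis by (simp add: \<sigma>2)
      qed
      then show ?thesis
        unfolding sum_pairs sum2 by (intro sum.cong refl) (simp add: D_def f_def)
    qed
    then show ?thesis by (simp add: rank_form_def)
  qed
  have Dlim: "(\<lambda>n. D n k) \<longlonglongrightarrow> D' k" if "k < 2 * r" for k
    using a[of "k div 2"] tendsto_minus[OF \<theta>[of "k div 2"]] that
    by (auto simp: D_def D'_def)
  have uv0: "(\<lambda>n. dot (d n) (u n b) (\<lambda>i. \<sigma> n c * v n c i)) \<longlonglongrightarrow> (if b = c then sqrt (\<rho> b / (1 + \<rho> b)) else 0)"
    if bc: "b < r" "c < r" for b c
  proof (cases "b = c")
    case True
    have "dot (d n) (u n b) (\<lambda>i. \<sigma> n c * v n c i) = sqrt ((dot (d n) (u n b) (v n c))\<^sup>2)" for n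
      unfolding dot_scale_right True by (simp add: \<sigma>_def)
    then show ?thesis using tendsto_real_sqrt[OF uv[OF bc]] True by simp
  next
    case False
    have "(\<lambda>n. sqrt ((dot (d n) (u n b) (v n c))\<^sup>2)) \<longlonglongrightarrow> 0"
      using tendsto_real_sqrt[OF uv[OF bc]] False by simp
    moreover have "\<bar>\<sigma> n c\<bar> = 1" for n by (simp add: \<sigma>_def)
    ultimately have "(\<lambda>n. \<bar>\<sigma> n c * dot (d n) (u n b) (v n c)\<bar>) \<longlonglongrightarrow> 0"
      by (simp add: abs_mult)
    then show ?thesis
      unfolding dot_scale_right using False by (simp add: tendsto_rabs_zero_iff)
  qed
  \<comment> \<open>Orthonormality is assumed for positive n only, so the constant Gram entries are
    reached eventually.\<close>
  have ev: "\<forall>\<^sub>F n::nat in sequentially. 0 < n" by (rule eventually_gt_at_top)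
  have glim: "(\<lambda>n. dot (d n) (f n k) (f n l)) \<longlonglongrightarrow> g k l" if kl: "k < 2 * r" "l < 2 * r" for k l
  proof -
    have b: "k div 2 < r" "l div 2 < r" using kl by auto
    have eq: "k = l \<longleftrightarrow> k div 2 = l div 2 \<and> k mod 2 = l mod 2" by (metis div_mult_mod_eq)
    consider "even k" "even l" | "even k" "odd l" | "odd k" "even l" | "odd k" "odd l" by blast
    then show ?thesis
    proof cases
      case 1
      then have "g k l = (if k div 2 = l div 2 then 1 else 0)" by (simp add: g_def gg_def even_iff_mod_2_eq_zero)
      then have "\<forall>\<^sub>F n in sequentially. g k l = dot (d n) (f n k) (f n l)"
        using 1 u[OF _ b] by (auto intro!: eventually_mono[OF ev] simp: f_def)
      then show ?thesis by (rule Lim_transform_eventually[OF tendsto_const])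
    next
      case 2
      then have "g k l = (if k div 2 = l div 2 then sqrt (\<rho> (k div 2) / (1 + \<rho> (k div 2))) else 0)"
        by (simp add: g_def gg_def even_iff_mod_2_eq_zero odd_iff_mod_2_eq_one)
      then show ?thesis using uv0[OF b] 2 by (simp add: f_def)
    next
      case 3
      then have "g k l = (if l div 2 = k div 2 then sqrt (\<rho> (l div 2) / (1 + \<rho> (l div 2))) else 0)"
        by (simp add: g_def gg_def even_iff_mod_2_eq_zero odd_iff_mod_2_eq_one)
      then show ?thesis using uv0[OF b(2,1)] 3 by (simp add: f_def dot_commute[of _ _ "u _ _"])
    next
      case 4
      then have "g k l = (if k div 2 = l div 2 then 1 else 0)" by (simp add: g_def gg_def odd_iff_mod_2_eq_one)
      then have "\<forall>\<^sub>F n in sequentially. g k l = dot (d n) (f n k) (f n l)"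
        using 4 v[OF _ b] by (auto intro!: eventually_mono[OF ev] simp: f_def dot_scale_left dot_scale_right \<sigma>2 mult.assoc[symmetric])
      then show ?thesis by (rule Lim_transform_eventually[OF tendsto_const])
    qed
  qed
  have gg2: "gg b i j = dot 2 (plane_pair (\<rho> b) i) (plane_pair (\<rho> b) j)" if "b < r" "i < 2" "j < 2" for b i j
    using plane_pair_gram[OF \<rho>[OF that(1)] that(2,3)] by (simp add: gg_def)
  have D2: "D' (2 * b + i) = (if i = 0 then \<rho> b else - t b)" if "i < 2" for b i
    using that by (auto simp: D'_def less_2_cases_iff)
  show ?thesis
    unfolding form using \<kappa>
  proof (elim disjE conjE)
    assume \<kappa>: "\<kappa> = Nuclear"
    have "sqrt_root_sum (char_poly (gram_core (2 * r) D' g))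
        = (\<Sum>b<r. sqrt_root_sum (char_poly (gram_core 2 (\<lambda>i. D' (2 * b + i)) (gg b))))"
      by (rule gram_core_block) (simp add: g_def)
    also have "\<dots> = (\<Sum>b<r. asym_loss Nuclear (\<rho> b) (t b))"
    proof (rule sum.cong[OF refl])
      fix b assume "b \<in> {..<r}"
      then have "gram_core 2 (\<lambda>i. D' (2 * b + i)) (gg b)
          = gram_core 2 (\<lambda>k. if k = 0 then \<rho> b else - t b) (\<lambda>k l. dot 2 (plane_pair (\<rho> b) k) (plane_pair (\<rho> b) l))"
        by (intro gram_core_cong) (simp_all add: D2 gg2)
      then show "sqrt_root_sum (char_poly (gram_core 2 (\<lambda>i. D' (2 * b + i)) (gg b))) = asym_loss Nuclear (\<rho> b) (t b)"
        by (simp add: asym_loss_rank_form nuclear_norm_rank_form)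
    qed
    finally show "(\<lambda>n. mat_norm \<kappa> (rank_form (d n) (2 * r) (D n) (f n))) \<longlonglongrightarrow> aggregate \<kappa> r (\<lambda>b. asym_loss \<kappa> (\<rho> b) (t b))"
      using nuclear_norm_rank_form_tendsto[of "2 * r" D D' d f g] Dlim glim by (simp add: \<kappa>)
  next
    assume \<kappa>: "\<kappa> = Frobenius"
    have "(\<Sum>k<2 * r. \<Sum>l<2 * r. D' k * D' l * (g k l)\<^sup>2) = (\<Sum>b<r. (asym_loss Frobenius (\<rho> b) (t b))\<^sup>2)"
      unfolding sum_pairs[of _ r]
    proof (rule sum.cong[OF refl])
      fix b assume b: "b \<in> {..<r}"
      have dm: "(2 * c + i) div 2 = c" "(2 * c + i) mod 2 = i" if "i < 2" for c i :: nat using that by auto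
      have "(\<Sum>i<2. \<Sum>c<r. \<Sum>j<2. D' (2 * b + i) * D' (2 * c + j) * (g (2 * b + i) (2 * c + j))\<^sup>2)
          = (\<Sum>i<2. \<Sum>c<r. if c = b then \<Sum>j<2. D' (2 * b + i) * D' (2 * b + j) * (gg b i j)\<^sup>2 else 0)"
        by (rule sum.cong[OF refl], rule sum.cong[OF refl]) (auto simp: g_def dm intro!: sum.cong sum.neutral)
      also have "\<dots> = (\<Sum>i<2. \<Sum>j<2. D' (2 * b + i) * D' (2 * b + j) * (gg b i j)\<^sup>2)"
        by (rule sum.cong[OF refl], subst sum.delta) (use b in auto)
      also have "\<dots> = (\<Sum>i<2. \<Sum>j<2. (if i = 0 then \<rho> b else - t b) * (if j = 0 then \<rho> b else - t b)
          * (dot 2 (plane_pair (\<rho> b) i) (plane_pair (\<rho> b) j))\<^sup>2)"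
        using b by (intro sum.cong refl) (simp add: D2 gg2)
      also have "\<dots> = (asym_loss Frobenius (\<rho> b) (t b))\<^sup>2"
      proof -
        have "0 \<le> asym_loss Frobenius (\<rho> b) (t b)"
          by (simp add: asym_loss_def frobenius_norm_def Let_def sum_nonneg)
        then show ?thesis
          by (simp add: asym_loss_rank_form frobenius_norm_rank_form real_sqrt_ge_0_iff)
      qed
      finally show "(\<Sum>i<2. \<Sum>c<r. \<Sum>j<2. D' (2 * b + i) * D' (2 * c + j) * (g (2 * b + i) (2 * c + j))\<^sup>2)
          = (asym_loss Frobenius (\<rho> b) (t b))\<^sup>2" .
    qed
    moreover have "(\<lambda>n. sqrt (\<Sum>k<2 * r. \<Sum>l<2 * r. D n k * D n l * (dot (d n) (f n k) (f n l))\<^sup>2))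
        \<longlonglongrightarrow> sqrt (\<Sum>k<2 * r. \<Sum>l<2 * r. D' k * D' l * (g k l)\<^sup>2)"
      by (intro tendsto_intros Dlim glim) auto
    ultimately show "(\<lambda>n. mat_norm \<kappa> (rank_form (d n) (2 * r) (D n) (f n))) \<longlonglongrightarrow> aggregate \<kappa> r (\<lambda>b. asym_loss \<kappa> (\<rho> b) (t b))"
      by (simp add: \<kappa> frobenius_norm_rank_form)
  next
    assume \<kappa>: "\<kappa> = Operator" and r: "r = 1"
    have \<rho>0: "0 \<le> \<rho> 0" using \<rho> r by simp
    define C where "C n = (dot (d n) (f n 0) (f n 1))\<^sup>2" for n
    have C: "C \<longlonglongrightarrow> \<rho> 0 / (1 + \<rho> 0)"
      using tendsto_power[OF glim[of 0 1], of 2] \<rho>0 r by (simp add: C_def[abs_def] g_def gg_def)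
    have "\<rho> 0 / (1 + \<rho> 0) < 1" using \<rho>0 by simp
    \<comment> \<open>The closed form for two directions needs them not to be parallel; the limiting
      squared cosine \<rho> / (1 + \<rho>) < 1 ensures this eventually.\<close>
    then have "\<forall>\<^sub>F n in sequentially. C n < 1" by (rule order_tendstoD(2)[OF C])
    then have "\<forall>\<^sub>F n in sequentially. (\<bar>D n 0 + D n 1\<bar> + sqrt ((D n 0 + D n 1)\<^sup>2 - 4 * D n 0 * D n 1 * (1 - C n))) / 2
        = operator_norm (rank_form (d n) 2 (D n) (f n))"
      using ev
    proof eventually_elim
      case (elim n)
      have "dot (d n) (f n 0) (f n 0) = 1" "dot (d n) (f n 1) (f n 1) = 1"
        using elim(2) u[of n 0 0] v[of n 0 0] r
        by (simp_all add: f_def dot_scale_left dot_scale_right \<sigma>2 mult.assoc[symmetric])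
      then show ?case using operator_norm_rank_two[of "d n" "f n" "D n"] elim(1) by (simp add: C_def)
    qed
    moreover have "(\<lambda>n. (\<bar>D n 0 + D n 1\<bar> + sqrt ((D n 0 + D n 1)\<^sup>2 - 4 * D n 0 * D n 1 * (1 - C n))) / 2)
        \<longlonglongrightarrow> (\<bar>D' 0 + D' 1\<bar> + sqrt ((D' 0 + D' 1)\<^sup>2 - 4 * D' 0 * D' 1 * (1 - \<rho> 0 / (1 + \<rho> 0)))) / 2"
      using r by (intro tendsto_intros C Dlim) auto
    moreover have "(\<bar>D' 0 + D' 1\<bar> + sqrt ((D' 0 + D' 1)\<^sup>2 - 4 * D' 0 * D' 1 * (1 - \<rho> 0 / (1 + \<rho> 0)))) / 2
        = asym_loss Operator (\<rho> 0) (t 0)"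
    proof -
      have "1 - \<rho> 0 / (1 + \<rho> 0) = 1 / (1 + \<rho> 0)" using \<rho>0 by (simp add: field_simps)
      then show ?thesis unfolding asym_loss_Operator[OF \<rho>0] by (simp add: D'_def)
    qed
    ultimately have "(\<lambda>n. operator_norm (rank_form (d n) 2 (D n) (f n))) \<longlonglongrightarrow> asym_loss Operator (\<rho> 0) (t 0)"
      using Lim_transform_eventually by fastforce
    then show "(\<lambda>n. mat_norm \<kappa> (rank_form (d n) (2 * r) (D n) (f n))) \<longlonglongrightarrow> aggregate \<kappa> r (\<lambda>b. asym_loss \<kappa> (\<rho> b) (t b))"
      by (simp add: \<kappa> r lessThan_Suc)
  qed
qed

section \<open>Admissibility of the optimal rules\<close>

text \<open>Orthonormality says V^T V = I; as V is square, V V^T = I follows. This is the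
  completeness relation, and inserting it into A v_a = lam_a v_a gives the spectral
  decomposition.\<close>

lemma eigensystem_spectral:
  assumes E: "eigensystem d A lam v"
  shows "orthobasis d (\<lambda>k i. v k $ i)"
    and "\<And>i j. i < d \<Longrightarrow> j < d \<Longrightarrow> A $$ (i, j) = (\<Sum>a<d. lam a * v a $ i * v a $ j)"
proof -
  have A: "A \<in> carrier_mat d d" using E by (simp add: eigensystem_def)
  have carr: "v a \<in> carrier_vec d" and Av: "A *\<^sub>v v a = lam a \<cdot>\<^sub>v v a" if "a < d" for a
    using E that A by (auto simp: eigensystem_def eigenvector_def)
  have on: "(\<Sum>i<d. v a $ i * v b $ i) = (if a = b then 1 else 0)" if "a < d" "b < d" for a b
  proof -
    have "v a \<bullet> v b = (if a = b then 1 else 0)" using E that by (simp add: eigensystem_def)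
    then show ?thesis using carr[OF that(2)] by (simp add: scalar_prod_def lessThan_atLeast0)
  qed
  define V where "V = mat d d (\<lambda>(i, k). v k $ i)"
  have V: "V \<in> carrier_mat d d" "transpose_mat V \<in> carrier_mat d d" by (simp_all add: V_def)
  have "transpose_mat V * V = 1\<^sub>m d"
    by (rule eq_matI) (simp_all add: V_def scalar_prod_def on[unfolded lessThan_atLeast0])
  then have VV: "V * transpose_mat V = 1\<^sub>m d"
    by (rule mat_mult_left_right_inverse[OF V(2,1)])
  have complete: "(\<Sum>k<d. v k $ i * v k $ j) = (if i = j then 1 else 0)" if "i < d" "j < d" for i j
  proof -
    have "(V * transpose_mat V) $$ (i, j) = (\<Sum>k<d. v k $ i * v k $ j)"
      using that by (simp add: V_def scalar_prod_def lessThan_atLeast0)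
    then show ?thesis using VV that by simp
  qed
  show "orthobasis d (\<lambda>k i. v k $ i)"
    using on complete by (simp add: orthobasis_def dot_def)
  fix i j assume ij: "i < d" "j < d"
  have "(\<Sum>a<d. lam a * v a $ i * v a $ j) = (\<Sum>a<d. (\<Sum>k<d. A $$ (i, k) * v a $ k) * v a $ j)"
  proof (rule sum.cong[OF refl])
    fix a assume a: "a \<in> {..<d}"
    have "(A *\<^sub>v v a) $ i = (\<Sum>k<d. A $$ (i, k) * v a $ k)"
      using A carr[of a] a ij by (simp add: scalar_prod_def lessThan_atLeast0)
    moreover have "(A *\<^sub>v v a) $ i = lam a * v a $ i"
      using Av[of a] carr[of a] a ij by simp
    ultimately show "lam a * v a $ i * v a $ j = (\<Sum>k<d. A $$ (i, k) * v a $ k) * v a $ j" by simp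
  qed
  also have "\<dots> = (\<Sum>a<d. \<Sum>k<d. A $$ (i, k) * (v a $ k * v a $ j))"
    by (simp add: sum_distrib_right mult.assoc)
  also have "\<dots> = (\<Sum>k<d. A $$ (i, k) * (\<Sum>a<d. v a $ k * v a $ j))"
    by (subst sum.swap) (simp add: sum_distrib_left)
  also have "\<dots> = (\<Sum>k<d. A $$ (i, k) * (if k = j then 1 else 0))"
    using ij by (intro sum.cong refl) (simp add: complete)
  also have "\<dots> = A $$ (i, j)" using ij by (simp add: if_distrib[of "\<lambda>c. _ * c"] cong: if_cong)
  finally show "A $$ (i, j) = (\<Sum>a<d. lam a * v a $ i * v a $ j)" ..
qed

text \<open>The functional b^T Z y is the sum of y_i <a, x_i> over the observations, with a = sum of
  b_k / sqrt (e_k) * u_k. The weights are chosen so that a^T S a = |b|^2, and independence over i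
  adds the variances.\<close>

lemma (in prob_space) spiked_model_white_noise:
  assumes model: "spiked_model M n d r ell S x"
    and u: "eigensystem d S e u" and e: "\<And>k. 1 \<le> e k"
  shows "white_noise M n d (\<lambda>k i \<omega>. dot d (\<lambda>j. u k $ j) (x i \<omega>) / sqrt (e k))"
  unfolding white_noise_def
proof (intro conjI allI impI)
  have indep: "indep_vars (\<lambda>_. PiM {..<d} (\<lambda>_. borel)) x {..<n}"
    and normal: "\<And>i. i < n \<Longrightarrow> normal_vector M d S (x i)"
    using model by (auto simp: spiked_model_def)
  have xm: "(\<lambda>\<omega>. x i \<omega> j) \<in> borel_measurable M" if "i < n" "j < d" for i j
  proof -
    have "x i \<in> measurable M (PiM {..<d} (\<lambda>_. borel))" using normal[OF that(1)] by (simp add: normal_vector_def)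
    then show ?thesis
      by (rule measurable_compose) (rule measurable_component_singleton, use that in simp)
  qed
  have e_pos: "0 < e k" for k using e[of k] by linarith
  note ub = eigensystem_spectral[OF u]
  have on: "dot d (\<lambda>j. u k $ j) (\<lambda>j. u l $ j) = (if k = l then 1 else 0)" if "k < d" "l < d" for k l
    using ub(1) that by (simp add: orthobasis_def)
  show "(\<lambda>\<omega>. dot d (\<lambda>j. u k $ j) (x i \<omega>) / sqrt (e k)) \<in> borel_measurable M" if "k < d" "i < n" for k i
    unfolding dot_def using xm that by (intro borel_measurable_divide borel_measurable_sum borel_measurable_times) auto
  fix b y :: "nat \<Rightarrow> real"
  assume b: "\<exists>k<d. b k \<noteq> 0" and y: "\<exists>i<n. y i \<noteq> 0"
  define a where "a = (\<lambda>j. \<Sum>k<d. (b k / sqrt (e k)) * u k $ j)"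
  define B where "B = (\<Sum>k<d. (b k)\<^sup>2)"
  have B: "0 < B" using b by (auto simp: B_def intro!: sum_pos2)
  have ua: "dot d (\<lambda>j. u l $ j) a = b l / sqrt (e l)" if "l < d" for l
  proof -
    have "dot d (\<lambda>j. u l $ j) a = (\<Sum>k<d. b k / sqrt (e k) * (if l = k then 1 else 0))"
      unfolding a_def dot_sum_right dot_scale_right using that by (intro sum.cong refl) (simp add: on)
    then show ?thesis using that by (simp add: if_distrib[of "\<lambda>c. _ * c"] cong: if_cong)
  qed
  have a0: "\<exists>j<d. a j \<noteq> 0"
  proof (rule ccontr)
    assume "\<not> ?thesis"
    then have "dot d (\<lambda>j. u l $ j) a = 0" for l by (simp add: dot_def)
    then show False using b ua e_pos by (metis divide_eq_0_iff less_numeral_extra(3) real_sqrt_gt_0_iff)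
  qed
  have quad: "(\<Sum>j<d. \<Sum>k<d. (c * a j) * S $$ (j, k) * (c * a k)) = c\<^sup>2 * B" for c
  proof -
    have "(\<Sum>j<d. \<Sum>k<d. (c * a j) * S $$ (j, k) * (c * a k))
        = (\<Sum>j<d. \<Sum>k<d. \<Sum>l<d. c\<^sup>2 * (e l * ((u l $ j * a j) * (u l $ k * a k))))"
      by (intro sum.cong refl) (simp add: ub(2) sum_distrib_left sum_distrib_right power2_eq_square mult_ac)
    also have "\<dots> = (\<Sum>j<d. \<Sum>l<d. \<Sum>k<d. c\<^sup>2 * (e l * ((u l $ j * a j) * (u l $ k * a k))))"
      by (rule sum.cong[OF refl], rule sum.swap)
    also have "\<dots> = (\<Sum>l<d. \<Sum>j<d. \<Sum>k<d. c\<^sup>2 * (e l * ((u l $ j * a j) * (u l $ k * a k))))"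
      by (rule sum.swap)
    also have "\<dots> = (\<Sum>l<d. c\<^sup>2 * (e l * (dot d (\<lambda>j. u l $ j) a)\<^sup>2))"
      unfolding dot_def power2_eq_square[of "sum _ _"] sum_product
      by (simp only: sum_distrib_left)
    also have "\<dots> = (\<Sum>l<d. c\<^sup>2 * (b l)\<^sup>2)"
      using e_pos by (intro sum.cong refl) (simp add: ua power_divide less_imp_le less_imp_neq[symmetric])
    finally show ?thesis by (simp add: B_def sum_distrib_left)
  qed
  \<comment> \<open>Observations with y i = 0 contribute a degenerate summand without density, so
    the sum of independent normals runs over the others.\<close>
  define I where "I = {i. i < n \<and> y i \<noteq> 0}"
  have I: "finite I" "I \<noteq> {}" "I \<subseteq> {..<n}" using y by (auto simp: I_def)
  define Y where "Y i w = (\<Sum>j<d. (y i * a j) * w j)" for i and w :: "nat \<Rightarrow> real"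
  have "indep_vars (\<lambda>_. borel) (\<lambda>i \<omega>. Y i (x i \<omega>)) I"
  proof (rule indep_vars_compose2[OF indep_vars_subset[OF indep I(3)]])
    show "Y i \<in> borel_measurable (PiM {..<d} (\<lambda>_. borel))" for i
      unfolding Y_def by measurable
  qed
  moreover have "distributed M lborel (\<lambda>\<omega>. Y i (x i \<omega>)) (normal_density 0 (\<bar>y i\<bar> * sqrt B))" if "i \<in> I" for i
  proof -
    have "\<exists>j<d. y i * a j \<noteq> 0" using a0 that by (auto simp: I_def)
    then have "distributed M lborel (\<lambda>\<omega>. \<Sum>j<d. (y i * a j) * x i \<omega> j)
        (normal_density 0 (sqrt (\<Sum>j<d. \<Sum>k<d. (y i * a j) * S $$ (j, k) * (y i * a k))))"
      using normal[of i] that by (simp only: normal_vector_def I_def mem_Collect_eq)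
    then show ?thesis unfolding quad Y_def by (simp add: real_sqrt_mult)
  qed
  ultimately have "distributed M lborel (\<lambda>\<omega>. \<Sum>i\<in>I. Y i (x i \<omega>))
      (normal_density (\<Sum>i\<in>I. 0) (sqrt (\<Sum>i\<in>I. (\<bar>y i\<bar> * sqrt B)\<^sup>2)))"
    using B by (intro sum_indep_normal I) (auto simp: I_def)
  moreover have "(\<Sum>i\<in>I. (\<bar>y i\<bar> * sqrt B)\<^sup>2) = B * (\<Sum>i<n. (y i)\<^sup>2)"
  proof -
    have "(\<Sum>i\<in>I. (y i)\<^sup>2) = (\<Sum>i<n. (y i)\<^sup>2)"
      by (rule sum.mono_neutral_left) (use I in \<open>auto simp: I_def\<close>)
    then show ?thesis using B by (simp add: power_mult_distrib sum_distrib_left[symmetric] mult.commute)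
  qed
  moreover have "(\<Sum>i\<in>I. Y i (x i \<omega>)) = (\<Sum>k<d. \<Sum>i<n. b k * y i * (dot d (\<lambda>j. u k $ j) (x i \<omega>) / sqrt (e k)))" for \<omega>
  proof -
    have Y: "Y i (x i \<omega>) = (\<Sum>k<d. b k * y i * (dot d (\<lambda>j. u k $ j) (x i \<omega>) / sqrt (e k)))" for i
    proof -
      have "Y i (x i \<omega>) = y i * dot d a (x i \<omega>)"
        by (simp add: Y_def dot_def sum_distrib_left mult.assoc)
      also have "dot d a (x i \<omega>) = (\<Sum>k<d. b k / sqrt (e k) * dot d (\<lambda>j. u k $ j) (x i \<omega>))"
        unfolding a_def by (simp only: dot_sum_left dot_scale_left)
      finally show ?thesis by (simp add: sum_distrib_left mult_ac)
    qed
    have "(\<Sum>i\<in>I. Y i (x i \<omega>)) = (\<Sum>i<n. Y i (x i \<omega>))"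
      by (rule sum.mono_neutral_left) (use I in \<open>auto simp: I_def Y_def\<close>)
    then show ?thesis unfolding Y by (simp only: sum.swap[of _ "{..<d}" "{..<n}"])
  qed
  ultimately show "distributed M lborel (\<lambda>\<omega>. \<Sum>k<d. \<Sum>i<n. b k * y i * (dot d (\<lambda>j. u k $ j) (x i \<omega>) / sqrt (e k)))
      (normal_density 0 (sqrt ((\<Sum>k<d. (b k)\<^sup>2) * (\<Sum>i<n. (y i)\<^sup>2))))"
    by (simp add: B_def)
qed

section \<open>Homogeneity of the norms\<close>

lemma nuclear_norm_smult:
  assumes A: "A \<in> carrier_mat d d" and c: "0 < c"
  shows "nuclear_norm (c \<cdot>\<^sub>m A) = c * nuclear_norm A"
proof -
  let ?G = "transpose_mat A * A" and ?H = "transpose_mat (c \<cdot>\<^sub>m A) * (c \<cdot>\<^sub>m A)"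
  have G: "?G \<in> carrier_mat d d" using A by auto
  have H: "?H = c\<^sup>2 \<cdot>\<^sub>m ?G"
    by (rule eq_matI) (use A in \<open>auto simp: scalar_prod_def sum_distrib_left power2_eq_square mult_ac\<close>)
  then have Hc: "?H \<in> carrier_mat d d" using G by simp
  obtain as where as: "char_poly ?G = (\<Prod>a\<leftarrow>as. [:- a, 1:])" "length as = d" "\<forall>a\<in>set as. 0 \<le> a"
    using char_poly_real_split[OF G nonneg_roots_char_poly_gram[OF A]] by blast
  have "poly (char_poly ?H) x = poly (\<Prod>a\<leftarrow>map (\<lambda>a. c\<^sup>2 * a) as. [:- a, 1:]) x" for x
  proof -
    have "- char_matrix ?H x = c\<^sup>2 \<cdot>\<^sub>m (- char_matrix ?G (x / c\<^sup>2))"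
      unfolding H using G c by (intro eq_matI) (auto simp: char_matrix_def field_simps simp del: index_mult_mat)
    then have "poly (char_poly ?H) x = (c\<^sup>2) ^ d * poly (char_poly ?G) (x / c\<^sup>2)"
      unfolding char_poly_matrix[OF Hc] char_poly_matrix[OF G] using A by (simp add: char_matrix_def)
    also have "\<dots> = (\<Prod>i<d. c\<^sup>2 * (x / c\<^sup>2 - as ! i))"
      unfolding as(1) poly_linear_factors as(2) by (simp add: prod.distrib)
    also have "\<dots> = (\<Prod>i<d. x - c\<^sup>2 * as ! i)"
      using c by (intro prod.cong refl) (simp add: right_diff_distrib)
    also have "\<dots> = poly (\<Prod>a\<leftarrow>map (\<lambda>a. c\<^sup>2 * a) as. [:- a, 1:]) x"
      unfolding poly_linear_factors using as(2) by simp
    finally show ?thesis .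
  qed
  then have "char_poly ?H = (\<Prod>a\<leftarrow>map (\<lambda>a. c\<^sup>2 * a) as. [:- a, 1:])" by (intro poly_ext)
  then have "nuclear_norm (c \<cdot>\<^sub>m A) = (\<Sum>a\<leftarrow>map (\<lambda>a. c\<^sup>2 * a) as. sqrt a)"
    unfolding nuclear_norm_def sqrt_root_sum_def[symmetric] by (simp only: sqrt_root_sum_linear_factors)
  also have "\<dots> = c * (\<Sum>a\<leftarrow>as. sqrt a)"
    using c by (simp add: o_def real_sqrt_mult sum_list_const_mult)
  also have "(\<Sum>a\<leftarrow>as. sqrt a) = nuclear_norm A"
    unfolding nuclear_norm_def sqrt_root_sum_def[symmetric] as(1) sqrt_root_sum_linear_factors ..
  finally show ?thesis .
qed

lemma mat_norm_smult:
  assumes A: "A \<in> carrier_mat d d" and c: "0 < c"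
  shows "mat_norm \<kappa> (c \<cdot>\<^sub>m A) = c * mat_norm \<kappa> A"
proof (cases \<kappa>)
  case Frobenius
  have "(\<Sum>i<d. \<Sum>j<d. (c * A $$ (i, j))\<^sup>2) = c\<^sup>2 * (\<Sum>i<d. \<Sum>j<d. (A $$ (i, j))\<^sup>2)"
    by (simp add: power_mult_distrib sum_distrib_left)
  then show ?thesis using A c by (simp add: Frobenius frobenius_norm_def real_sqrt_mult)
next
  case Nuclear
  then show ?thesis using nuclear_norm_smult[OF assms] by simp
next
  case Operator
  let ?X = "{x \<in> carrier_vec d. x \<bullet> x \<le> (1::real)}"
  let ?f = "\<lambda>x. sqrt ((A *\<^sub>v x) \<bullet> (A *\<^sub>v x))"
  have f: "sqrt (((c \<cdot>\<^sub>m A) *\<^sub>v x) \<bullet> ((c \<cdot>\<^sub>m A) *\<^sub>v x)) = c * ?f x" if "x \<in> carrier_vec d" for x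
  proof -
    have "(c \<cdot>\<^sub>m A) *\<^sub>v x = c \<cdot>\<^sub>v (A *\<^sub>v x)"
      by (rule eq_vecI) (use A that in \<open>auto simp: scalar_prod_def sum_distrib_left mult.assoc\<close>)
    then have "((c \<cdot>\<^sub>m A) *\<^sub>v x) \<bullet> ((c \<cdot>\<^sub>m A) *\<^sub>v x) = c\<^sup>2 * ((A *\<^sub>v x) \<bullet> (A *\<^sub>v x))"
      by (simp add: power2_eq_square)
    then show ?thesis using c by (simp add: real_sqrt_mult)
  qed
  \<comment> \<open>A supremum of reals is only well behaved for bounded sets; Cauchy-Schwarz in
    each row bounds it by the Frobenius norm.\<close>
  have bdd: "bdd_above (?f ` ?X)"
  proof (rule bdd_aboveI2)
    fix x :: "real vec" assume "x \<in> ?X"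
    then have x: "x \<in> carrier_vec d" "(\<Sum>j<d. (x $ j)\<^sup>2) \<le> 1"
      by (auto simp: scalar_prod_def lessThan_atLeast0 power2_eq_square)
    have "(A *\<^sub>v x) \<bullet> (A *\<^sub>v x) = (\<Sum>i<d. (\<Sum>j<d. A $$ (i, j) * x $ j)\<^sup>2)"
      using A x(1) by (simp add: scalar_prod_def lessThan_atLeast0 power2_eq_square)
    also have "\<dots> \<le> (\<Sum>i<d. (\<Sum>j<d. (A $$ (i, j))\<^sup>2) * (\<Sum>j<d. (x $ j)\<^sup>2))"
      by (rule sum_mono) (rule Cauchy_Schwarz_ineq_sum)
    also have "\<dots> \<le> (\<Sum>i<d. (\<Sum>j<d. (A $$ (i, j))\<^sup>2) * 1)"
      using x(2) by (intro sum_mono mult_left_mono sum_nonneg) auto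
    finally show "?f x \<le> sqrt (\<Sum>i<d. \<Sum>j<d. (A $$ (i, j))\<^sup>2)" by simp
  qed
  have "0\<^sub>v d \<in> ?X" by simp
  then have "?f ` ?X \<noteq> {}" by blast
  moreover have "mono (\<lambda>t. c * t)" using c by (intro monoI) simp
  ultimately have "c * Sup (?f ` ?X) = (SUP t\<in>?f ` ?X. c * t)"
    using bdd by (intro continuous_at_Sup_mono) (auto intro!: continuous_intros)
  also have "\<dots> = (SUP x\<in>?X. c * ?f x)" by (simp add: image_image)
  also have "\<dots> = (SUP x\<in>?X. sqrt (((c \<cdot>\<^sub>m A) *\<^sub>v x) \<bullet> ((c \<cdot>\<^sub>m A) *\<^sub>v x)))"
    by (rule SUP_cong[OF refl]) (simp add: f)
  finally show ?thesis using A by (simp add: Operator operator_norm_def)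
qed

section \<open>From the model to the limiting loss\<close>

text \<open>The population eigenvectors are chosen once for each n, before the sample point, so the
  noise they define is measurable and one null set serves all spikes.\<close>

lemma (in prob_space) DGF_spectral_limits:
  assumes DGF: "DGF_infinity M p r rho D"
  obtains u where
    "\<And>n. 0 < n \<Longrightarrow> eigensystem (p n) (pop_cov D n) (\<lambda>i. if i < r then spike D n i else 1) (u n)"
    "AE \<omega> in M. (\<forall>a<r. (\<lambda>n. sample_eval D n \<omega> a / aspect p n) \<longlonglongrightarrow> 1 + rho a) \<and>
      (\<forall>k<r. \<forall>a<r. (\<lambda>n. (dot (p n) (\<lambda>j. u n k $ j) (\<lambda>j. sample_evec D n \<omega> a $ j))\<^sup>2)
        \<longlonglongrightarrow> (if k = a then rho a / (1 + rho a) else 0))"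
proof -
  define e where "e n k = (if k < r then spike D n k else 1)" for n k
  have model: "spiked_model M n (p n) r (spike D n) (pop_cov D n) (obs D n)"
    and sample: "\<And>\<omega>. \<omega> \<in> space M \<Longrightarrow> eigensystem (p n) (sample_cov n (p n) (\<lambda>i. obs D n i \<omega>)) (sample_eval D n \<omega>) (sample_evec D n \<omega>)"
    if "0 < n" for n
    using DGF that by (simp_all add: DGF_infinity_def)
  have asp: "filterlim (aspect p) at_top sequentially"
    and rho: "\<And>i j. i < j \<Longrightarrow> j < r \<Longrightarrow> rho j < rho i" "\<And>i. i < r \<Longrightarrow> 0 \<le> rho i"
    and lim: "\<And>i. i < r \<Longrightarrow> (\<lambda>n. (spike D n i - 1) / aspect p n) \<longlonglongrightarrow> rho i"
    using DGF by (simp_all add: DGF_infinity_def)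
  have e1: "1 \<le> e n k" if "0 < n" for n k
    using model[OF that] by (simp add: spiked_model_def e_def)
  have rp: "r \<le> p n" if "0 < n" for n using model[OF that] by (simp add: spiked_model_def)
  have "\<exists>u. eigensystem (p n) (pop_cov D n) (e n) u" if "0 < n" for n
    using model[OF that] by (simp add: spiked_model_def e_def[abs_def])
  then obtain u where u: "\<And>n. 0 < n \<Longrightarrow> eigensystem (p n) (pop_cov D n) (e n) (u n)" by metis
  define z where "z n k i \<omega> = dot (p n) (\<lambda>j. u n k $ j) (obs D n i \<omega>) / sqrt (e n k)" for n k i \<omega>
  have white: "white_noise M n (p n) (z n)" if "0 < n" for n
    using spiked_model_white_noise[OF model[OF that] u[OF that] e1[OF that]] by (simp add: z_def[abs_def])
  have "AE \<omega> in M. (\<forall>a<r. (\<lambda>n. sample_eval D n \<omega> a / aspect p n) \<longlonglongrightarrow> 1 + rho a) \<and>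
      (\<forall>k<r. \<forall>a<r. (\<lambda>n. (dot (p n) (\<lambda>j. u n k $ j) (\<lambda>j. sample_evec D n \<omega> a $ j))\<^sup>2)
        \<longlonglongrightarrow> (if k = a then rho a / (1 + rho a) else 0))"
  proof (rule AE_mp, rule AE_near_isometric[OF asp], rule rp, assumption, rule white, assumption, intro AE_I2 impI)
    fix \<omega> assume \<omega>: "\<omega> \<in> space M"
    assume "\<exists>\<delta>. \<delta> \<longlonglongrightarrow> 0 \<and> (\<forall>n. 0 \<le> \<delta> n) \<and> (\<forall>\<^sub>F n in sequentially. near_isometric n (p n) r (\<lambda>k i. z n k i \<omega>) (\<delta> n))"
    then obtain \<delta> where \<delta>: "\<delta> \<longlonglongrightarrow> 0" "\<And>n. 0 \<le> \<delta> n"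
      "\<forall>\<^sub>F n in sequentially. near_isometric n (p n) r (\<lambda>k i. z n k i \<omega>) (\<delta> n)" by blast
    \<comment> \<open>Positivity of p n comes from 0 < r \<le> p n; for r = 0 the claims about
      spikes are vacuous.\<close>
    have spec: "sample_spectrum n (p n) r (e n) (sample_eval D n \<omega>) (\<lambda>k j. u n k $ j) (\<lambda>a j. sample_evec D n \<omega> a $ j) (\<lambda>i. obs D n i \<omega>)"
      if n: "0 < n" and r: "0 < r" for n
    proof
      show "0 < n" "0 < p n" "r \<le> p n" using n r rp[OF n] by auto
      show "orthobasis (p n) (\<lambda>k j. u n k $ j)" by (rule eigensystem_spectral(1)[OF u[OF n]])
      show "orthobasis (p n) (\<lambda>a j. sample_evec D n \<omega> a $ j)" by (rule eigensystem_spectral(1)[OF sample[OF n \<omega>]])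
      show "1 \<le> e n k" for k by (rule e1[OF n])
      show "r \<le> k \<Longrightarrow> e n k = 1" for k by (simp add: e_def)
      show "(\<Sum>i<n. obs D n i \<omega> j * obs D n i \<omega> k) / real n
          = (\<Sum>a<p n. sample_eval D n \<omega> a * sample_evec D n \<omega> a $ j * sample_evec D n \<omega> a $ k)"
        if "j < p n" "k < p n" for j k
        using eigensystem_spectral(2)[OF sample[OF n \<omega>] that] that by (simp add: sample_cov_def)
      show "sample_eval D n \<omega> b \<le> sample_eval D n \<omega> a" if "a \<le> b" "b < p n" for a b
        using sample[OF n \<omega>] that by (simp add: eigensystem_def)
    qed
    have "(\<lambda>n. (e n i - 1) / aspect p n) \<longlonglongrightarrow> rho i" if "i < r" for i
      using lim[OF that] that by (simp add: e_def)
    note limits = spectral_limits[OF spec asp rho this \<delta>(1,2) \<delta>(3)[unfolded z_def]]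
    show "(\<forall>a<r. (\<lambda>n. sample_eval D n \<omega> a / aspect p n) \<longlonglongrightarrow> 1 + rho a) \<and>
      (\<forall>k<r. \<forall>a<r. (\<lambda>n. (dot (p n) (\<lambda>j. u n k $ j) (\<lambda>j. sample_evec D n \<omega> a $ j))\<^sup>2)
        \<longlonglongrightarrow> (if k = a then rho a / (1 + rho a) else 0))"
    proof (intro conjI allI impI)
      fix a assume a: "a < r"
      then show "(\<lambda>n. sample_eval D n \<omega> a / aspect p n) \<longlonglongrightarrow> 1 + rho a" by (intro limits(1)) auto
    next
      fix k a assume k: "k < r" and a: "a < r"
      then show "(\<lambda>n. (dot (p n) (\<lambda>j. u n k $ j) (\<lambda>j. sample_evec D n \<omega> a $ j))\<^sup>2)
        \<longlonglongrightarrow> (if k = a then rho a / (1 + rho a) else 0)" by (intro limits(2)) auto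
    qed
  qed
  then show ?thesis using that u unfolding e_def[abs_def] by blast
qed

lemma opt_rule_descriptor:
  assumes asp: "filterlim (aspect p) at_top sequentially" and \<rho>: "0 \<le> \<rho>"
    and lam: "(\<lambda>n. lam n / aspect p n) \<longlonglongrightarrow> 1 + \<rho>"
  shows "(\<lambda>n. (opt_rule p \<kappa> n (lam n) - 1) / aspect p n) \<longlonglongrightarrow> opt_descriptor \<kappa> \<rho>"
proof -
  have "(\<lambda>n. lam n / aspect p n - 1) \<longlonglongrightarrow> 1 + \<rho> - 1" by (intro tendsto_intros lam)
  then have "(\<lambda>n. opt_descriptor \<kappa> (lam n / aspect p n - 1)) \<longlonglongrightarrow> opt_descriptor \<kappa> \<rho>"
    using \<rho> by (intro opt_descriptor_tendsto) simp_all
  moreover have "\<forall>\<^sub>F n in sequentially. opt_descriptor \<kappa> (lam n / aspect p n - 1) = (opt_rule p \<kappa> n (lam n) - 1) / aspect p n"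
    using asp[unfolded filterlim_at_top, rule_format, of 1]
    by eventually_elim (simp add: opt_rule_def)
  ultimately show ?thesis by (rule Lim_transform_eventually)
qed

text \<open>By completeness of u the population covariance is the identity plus a spike part; the
  identity cancels against that of the estimator, leaving 2 r rank-one terms.\<close>

lemma spike_difference:
  assumes S: "eigensystem d S (\<lambda>i. if i < r then ell i else 1) u" and r: "r \<le> d" and g: "0 < g"
  shows "loss1 \<kappa> S (shrinkage_estimator d r h lam v) / g
    = mat_norm \<kappa> (mat d d (\<lambda>(i, j). \<Sum>b<r. (ell b - 1) / g * u b $ i * u b $ j - (h (lam b) - 1) / g * v b $ i * v b $ j))"
proof -
  have S': "S \<in> carrier_mat d d" using S by (simp add: eigensystem_def)
  have E: "shrinkage_estimator d r h lam v \<in> carrier_mat d d" by (simp add: shrinkage_estimator_def)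
  have diff: "S - shrinkage_estimator d r h lam v \<in> carrier_mat d d" using S' E by (intro minus_carrier_mat)
  have "(1 / g) \<cdot>\<^sub>m (S - shrinkage_estimator d r h lam v)
    = mat d d (\<lambda>(i, j). \<Sum>b<r. (ell b - 1) / g * u b $ i * u b $ j - (h (lam b) - 1) / g * v b $ i * v b $ j)" (is "_ = ?R")
  proof (rule eq_matI)
    fix i j assume "i < dim_row ?R" "j < dim_col ?R"
    then have ij: "i < d" "j < d" by simp_all
    have "S $$ (i, j) = (\<Sum>k<d. u k $ i * u k $ j + (if k < r then (ell k - 1) * u k $ i * u k $ j else 0))"
      unfolding eigensystem_spectral(2)[OF S ij] by (intro sum.cong refl) (simp add: algebra_simps)
    also have "\<dots> = (if i = j then 1 else 0) + (\<Sum>k<d. if k < r then (ell k - 1) * u k $ i * u k $ j else 0)"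
      using eigensystem_spectral(1)[OF S] ij by (simp add: sum.distrib orthobasis_def)
    also have "(\<Sum>k<d. if k < r then (ell k - 1) * u k $ i * u k $ j else 0) = (\<Sum>k<r. (ell k - 1) * u k $ i * u k $ j)"
      using r by (intro sum.mono_neutral_cong_right) auto
    finally have Sij: "S $$ (i, j) = (if i = j then 1 else 0) + (\<Sum>k<r. (ell k - 1) * u k $ i * u k $ j)" .
    have "((1 / g) \<cdot>\<^sub>m (S - shrinkage_estimator d r h lam v)) $$ (i, j)
        = 1 / g * ((\<Sum>b<r. (ell b - 1) * u b $ i * u b $ j) - (\<Sum>b<r. (h (lam b) - 1) * v b $ i * v b $ j))"
      using S' E ij by (simp add: Sij shrinkage_estimator_def)
    also have "\<dots> = ?R $$ (i, j)"
      unfolding sum_subtractf[symmetric] sum_distrib_left using ij by (simp add: right_diff_distrib)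
    finally show "((1 / g) \<cdot>\<^sub>m (S - shrinkage_estimator d r h lam v)) $$ (i, j) = ?R $$ (i, j)" .
  qed (use S' E in simp_all)
  then show ?thesis
    using mat_norm_smult[OF diff, of "1 / g" \<kappa>] g by (simp add: loss1_def)
qed

lemma asym_loss_Frobenius_nonneg: "0 \<le> asym_loss Frobenius \<rho> \<theta>"
  by (simp add: asym_loss_def frobenius_norm_def Let_def sum_nonneg)

lemma aggregate_cong: "(\<And>i. i < r \<Longrightarrow> f i = g i) \<Longrightarrow> aggregate \<kappa> r f = aggregate \<kappa> r g"
  by (cases \<kappa>) (auto intro!: arg_cong[where f = Max] image_cong)

text \<open>Sums inherit a strict improvement in one coordinate. A maximum does not, since another
  spike may dominate it; this is why the operator norm is paired with a single spike.\<close>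

lemma total_asym_loss_strict_mono:
  assumes \<kappa>: "\<kappa> = Frobenius \<or> \<kappa> = Nuclear \<or> (\<kappa> = Operator \<and> r = 1)"
    and le: "\<And>i. i < r \<Longrightarrow> asym_loss \<kappa> (rho i) (\<theta> i) \<le> asym_loss \<kappa> (rho i) (\<theta>' i)"
    and less: "i < r" "asym_loss \<kappa> (rho i) (\<theta> i) < asym_loss \<kappa> (rho i) (\<theta>' i)"
  shows "total_asym_loss \<kappa> r rho \<theta> < total_asym_loss \<kappa> r rho \<theta>'"
  using \<kappa>
proof (elim disjE conjE)
  assume \<kappa>: "\<kappa> = Frobenius"
  have "(\<Sum>i<r. (asym_loss \<kappa> (rho i) (\<theta> i))\<^sup>2) < (\<Sum>i<r. (asym_loss \<kappa> (rho i) (\<theta>' i))\<^sup>2)"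
    using le less asym_loss_Frobenius_nonneg unfolding \<kappa>
    by (intro sum_strict_mono_ex1 ballI bexI[of _ i] power_mono power_strict_mono) auto
  then show ?thesis by (simp add: total_asym_loss_def \<kappa>)
next
  assume \<kappa>: "\<kappa> = Nuclear"
  have "(\<Sum>i<r. asym_loss \<kappa> (rho i) (\<theta> i)) < (\<Sum>i<r. asym_loss \<kappa> (rho i) (\<theta>' i))"
    using le less by (intro sum_strict_mono_ex1 ballI bexI[of _ i]) auto
  then show ?thesis by (simp add: total_asym_loss_def \<kappa>)
next
  assume "\<kappa> = Operator" "r = 1"
  then show ?thesis using less by (simp add: total_asym_loss_def lessThan_Suc)
qed

theorem theorem4p4:
  fixes M :: "'a measure" and p :: "nat \<Rightarrow> nat" and r :: nat and \<kappa> :: norm_kind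
  assumes "prob_space M"
    and "filterlim (aspect p) at_top sequentially"
    and "\<kappa> = Frobenius \<or> \<kappa> = Nuclear \<or> (\<kappa> = Operator \<and> r = 1)"
  shows "uniquely_admissible M p r \<kappa> (opt_rule p \<kappa>)"
proof -
  interpret prob_space M by fact
  note asp = assms(2) and \<kappa> = assms(3)
  have "0 \<le> aspect p n" for n by (simp add: aspect_def)
  then have rule: "shrinkage_rule (opt_rule p \<kappa>)"
    unfolding shrinkage_rule_def opt_rule_def
    by (auto intro!: add_nonneg_nonneg mult_nonneg_nonneg opt_descriptor_nonneg)
  have optimal: "everywhere_optimal M p r \<kappa> (opt_rule p \<kappa>)"
    unfolding everywhere_optimal_def
  proof (intro allI impI)
    fix rho and D :: "'a model_seq" assume DGF: "DGF_infinity M p r rho D"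
    have rho: "\<And>i. i < r \<Longrightarrow> 0 \<le> rho i"
      and lim: "\<And>i. i < r \<Longrightarrow> (\<lambda>n. (spike D n i - 1) / aspect p n) \<longlonglongrightarrow> rho i"
      and rp: "\<And>n. 0 < n \<Longrightarrow> r \<le> p n"
      and sample: "\<And>n \<omega>. 0 < n \<Longrightarrow> \<omega> \<in> space M \<Longrightarrow>
        eigensystem (p n) (sample_cov n (p n) (\<lambda>i. obs D n i \<omega>)) (sample_eval D n \<omega>) (sample_evec D n \<omega>)"
      using DGF by (simp_all add: DGF_infinity_def spiked_model_def)
    obtain u where u: "\<And>n. 0 < n \<Longrightarrow> eigensystem (p n) (pop_cov D n) (\<lambda>i. if i < r then spike D n i else 1) (u n)"
      and ae: "AE \<omega> in M. (\<forall>a<r. (\<lambda>n. sample_eval D n \<omega> a / aspect p n) \<longlonglongrightarrow> 1 + rho a) \<and>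
        (\<forall>k<r. \<forall>a<r. (\<lambda>n. (dot (p n) (\<lambda>j. u n k $ j) (\<lambda>j. sample_evec D n \<omega> a $ j))\<^sup>2)
          \<longlonglongrightarrow> (if k = a then rho a / (1 + rho a) else 0))"
      using DGF_spectral_limits[OF DGF] by blast
    show "AE \<omega> in M. (\<lambda>n. loss1 \<kappa> (pop_cov D n)
        (shrinkage_estimator (p n) r (opt_rule p \<kappa> n) (sample_eval D n \<omega>) (sample_evec D n \<omega>)) / aspect p n)
      \<longlonglongrightarrow> aggregate \<kappa> r (\<lambda>i. min_asym_loss \<kappa> (rho i))"
      using ae
    proof (rule AE_mp, intro AE_I2 impI, elim conjE)
      fix \<omega> assume \<omega>: "\<omega> \<in> space M"
      assume ev: "\<forall>a<r. (\<lambda>n. sample_eval D n \<omega> a / aspect p n) \<longlonglongrightarrow> 1 + rho a"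
        and ov: "\<forall>k<r. \<forall>a<r. (\<lambda>n. (dot (p n) (\<lambda>j. u n k $ j) (\<lambda>j. sample_evec D n \<omega> a $ j))\<^sup>2)
          \<longlonglongrightarrow> (if k = a then rho a / (1 + rho a) else 0)"
      define \<theta> where "\<theta> n b = (opt_rule p \<kappa> n (sample_eval D n \<omega> b) - 1) / aspect p n" for n b
      have \<theta>: "(\<lambda>n. \<theta> n b) \<longlonglongrightarrow> opt_descriptor \<kappa> (rho b)" if "b < r" for b
        unfolding \<theta>_def using ev that by (intro opt_rule_descriptor asp rho) auto
      have lim1: "(\<lambda>n. mat_norm \<kappa> (mat (p n) (p n) (\<lambda>(i, j). \<Sum>b<r. (spike D n b - 1) / aspect p n * u n b $ i * u n b $ j
            - \<theta> n b * sample_evec D n \<omega> b $ i * sample_evec D n \<omega> b $ j)))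
          \<longlonglongrightarrow> aggregate \<kappa> r (\<lambda>b. asym_loss \<kappa> (rho b) (opt_descriptor \<kappa> (rho b)))"
      proof (rule mat_norm_spike_difference_tendsto[OF _ _ _ rho lim \<theta> \<kappa>])
        fix n b c assume n: "0 < (n::nat)" and bc: "b < r" "c < r"
        have "b < p n" "c < p n" using bc rp[OF n] by auto
        then show "dot (p n) (\<lambda>j. u n b $ j) (\<lambda>j. u n c $ j) = (if b = c then 1 else 0)"
          "dot (p n) (\<lambda>j. sample_evec D n \<omega> b $ j) (\<lambda>j. sample_evec D n \<omega> c $ j) = (if b = c then 1 else 0)"
          using eigensystem_spectral(1)[OF u[OF n]] eigensystem_spectral(1)[OF sample[OF n \<omega>]]
          by (simp_all add: orthobasis_def)
      next
        fix b c assume "b < r" "c < r"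
        then show "(\<lambda>n. (dot (p n) (\<lambda>j. u n b $ j) (\<lambda>j. sample_evec D n \<omega> c $ j))\<^sup>2)
          \<longlonglongrightarrow> (if b = c then rho c / (1 + rho c) else 0)" using ov by blast
      qed
      have lim2: "\<forall>\<^sub>F n in sequentially. mat_norm \<kappa> (mat (p n) (p n) (\<lambda>(i, j). \<Sum>b<r. (spike D n b - 1) / aspect p n * u n b $ i * u n b $ j
            - \<theta> n b * sample_evec D n \<omega> b $ i * sample_evec D n \<omega> b $ j))
          = loss1 \<kappa> (pop_cov D n) (shrinkage_estimator (p n) r (opt_rule p \<kappa> n) (sample_eval D n \<omega>) (sample_evec D n \<omega>)) / aspect p n"
        using asp[unfolded filterlim_at_top, rule_format, of 1] eventually_gt_at_top[of 0]
      proof eventually_elim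
        case (elim n)
        then have "0 < aspect p n" by linarith
        from spike_difference[OF u[OF elim(2)] rp[OF elim(2)] this] show ?case by (simp add: \<theta>_def)
      qed
      have lim3: "aggregate \<kappa> r (\<lambda>b. asym_loss \<kappa> (rho b) (opt_descriptor \<kappa> (rho b)))
          = aggregate \<kappa> r (\<lambda>i. min_asym_loss \<kappa> (rho i))"
        by (rule aggregate_cong) (simp add: min_asym_loss_eq rho)
      show "(\<lambda>n. loss1 \<kappa> (pop_cov D n)
          (shrinkage_estimator (p n) r (opt_rule p \<kappa> n) (sample_eval D n \<omega>) (sample_evec D n \<omega>)) / aspect p n)
        \<longlonglongrightarrow> aggregate \<kappa> r (\<lambda>i. min_asym_loss \<kappa> (rho i))"
        using Lim_transform_eventually[OF lim1 lim2] unfolding lim3 .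
    qed
  qed
  have unique: "\<exists>rho D \<theta> \<theta>'. differing_descriptors_at M p r (opt_rule p \<kappa>) \<eta>' rho D \<theta> \<theta>' \<and>
      total_asym_loss \<kappa> r rho \<theta> < total_asym_loss \<kappa> r rho \<theta>'"
    if distinct: "somewhere_distinct M p r (opt_rule p \<kappa>) \<eta>'" for \<eta>'
  proof -
    obtain rho D \<theta> \<theta>' where diff: "differing_descriptors_at M p r (opt_rule p \<kappa>) \<eta>' rho D \<theta> \<theta>'"
      using distinct by (auto simp: somewhere_distinct_def)
    then have DGF: "DGF_infinity M p r rho D" and desc: "descriptors M p r (opt_rule p \<kappa>) D \<theta>"
      by (simp_all add: differing_descriptors_at_def)
    have rho: "\<And>i. i < r \<Longrightarrow> 0 \<le> rho i" using DGF by (simp add: DGF_infinity_def)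
    \<comment> \<open>Uniqueness of limits on a common set of full measure. The resulting equality
      does not involve the sample point, and on a probability space it therefore holds
      outright.\<close>
    have \<theta>: "\<theta> i = opt_descriptor \<kappa> (rho i)" if i: "i < r" for i
    proof -
      obtain u where "AE \<omega> in M. (\<forall>a<r. (\<lambda>n. sample_eval D n \<omega> a / aspect p n) \<longlonglongrightarrow> 1 + rho a) \<and>
          (\<forall>k<r. \<forall>a<r. (\<lambda>n. (dot (p n) (\<lambda>j. u n k $ j) (\<lambda>j. sample_evec D n \<omega> a $ j))\<^sup>2)
            \<longlonglongrightarrow> (if k = a then rho a / (1 + rho a) else 0))"
        using DGF_spectral_limits[OF DGF] by blast
      then have "AE \<omega> in M. (\<forall>a<r. (\<lambda>n. sample_eval D n \<omega> a / aspect p n) \<longlonglongrightarrow> 1 + rho a)"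
        by eventually_elim (rule conjunct1)
      moreover have "AE \<omega> in M. (\<lambda>n. (opt_rule p \<kappa> n (sample_eval D n \<omega> i) - 1) / aspect p n) \<longlonglongrightarrow> \<theta> i"
        using desc i by (simp add: descriptors_def)
      ultimately have "AE \<omega> in M. \<theta> i = opt_descriptor \<kappa> (rho i)"
      proof eventually_elim
        case (elim \<omega>)
        then show ?case
          using opt_rule_descriptor[OF asp rho[OF i], of "\<lambda>n. sample_eval D n \<omega> i" \<kappa>] i LIMSEQ_unique by blast
      qed
      then show ?thesis by simp
    qed
    obtain i where i: "i < r" "\<theta> i \<noteq> \<theta>' i" using diff by (auto simp: differing_descriptors_at_def)
    have "total_asym_loss \<kappa> r rho \<theta> < total_asym_loss \<kappa> r rho \<theta>'"
    proof (rule total_asym_loss_strict_mono[OF \<kappa> _ i(1)])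
      show "asym_loss \<kappa> (rho j) (\<theta> j) \<le> asym_loss \<kappa> (rho j) (\<theta>' j)" if "j < r" for j
        using asym_loss_unique_minimum[OF rho[OF that], of "\<theta>' j" \<kappa>] \<theta>[OF that]
        by (cases "\<theta>' j = opt_descriptor \<kappa> (rho j)") auto
      show "asym_loss \<kappa> (rho i) (\<theta> i) < asym_loss \<kappa> (rho i) (\<theta>' i)"
        using asym_loss_unique_minimum[OF rho[OF i(1)], of "\<theta>' i" \<kappa>] \<theta>[OF i(1)] i(2) by simp
    qed
    then show ?thesis using diff by blast
  qed
  show ?thesis
    unfolding uniquely_admissible_def using rule optimal unique by blast
qed

end
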